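(* Let $N$ be a smooth manifold of dimension $n\ge2$ with a projective structure $[D]$. Let $(\mathcal C,\nabla)$ be the Thomas cone of $(N,[D])$ with its Thomas cone connection, let $(\mathbf M,\mathbf g)$ be $\mathbf M=T^*\mathcal C$ with the Patterson--Walker metric $\mathbf g$ of $\nabla$, and let $(M,[g])$ be the conformal structure of signature $(n,n)$ induced by $[D]$ on the projectively weighted cotangent bundle $M$ of $N$ (all defined in the context). Then the two constructions $$(N,[D])\rightsquigarrow(\mathcal C,\nabla)\rightsquigarrow(\mathbf M,\mathbf g)\qquad\text{and}\qquad (N,[D])\rightsquigarrow(M,[g])\rightsquigarrow(\text{Fefferman--Graham ambient metric of }[g])$$ commute: $(\mathbf M,\mathbf g)$ is a Fefferman--Graham ambient metric for $(M,[g])$ (with respect to the identification $\mathbf M\cong\mathbb R_+\times M\times\mathbb R$ given in the context, for the representative metric $g$ determined by any choice of scale). In particular, the induced conformal structure $[g]$ admits a globally Ricci-flat Fefferman--Graham ambient metric $\mathbf g$ which is itself a Patterson--Walker metric.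
   Context: Summation over repeated indices is understood, and $\alpha\odot\beta=\tfrac12(\alpha\otimes\beta+\beta\otimes\alpha)$. **Projective structures and scales.** Torsion-free affine connections $D,D'$ on $N$ are projectively equivalent if there is a $1$-form $\Upsilon$ with $D'_XY=D_XY+\Upsilon(X)Y+\Upsilon(Y)X$ for all vector fields $X,Y$. A projective structure $[D]$ is an equivalence class; only special connections in $[D]$, i.e. those preserving a volume form (up to sign, i.e. a positive density), are used. For $w\in\mathbb R$ put $\mathcal E(w)=(\wedge^nTN)^{-w/(n+1)}$ (a density bundle), and let $\mathcal E_+(1)$ be the ray bundle of positive elements of $\mathcal E(1)$. A section $s:N\to\mathcal E_+(1)$ (a scale) corresponds to the special connection $D\in[D]$ with $Ds=0$; the scale $s'=e^fs$ corresponds to the connection $D'$ given by $D'_XY=D_XY+\Upsilon(X)Y+\Upsilon(Y)X$ with $\Upsilon=df$. **Patterson--Walker metric.** For a torsion-free affine connection $D$ preserving a volume form on a manifold $N$, with local coordinates $x^A$, induced fibre coordinates $p_A$ on $T^*N$, and Christoffel symbols $D_{\partial_A}\partial_B=\Gamma_A{}^C{}_B\partial_C$, the Patterson--Walker metric on $T^*N$ is $$g=2\,dx^A\odot dp_A-2\,\Gamma_A{}^C{}_B\,p_C\,dx^A\odot dx^B .$$ **The conformal structure $(M,[g])$.** Let $M=T^*N\otimes\mathcal E(-2)=T^*N\otimes(\wedge^nTN)^{2/(n+1)}$. A scale $s$ identifies $T^*N\cong M$ by $p\mapsto p\otimes s^{-2}$, and so transports the Patterson--Walker metric of the corresponding connection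 $D$ to a metric on $M$. The metrics obtained from different scales are conformally related ($s'=e^fs$ gives $g'=e^{2f}g$), and $[g]$ denotes their conformal class. **Thomas cone.** $\mathcal C=\mathcal E_+(1)$. A scale $s$, with connection $D$, gives a trivialization $\mathbb R_+\times N\cong\mathcal C$, $(x^0,x)\mapsto x^0s(x)$. Let $Z=x^0\partial_{x^0}$ be the Euler field. The Thomas cone connection $\nabla$ is the torsion-free affine connection on $\mathcal C$ given in this trivialization by $$\nabla_XY=D_XY-\tfrac1{n-1}\mathrm{Ric}(X,Y)Z,\qquad \nabla Z=\mathrm{id}_{T\mathcal C},$$ for vector fields $X,Y$ on $N$ (lifted to $\mathbb R_+\times N$ in the obvious way), where $\mathrm{Ric}(Y,W)=\mathrm{tr}(X\mapsto R(X,Y)W)$, with $R(X,Y)W=D_XD_YW-D_YD_XW-D_{[X,Y]}W$, is the Ricci tensor of $D$. It is independent of the chosen scale. **Identification of $\mathbf M$.** Let $s$ be a scale, $x^A$ local coordinates on $N$, $(x^0,x^A)$ the resulting coordinates on $\mathcal C$, and $(x^0,x^A,y_A,y_0)$ the canonical coordinates on $T^*\mathcal C$. Then $t=x^0$, $\rho=y_0/x^0$, $p_A=y_A/(x^0)^2$ defines a diffeomorphism $T^*\mathcal C\cong\mathbb R_+\times T^*N\times\mathbb R\cong\mathbb R_+\times M\times\mathbb R$, with coordinates $(t,(x^A,p_A),\rho)$. **Fefferman--Graham ambient metric.** For a pseudo-Riemannian manifold $(M,g)$ of signature $(p,q)$, a globally Ricci-flat Fefferman--Graham ambient metric for $[g]$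 is a metric $\mathbf g$ of signature $(p+1,q+1)$ on $\mathbb R_+\times M\times\mathbb R$, with coordinates $(t,x,\rho)$, of the form $$\mathbf g=t^2g_{ij}(x,\rho)\,dx^i\odot dx^j+2\rho\,dt\odot dt+2t\,dt\odot d\rho,$$ with $g_{ij}(x,0)\,dx^i\odot dx^j=g$ and $\mathrm{Ric}(\mathbf g)=0$ everywhere. *)

theory Defs
  imports "HOL-Analysis.Analysis"
begin

section \<open>Smooth manifolds\<close>

primrec Ck_on :: "nat \<Rightarrow> 'a::euclidean_space set \<Rightarrow> ('a \<Rightarrow> 'b::real_normed_vector) \<Rightarrow> bool" where
  "Ck_on 0 S f \<longleftrightarrow> continuous_on S f"
| "Ck_on (Suc k) S f \<longleftrightarrow>
     (\<forall>x\<in>S. f differentiable (at x)) \<and> (\<forall>v. Ck_on k S (\<lambda>x. frechet_derivative f (at x) v))"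

text \<open>Meant for open \<open>S\<close>.\<close>

definition smooth_on :: "'a::euclidean_space set \<Rightarrow> ('a \<Rightarrow> 'b::real_normed_vector) \<Rightarrow> bool" where
  "smooth_on S f \<longleftrightarrow> (\<forall>k. Ck_on k S f)"

text \<open>An indexed atlas on the set \<open>points\<close>, with charts \<open>coord i\<close> defined on \<open>cdom i\<close>.  The charts of
  a manifold induce charts of its bundles, so geometric objects are given by their components in the
  charts, as families over the index type subject to the usual transformation laws.  Components are
  functions on the coordinate domain \<open>img A i\<close>; their values elsewhere are irrelevant.\<close>

record ('i, 'a, 'v) atlas =
  points :: "'a set"
  indices :: "'i set"
  cdom :: "'i \<Rightarrow> 'a set"
  coord :: "'i \<Rightarrow> 'a \<Rightarrow> 'v"

definition img :: "('i, 'a, 'v) atlas \<Rightarrow> 'i \<Rightarrow> 'v set" where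
  "img A i = coord A i ` cdom A i"

definition inv_coord :: "('i, 'a, 'v) atlas \<Rightarrow> 'i \<Rightarrow> 'v \<Rightarrow> 'a" where
  "inv_coord A i = inv_into (cdom A i) (coord A i)"

definition overlap :: "('i, 'a, 'v) atlas \<Rightarrow> 'i \<Rightarrow> 'i \<Rightarrow> 'v set" where
  "overlap A i j = coord A i ` (cdom A i \<inter> cdom A j)"

definition trans_map :: "('i, 'a, 'v) atlas \<Rightarrow> 'i \<Rightarrow> 'i \<Rightarrow> 'v \<Rightarrow> 'v" where
  "trans_map A i j = coord A j \<circ> inv_coord A i"

definition jac :: "('i, 'a, 'v::euclidean_space) atlas \<Rightarrow> 'i \<Rightarrow> 'i \<Rightarrow> 'v \<Rightarrow> 'v \<Rightarrow> 'v" where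
  "jac A i j x = frechet_derivative (trans_map A i j) (at x)"

definition atlas_topology :: "('i, 'a, 'v::topological_space) atlas \<Rightarrow> 'a topology" where
  "atlas_topology A =
     topology (\<lambda>U. U \<subseteq> points A \<and> (\<forall>i\<in>indices A. open (coord A i ` (U \<inter> cdom A i))))"

definition smooth_manifold :: "('i, 'a, 'v::euclidean_space) atlas \<Rightarrow> bool" where
  "smooth_manifold A \<longleftrightarrow>
     (\<Union>i\<in>indices A. cdom A i) = points A \<and>
     (\<forall>i\<in>indices A. inj_on (coord A i) (cdom A i)) \<and>
     (\<forall>i\<in>indices A. \<forall>j\<in>indices A.
        open (overlap A i j) \<and> smooth_on (overlap A i j) (trans_map A i j)) \<and>
     Hausdorff_space (atlas_topology A) \<and> second_countable (atlas_topology A)"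

definition smooth_map ::
  "('i, 'a, 'v::euclidean_space) atlas \<Rightarrow> ('j, 'b, 'w::euclidean_space) atlas \<Rightarrow> ('a \<Rightarrow> 'b) \<Rightarrow> bool" where
  "smooth_map A B F \<longleftrightarrow> F ` points A \<subseteq> points B \<and>
     (\<forall>q\<in>points A. \<exists>i\<in>indices A. \<exists>j\<in>indices B. q \<in> cdom A i \<and> F ` cdom A i \<subseteq> cdom B j \<and>
        smooth_on (img A i) (coord B j \<circ> F \<circ> inv_coord A i))"

definition diffeomorphism ::
  "('i, 'a, 'v::euclidean_space) atlas \<Rightarrow> ('j, 'b, 'w::euclidean_space) atlas \<Rightarrow> ('a \<Rightarrow> 'b) \<Rightarrow> bool" where
  "diffeomorphism A B F \<longleftrightarrow> bij_betw F (points A) (points B) \<and>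
     smooth_map A B F \<and> smooth_map B A (inv_into (points A) F)"

definition smooth_function :: "('i, 'a, 'v::euclidean_space) atlas \<Rightarrow> ('i \<Rightarrow> 'v \<Rightarrow> real) \<Rightarrow> bool" where
  "smooth_function A f \<longleftrightarrow> (\<forall>i\<in>indices A. smooth_on (img A i) (f i) \<and>
     (\<forall>j\<in>indices A. \<forall>x\<in>overlap A i j. f j (trans_map A i j x) = f i x))"

definition one_form :: "('i, 'a, 'v::euclidean_space) atlas \<Rightarrow> ('i \<Rightarrow> 'v \<Rightarrow> 'v \<Rightarrow> real) \<Rightarrow> bool" where
  "one_form A \<Upsilon> \<longleftrightarrow> (\<forall>i\<in>indices A.
     (\<forall>x\<in>img A i. linear (\<Upsilon> i x)) \<and> (\<forall>v. smooth_on (img A i) (\<lambda>x. \<Upsilon> i x v)) \<and>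
     (\<forall>j\<in>indices A. \<forall>x\<in>overlap A i j. \<forall>v. \<Upsilon> j (trans_map A i j x) (jac A i j x v) = \<Upsilon> i x v))"


section \<open>Traces, determinants, densities\<close>

definition eucl_trace :: "('v::euclidean_space \<Rightarrow> 'v) \<Rightarrow> real" where
  "eucl_trace f = (\<Sum>b\<in>Basis. f b \<bullet> b)"

text \<open>The determinant of an endomorphism; on \<open>real^'n\<close> it is the library's determinant (lemma below),
  which does not cover product spaces such as \<open>real \<times> real^'n\<close>.\<close>

definition eucl_det :: "('v::euclidean_space \<Rightarrow> 'v) \<Rightarrow> real" where
  "eucl_det f = (\<Sum>\<pi> | \<pi> permutes Basis. of_int (sign \<pi>) * (\<Prod>b\<in>Basis. f (\<pi> b) \<bullet> b))"

lemma eucl_det_eq_det: "eucl_det (f :: real^'n \<Rightarrow> real^'n) = det (matrix f)"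
proof -
  let ?e = "\<lambda>i::'n. axis i (1::real)"
  have bij: "bij_betw ?e UNIV Basis"
    unfolding bij_betw_def by (auto simp: inj_on_def axis_eq_axis Basis_vec_def)
  have inj: "inj ?e" and img: "range ?e = Basis"
    using bij by (auto simp: bij_betw_def)
  have axis_inv: "axis (inv ?e x) 1 = x" if "x \<in> Basis" for x
    using f_inv_into_f[of x ?e UNIV] that img by blast
  let ?m = "map_permutation UNIV ?e"
  let ?m' = "map_permutation Basis (inv_into UNIV ?e)"
  have m_axis: "?m p (axis i 1) = axis (p i) 1" for p i
    unfolding map_permutation_def img
    by (simp add: restrict_id_def inv_into_f_f[OF inj])
  have "det (matrix f) =
      (\<Sum>p | p permutes UNIV. of_int (sign p) * (\<Prod>i\<in>UNIV. f (axis (p i) 1) $ i))"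
    by (simp add: det_def matrix_def)
  also have "\<dots> = (\<Sum>\<pi> | \<pi> permutes Basis. of_int (sign \<pi>) * (\<Prod>b\<in>Basis. f (\<pi> b) \<bullet> b))"
  proof (rule sum.reindex_bij_witness[of _ "?m'" "?m"])
    fix p :: "'n \<Rightarrow> 'n" assume p: "p \<in> {p. p permutes UNIV}"
    show "?m' (?m p) = p"
      using p bij by (subst map_permutation_compose[OF bij])
        (auto simp: bij_betw_def inj_on_inv_into o_def inv_into_f_f[OF inj])
    show "?m p \<in> {\<pi>. \<pi> permutes Basis}"
      using p map_permutation_permutes[OF bij] by auto
    have "(\<Prod>b\<in>Basis. f (?m p b) \<bullet> b) = (\<Prod>i\<in>UNIV. f (?m p (?e i)) \<bullet> ?e i)"
      by (rule prod.reindex_bij_betw[OF bij, symmetric])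
    moreover have "sign (?m p) = sign p"
      using p inj by (intro sign_map_permutation) auto
    ultimately show "of_int (sign (?m p)) * (\<Prod>b\<in>Basis. f (?m p b) \<bullet> b)
        = of_int (sign p) * (\<Prod>i\<in>UNIV. f (axis (p i) 1) $ i)"
      by (simp add: m_axis inner_axis)
  next
    fix \<pi> :: "real^'n \<Rightarrow> real^'n" assume \<pi>: "\<pi> \<in> {\<pi>. \<pi> permutes Basis}"
    have bij': "bij_betw (inv_into UNIV ?e) Basis UNIV"
      by (rule bij_betw_inv_into[OF bij])
    show "?m' \<pi> \<in> {p. p permutes UNIV}"
      using \<pi> map_permutation_permutes[OF bij'] by auto
    have "?m (?m' \<pi>) = map_permutation Basis (?e \<circ> inv_into UNIV ?e) \<pi>"
      by (rule map_permutation_compose[OF bij' inj])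
    also have "\<dots> = map_permutation Basis id \<pi>"
      using \<pi> bij by (intro map_permutation_cong)
        (auto simp: axis_inv inj_on_def)
    finally show "?m (?m' \<pi>) = \<pi>" using \<pi> by simp
  qed
  finally show ?thesis unfolding eucl_det_def by simp
qed

definition abs_jac_det :: "('i, 'a, 'v::euclidean_space) atlas \<Rightarrow> 'i \<Rightarrow> 'i \<Rightarrow> 'v \<Rightarrow> real" where
  "abs_jac_det A i j x = \<bar>eucl_det (jac A i j x)\<bar>"

text \<open>A section of \<open>\<E>(w) = (\<Lambda>\<^sup>n T)\<^bsup>-w/(n+1)\<^esup>\<close> has one component per chart, taken with respect to
  \<open>|\<partial>\<^sub>1 \<and> \<dots> \<and> \<partial>\<^sub>n|\<^bsup>-w/(n+1)\<^esup>\<close>; it is multiplied by the following factor when passing from chart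
  \<open>i\<close> to chart \<open>j\<close>.\<close>

definition weight_factor ::
  "real \<Rightarrow> ('i, 'a, 'v::euclidean_space) atlas \<Rightarrow> 'i \<Rightarrow> 'i \<Rightarrow> 'v \<Rightarrow> real" where
  "weight_factor w A i j x = abs_jac_det A i j x powr (- w / (real DIM('v) + 1))"

definition is_scale :: "('i, 'a, 'v::euclidean_space) atlas \<Rightarrow> ('i \<Rightarrow> 'v \<Rightarrow> real) \<Rightarrow> bool" where
  "is_scale A s \<longleftrightarrow> (\<forall>i\<in>indices A. smooth_on (img A i) (s i) \<and> (\<forall>x\<in>img A i. s i x > 0) \<and>
     (\<forall>j\<in>indices A. \<forall>x\<in>overlap A i j. s j (trans_map A i j x) = weight_factor 1 A i j x * s i x))"


section \<open>Connections\<close>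

text \<open>A connection is given by Christoffel symbols in the charts:
  in the chart \<open>i\<close>, \<open>D\<^sub>X Y = dY(X) + D i x X Y\<close>.\<close>

type_synonym ('i, 'v) connection = "'i \<Rightarrow> 'v \<Rightarrow> 'v \<Rightarrow> 'v \<Rightarrow> 'v"

definition affine_connection ::
  "('i, 'a, 'v::euclidean_space) atlas \<Rightarrow> ('i, 'v) connection \<Rightarrow> bool" where
  "affine_connection A D \<longleftrightarrow> (\<forall>i\<in>indices A.
     (\<forall>x\<in>img A i. bilinear (D i x)) \<and> (\<forall>u v. smooth_on (img A i) (\<lambda>x. D i x u v)) \<and>
     (\<forall>j\<in>indices A. \<forall>x\<in>overlap A i j. \<forall>u v.
        D j (trans_map A i j x) (jac A i j x u) (jac A i j x v) =
          jac A i j x (D i x u v) - frechet_derivative (\<lambda>y. jac A i j y v) (at x) u))"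

definition torsion_free_connection ::
  "('i, 'a, 'v::euclidean_space) atlas \<Rightarrow> ('i, 'v) connection \<Rightarrow> bool" where
  "torsion_free_connection A D \<longleftrightarrow> affine_connection A D \<and>
     (\<forall>i\<in>indices A. \<forall>x\<in>img A i. \<forall>u v. D i x u v = D i x v u)"

text \<open>Torsion-free and preserving a positive density \<open>\<nu>\<close>, i.e. a volume form up to sign.\<close>

definition special_connection ::
  "('i, 'a, 'v::euclidean_space) atlas \<Rightarrow> ('i, 'v) connection \<Rightarrow> bool" where
  "special_connection A D \<longleftrightarrow> torsion_free_connection A D \<and>
     (\<exists>\<nu> :: 'i \<Rightarrow> 'v \<Rightarrow> real. \<forall>i\<in>indices A. smooth_on (img A i) (\<nu> i) \<and>
        (\<forall>x\<in>img A i. \<nu> i x > 0 \<and>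
           (\<forall>u. frechet_derivative (\<nu> i) (at x) u - eucl_trace (D i x u) * \<nu> i x = 0)) \<and>
        (\<forall>j\<in>indices A. \<forall>x\<in>overlap A i j. \<nu> j (trans_map A i j x) * abs_jac_det A i j x = \<nu> i x))"

text \<open>\<open>D s = 0\<close>.  The connection induced on \<open>\<Lambda>\<^sup>n T\<close> is \<open>d + tr D\<close>, hence on \<open>\<E>(1)\<close> it is
  \<open>d - tr D / (n + 1)\<close>.\<close>

definition parallel_scale ::
  "('i, 'a, 'v::euclidean_space) atlas \<Rightarrow> ('i, 'v) connection \<Rightarrow> ('i \<Rightarrow> 'v \<Rightarrow> real) \<Rightarrow> bool" where
  "parallel_scale A D s \<longleftrightarrow> (\<forall>i\<in>indices A. \<forall>x\<in>img A i. \<forall>u.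
     frechet_derivative (s i) (at x) u - eucl_trace (D i x u) / (real DIM('v) + 1) * s i x = 0)"

definition projectively_equivalent ::
  "('i, 'a, 'v::euclidean_space) atlas \<Rightarrow> ('i, 'v) connection \<Rightarrow> ('i, 'v) connection \<Rightarrow> bool" where
  "projectively_equivalent A D D' \<longleftrightarrow> (\<exists>\<Upsilon>. one_form A \<Upsilon> \<and>
     (\<forall>i\<in>indices A. \<forall>x\<in>img A i. \<forall>u v. D' i x u v = D i x u v + \<Upsilon> i x u *\<^sub>R v + \<Upsilon> i x v *\<^sub>R u))"

definition projective_structure ::
  "('i, 'a, 'v::euclidean_space) atlas \<Rightarrow> ('i, 'v) connection set \<Rightarrow> bool" where
  "projective_structure A P \<longleftrightarrow>
     P \<in> {D. torsion_free_connection A D} //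
       {(D, D'). torsion_free_connection A D \<and> torsion_free_connection A D' \<and>
                 projectively_equivalent A D D'}"

text \<open>Unique up to irrelevant values outside the coordinate domains.\<close>

definition scale_connection ::
  "('i, 'a, 'v::euclidean_space) atlas \<Rightarrow> ('i, 'v) connection set \<Rightarrow> ('i \<Rightarrow> 'v \<Rightarrow> real) \<Rightarrow> ('i, 'v) connection"
  where "scale_connection A P s = (SOME D. D \<in> P \<and> parallel_scale A D s)"

text \<open>Curvature \<open>R(u,v)w\<close> and Ricci tensor in one chart, for the connection \<open>d + \<Gamma>\<close>.\<close>

definition curvature :: "('v::euclidean_space \<Rightarrow> 'v \<Rightarrow> 'v \<Rightarrow> 'v) \<Rightarrow> 'v \<Rightarrow> 'v \<Rightarrow> 'v \<Rightarrow> 'v \<Rightarrow> 'v" where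
  "curvature \<Gamma> x u v w =
     frechet_derivative (\<lambda>y. \<Gamma> y v w) (at x) u - frechet_derivative (\<lambda>y. \<Gamma> y u w) (at x) v
     + \<Gamma> x u (\<Gamma> x v w) - \<Gamma> x v (\<Gamma> x u w)"

definition ricci :: "('v::euclidean_space \<Rightarrow> 'v \<Rightarrow> 'v \<Rightarrow> 'v) \<Rightarrow> 'v \<Rightarrow> 'v \<Rightarrow> 'v \<Rightarrow> real" where
  "ricci \<Gamma> x v w = eucl_trace (\<lambda>u. curvature \<Gamma> x u v w)"


section \<open>Pseudo-Riemannian metrics\<close>

type_synonym ('i, 'v) metric_field = "'i \<Rightarrow> 'v \<Rightarrow> 'v \<Rightarrow> 'v \<Rightarrow> real"

definition has_signature :: "nat \<Rightarrow> nat \<Rightarrow> ('v::euclidean_space \<Rightarrow> 'v \<Rightarrow> real) \<Rightarrow> bool" where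
  "has_signature p q \<beta> \<longleftrightarrow> bilinear \<beta> \<and> (\<forall>u v. \<beta> u v = \<beta> v u) \<and>
     (\<exists>V W. subspace V \<and> subspace W \<and> dim V = p \<and> dim W = q \<and> span (V \<union> W) = UNIV \<and>
        (\<forall>u\<in>V. \<forall>v\<in>W. \<beta> u v = 0) \<and>
        (\<forall>u\<in>V. u \<noteq> 0 \<longrightarrow> \<beta> u u > 0) \<and> (\<forall>v\<in>W. v \<noteq> 0 \<longrightarrow> \<beta> v v < 0))"

definition pseudo_metric ::
  "('i, 'a, 'v::euclidean_space) atlas \<Rightarrow> nat \<Rightarrow> nat \<Rightarrow> ('i, 'v) metric_field \<Rightarrow> bool" where
  "pseudo_metric A p q G \<longleftrightarrow> (\<forall>i\<in>indices A.
     (\<forall>x\<in>img A i. has_signature p q (G i x)) \<and> (\<forall>u v. smooth_on (img A i) (\<lambda>x. G i x u v)) \<and>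
     (\<forall>j\<in>indices A. \<forall>x\<in>overlap A i j. \<forall>u v.
        G j (trans_map A i j x) (jac A i j x u) (jac A i j x v) = G i x u v))"

definition levi_civita ::
  "('v::euclidean_space \<Rightarrow> 'v \<Rightarrow> 'v \<Rightarrow> real) \<Rightarrow> 'v \<Rightarrow> 'v \<Rightarrow> 'v \<Rightarrow> 'v" where
  "levi_civita G x u v = (THE w. \<forall>z. 2 * G x w z =
     frechet_derivative (\<lambda>y. G y v z) (at x) u + frechet_derivative (\<lambda>y. G y u z) (at x) v
     - frechet_derivative (\<lambda>y. G y u v) (at x) z)"

definition ricci_flat ::
  "('i, 'a, 'v::euclidean_space) atlas \<Rightarrow> ('i, 'v) metric_field \<Rightarrow> bool" where
  "ricci_flat A G \<longleftrightarrow>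
     (\<forall>i\<in>indices A. \<forall>x\<in>img A i. \<forall>u v. ricci (levi_civita (G i)) x u v = 0)"

text \<open>The metric on \<open>B\<close> corresponding to the metric \<open>G\<close> on \<open>A\<close> under a diffeomorphism
  \<open>F : A \<rightarrow> B\<close>, i.e. the pullback of \<open>G\<close> along the inverse of \<open>F\<close>.  The choice of the chart \<open>i\<close> of \<open>A\<close>
  does not matter by the transformation law of \<open>G\<close>.\<close>

definition transport ::
  "('i, 'a, 'v::euclidean_space) atlas \<Rightarrow> ('j, 'b, 'w::euclidean_space) atlas \<Rightarrow> ('a \<Rightarrow> 'b) \<Rightarrow>
   ('i, 'v) metric_field \<Rightarrow> ('j, 'w) metric_field" where
  "transport A B F G j y u v =
     (let h = inv_into (points A) F \<circ> inv_coord B j;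
          i = (SOME i. i \<in> indices A \<and> h y \<in> cdom A i);
          L = frechet_derivative (coord A i \<circ> h) (at y)
      in G i (coord A i (h y)) (L u) (L v))"

definition conformal_metrics ::
  "('i, 'a, 'v::euclidean_space) atlas \<Rightarrow> ('i, 'v) metric_field \<Rightarrow> ('i, 'v) metric_field \<Rightarrow> bool" where
  "conformal_metrics A g g' \<longleftrightarrow> (\<exists>\<Omega>. smooth_function A \<Omega> \<and>
     (\<forall>i\<in>indices A. \<forall>x\<in>img A i. \<Omega> i x > 0 \<and> (\<forall>u v. g' i x u v = (\<Omega> i x)\<^sup>2 * g i x u v)))"


section \<open>Cotangent bundles and Patterson--Walker metrics\<close>

text \<open>Covectors (possibly weighted) at \<open>x\<close> are families of components over the charts around \<open>x\<close>,
  covectors of the model space being represented by vectors via the inner product;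
  \<open>c\<close> is the transition factor of the weight.  Components in charts not containing \<open>x\<close> are set to \<open>0\<close>,
  to make the representation unique.\<close>

definition covector_bundle ::
  "('i \<Rightarrow> 'i \<Rightarrow> 'v \<Rightarrow> real) \<Rightarrow> ('i, 'a, 'v::euclidean_space) atlas \<Rightarrow> ('i, 'a \<times> ('i \<Rightarrow> 'v), 'v \<times> 'v) atlas" where
  "covector_bundle c A =
    (let E = {(x, \<eta>). x \<in> points A \<and>
               (\<forall>i\<in>indices A. \<forall>j\<in>indices A. x \<in> cdom A i \<inter> cdom A j \<longrightarrow>
                  (\<forall>v. \<eta> j \<bullet> jac A i j (coord A i x) v = c i j (coord A i x) * (\<eta> i \<bullet> v))) \<and>
               (\<forall>i. \<not> (i \<in> indices A \<and> x \<in> cdom A i) \<longrightarrow> \<eta> i = 0)}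
     in \<lparr>points = E, indices = indices A,
         cdom = (\<lambda>i. {(x, \<eta>) \<in> E. x \<in> cdom A i}),
         coord = (\<lambda>i (x, \<eta>). (coord A i x, \<eta> i))\<rparr>)"

definition cotangent ::
  "('i, 'a, 'v::euclidean_space) atlas \<Rightarrow> ('i, 'a \<times> ('i \<Rightarrow> 'v), 'v \<times> 'v) atlas" where
  "cotangent A = covector_bundle (\<lambda>i j x. 1) A"

definition weighted_cotangent ::
  "real \<Rightarrow> ('i, 'a, 'v::euclidean_space) atlas \<Rightarrow> ('i, 'a \<times> ('i \<Rightarrow> 'v), 'v \<times> 'v) atlas" where
  "weighted_cotangent w A = covector_bundle (weight_factor w A) A"

text \<open>\<open>2 dx\<^sup>A \<odot> dp\<^sub>A - 2 \<Gamma>\<^sub>A\<^sup>C\<^sub>B p\<^sub>C dx\<^sup>A \<odot> dx\<^sup>B\<close> at \<open>(x, p)\<close>, evaluated on \<open>(u, \<alpha>)\<close> and \<open>(v, \<beta>)\<close>.\<close>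

definition patterson_walker :: "('i, 'v::euclidean_space) connection \<Rightarrow> ('i, 'v \<times> 'v) metric_field" where
  "patterson_walker D i = (\<lambda>(x, p) (u, \<alpha>) (v, \<beta>).
     u \<bullet> \<beta> + v \<bullet> \<alpha> - (D i x u v + D i x v u) \<bullet> p)"

text \<open>\<open>(B, G)\<close> is, up to the diffeomorphism, \<open>T*X\<close> with the Patterson--Walker metric of a connection.\<close>

definition is_patterson_walker_of ::
  "('i, 'a, 'v::euclidean_space) atlas \<Rightarrow> ('j, 'b, 'w::euclidean_space) atlas \<Rightarrow> ('j, 'w) metric_field \<Rightarrow> bool" where
  "is_patterson_walker_of X B G \<longleftrightarrow> (\<exists>D F. special_connection X D \<and>
     diffeomorphism (cotangent X) B F \<and> G = transport (cotangent X) B F (patterson_walker D))"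


section \<open>The induced conformal structure\<close>

text \<open>\<open>T*N \<rightarrow> T*N \<otimes> \<E>(-2)\<close>, \<open>p \<mapsto> p \<otimes> s\<^bsup>-2\<^esup>\<close>.\<close>

definition scale_iso ::
  "('i, 'a, 'v::euclidean_space) atlas \<Rightarrow> ('i \<Rightarrow> 'v \<Rightarrow> real) \<Rightarrow> 'a \<times> ('i \<Rightarrow> 'v) \<Rightarrow> 'a \<times> ('i \<Rightarrow> 'v)" where
  "scale_iso N s = (\<lambda>(x, p). (x, \<lambda>i. p i /\<^sub>R (s i (coord N i x))\<^sup>2))"

definition induced_metric ::
  "('i, 'a, 'v::euclidean_space) atlas \<Rightarrow> ('i, 'v) connection set \<Rightarrow> ('i \<Rightarrow> 'v \<Rightarrow> real) \<Rightarrow>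
   ('i, 'v \<times> 'v) metric_field" where
  "induced_metric N P s = transport (cotangent N) (weighted_cotangent (-2) N) (scale_iso N s)
     (patterson_walker (scale_connection N P s))"

definition induced_conformal_structure ::
  "('i, 'a, 'v::euclidean_space) atlas \<Rightarrow> ('i, 'v) connection set \<Rightarrow> ('i, 'v \<times> 'v) metric_field set" where
  "induced_conformal_structure N P =
     {g. pseudo_metric (weighted_cotangent (-2) N) DIM('v) DIM('v) g \<and>
         (\<exists>s. is_scale N s \<and> conformal_metrics (weighted_cotangent (-2) N) (induced_metric N P s) g)}"


section \<open>The Thomas cone\<close>

text \<open>The ray bundle of positive elements of \<open>\<E>(1)\<close>.  Its charts are indexed by a scale \<open>s\<close> and a chart
  of \<open>N\<close>: they are the coordinates \<open>(x\<^sup>0, x\<^sup>A)\<close> of the trivialization \<open>(x\<^sup>0, x) \<mapsto> x\<^sup>0 s(x)\<close>.\<close>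

definition thomas_cone ::
  "('i, 'a, 'v::euclidean_space) atlas \<Rightarrow>
   (('i \<Rightarrow> 'v \<Rightarrow> real) \<times> 'i, 'a \<times> ('i \<Rightarrow> real), real \<times> 'v) atlas" where
  "thomas_cone N =
    (let E = {(x, \<sigma>). x \<in> points N \<and>
               (\<forall>i\<in>indices N. x \<in> cdom N i \<longrightarrow> \<sigma> i > 0) \<and>
               (\<forall>i\<in>indices N. \<forall>j\<in>indices N. x \<in> cdom N i \<inter> cdom N j \<longrightarrow>
                  \<sigma> j = weight_factor 1 N i j (coord N i x) * \<sigma> i) \<and>
               (\<forall>i. \<not> (i \<in> indices N \<and> x \<in> cdom N i) \<longrightarrow> \<sigma> i = 0)}
     in \<lparr>points = E, indices = Collect (is_scale N) \<times> indices N,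
         cdom = (\<lambda>(s, i). {(x, \<sigma>) \<in> E. x \<in> cdom N i}),
         coord = (\<lambda>(s, i) (x, \<sigma>). (\<sigma> i / s i (coord N i x), coord N i x))\<rparr>)"

text \<open>In the trivialization given by \<open>s\<close>, with \<open>D\<close> the connection of \<open>s\<close>: \<open>\<nabla>\<^bsub>\<partial>A\<^esub> \<partial>\<^sub>B\<close> is
  \<open>D\<^bsub>\<partial>A\<^esub> \<partial>\<^sub>B - Ric\<^sub>A\<^sub>B Z / (n - 1)\<close> with \<open>Z = x\<^sup>0 \<partial>\<^sub>0\<close>, while \<open>\<nabla> Z = id\<close> and torsion-freeness amount to
  \<open>\<nabla>\<^bsub>\<partial>0\<^esub> \<partial>\<^sub>0 = 0\<close> and \<open>\<nabla>\<^bsub>\<partial>A\<^esub> \<partial>\<^sub>0 = \<nabla>\<^bsub>\<partial>0\<^esub> \<partial>\<^sub>A = \<partial>\<^sub>A / x\<^sup>0\<close>.\<close>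

definition thomas_connection ::
  "('i, 'a, 'v::euclidean_space) atlas \<Rightarrow> ('i, 'v) connection set \<Rightarrow>
   (('i \<Rightarrow> 'v \<Rightarrow> real) \<times> 'i, real \<times> 'v) connection" where
  "thomas_connection N P = (\<lambda>(s, i) (x0, x) (a, u) (b, v).
     let D = scale_connection N P s in
       (- (x0 / (real DIM('v) - 1)) * ricci (D i) x u v,
        D i x u v + (a / x0) *\<^sub>R v + (b / x0) *\<^sub>R u))"


section \<open>Fefferman--Graham ambient metrics\<close>

definition ambient_space :: "('i, 'a, 'v) atlas \<Rightarrow> ('i, real \<times> 'a \<times> real, real \<times> 'v \<times> real) atlas" where
  "ambient_space M =
    \<lparr>points = {0<..} \<times> points M \<times> UNIV, indices = indices M,
     cdom = (\<lambda>i. {0<..} \<times> cdom M i \<times> UNIV),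
     coord = (\<lambda>i (t, m, \<rho>). (t, coord M i m, \<rho>))\<rparr>"

text \<open>\<open>G\<close> is a globally Ricci-flat Fefferman--Graham ambient metric for \<open>(M, g)\<close>, \<open>g\<close> of signature
  \<open>(p, q)\<close>; \<open>h i x \<rho>\<close> is the bilinear form \<open>g\<^sub>i\<^sub>j(x, \<rho>) dx\<^sup>i \<odot> dx\<^sup>j\<close>.\<close>

definition ricci_flat_ambient_metric ::
  "('i, 'a, 'v::euclidean_space) atlas \<Rightarrow> nat \<Rightarrow> nat \<Rightarrow> ('i, 'v) metric_field \<Rightarrow>
   ('i, real \<times> 'v \<times> real) metric_field \<Rightarrow> bool" where
  "ricci_flat_ambient_metric M p q g G \<longleftrightarrow>
     pseudo_metric M p q g \<and> pseudo_metric (ambient_space M) (p + 1) (q + 1) G \<and>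
     (\<exists>h. \<forall>i\<in>indices M. \<forall>x\<in>img M i. (\<forall>u v. h i x 0 u v = g i x u v) \<and>
        (\<forall>t>0. \<forall>\<rho> a u b a' u' b'.
           G i (t, x, \<rho>) (a, u, b) (a', u', b') =
             t\<^sup>2 * h i x \<rho> u u' + 2 * \<rho> * a * a' + t * (a * b' + a' * b))) \<and>
     ricci_flat (ambient_space M) G"

text \<open>The identification of \<open>T*\<C>\<close> with \<open>\<real>\<^sub>+ \<times> M \<times> \<real>\<close> for a scale \<open>s\<close>: a point with canonical
  coordinates \<open>((x\<^sup>0, x\<^sup>A), (y\<^sub>0, y\<^sub>A))\<close> over the chart \<open>(s, i)\<close> is sent to \<open>t = x\<^sup>0\<close>,
  \<open>p\<^sub>A = y\<^sub>A / (x\<^sup>0)\<^sup>2\<close>, \<open>\<rho> = y\<^sub>0 / x\<^sup>0\<close>, where \<open>(x, p)\<close> becomes a point of \<open>M\<close> via \<open>s\<close>.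
  The numbers \<open>x\<^sup>0\<close> and \<open>y\<^sub>0\<close> depend only on \<open>s\<close>, not on \<open>i\<close>.\<close>

definition identification ::
  "('i, 'a, 'v::euclidean_space) atlas \<Rightarrow> ('i \<Rightarrow> 'v \<Rightarrow> real) \<Rightarrow>
   ('a \<times> ('i \<Rightarrow> real)) \<times> (('i \<Rightarrow> 'v \<Rightarrow> real) \<times> 'i \<Rightarrow> real \<times> 'v) \<Rightarrow>
   real \<times> ('a \<times> ('i \<Rightarrow> 'v)) \<times> real" where
  "identification N s = (\<lambda>(c, \<eta>).
     let i = (SOME i. i \<in> indices N \<and> fst c \<in> cdom N i);
         x0 = fst (coord (thomas_cone N) (s, i) c);
         y0 = fst (\<eta> (s, i))
     in (x0, scale_iso N s (fst c, \<lambda>j. snd (\<eta> (s, j)) /\<^sub>R x0\<^sup>2), y0 / x0))"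

end

theory Submission
  imports Defs
begin

text \<open>In a scale with connection \<open>D\<close> and coordinates \<open>(t, (x, p), \<rho>)\<close>, the Patterson--Walker metric
  of the Thomas cone connection is
  \<open>t\<^sup>2 (g + 2 \<rho> Ric / (n - 1)) + 2 \<rho> dt \<odot> dt + 2 t dt \<odot> d\<rho>\<close> with \<open>g\<close> the Patterson--Walker metric
  of \<open>D\<close>; this is the normal form of an ambient metric.  The Ricci tensor of a Patterson--Walker
  metric is twice the pullback of the symmetrised Ricci tensor of the connection, and the Thomas cone
  connection is Ricci-flat because its \<open>Ric\<close>-term cancels the trace of the curvature of \<open>D\<close>.  The
  cone connection does not depend on the scale: a change of scale by \<open>f\<close> changes \<open>Ric\<close> by a multiple
  of the Hessian of \<open>f\<close> divided by \<open>f\<close>, which is the second derivative of the coordinate change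
  \<open>x\<^sup>0 \<mapsto> x\<^sup>0 f(x)\<close> of the cone.\<close>

section \<open>Calculus of smooth maps\<close>

text \<open>All objects are families of components over charts, and several definitions involve a
  choice: \<open>levi_civita\<close> a definite description, \<open>scale_connection\<close>,
  \<open>transport\<close> and \<open>identification\<close> a Hilbert choice. Each choice is
  removed once by a uniqueness or invariance lemma; afterwards everything is done with explicit
  Christoffel symbols in one chart. For the ambient Ricci tensor this means solving the Koszul
  formula in the canonical coordinates of the cotangent bundle of the cone, where the metric is
  affine in the fibre variable, and moving the result to the coordinates
  \<open>(t, (x, p), \<rho>)\<close> by naturality.

  The cone atlas contains the charts of all scales at once, so independence of the scale is the
  transformation law of \<open>thomas_connection\<close> between the charts \<open>(s, i)\<close>
  and \<open>(s', j)\<close>. The constant n + 1 has two sources that have to match: a change by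
  \<Upsilon> adds (n + 1) \<Upsilon> to the trace of a connection, and scales transform with the
  power -1 / (n + 1) of the Jacobian determinant. Comparing them requires the derivative of a
  determinant.\<close>

abbreviation fd :: "('a::real_normed_vector \<Rightarrow> 'b::real_normed_vector) \<Rightarrow> 'a \<Rightarrow> 'a \<Rightarrow> 'b" where
  "fd f x \<equiv> frechet_derivative f (at x)"

lemma linear_eq_sum_Basis:
  fixes f :: "'a::euclidean_space \<Rightarrow> 'b::real_vector"
  assumes "linear f"
  shows "f u = (\<Sum>b\<in>Basis. (u \<bullet> b) *\<^sub>R f b)"
  using linear_sum[OF assms, of "\<lambda>b. (u \<bullet> b) *\<^sub>R b" Basis]
  by (simp add: euclidean_representation linear_cmul[OF assms])

lemma bilinear_eq_sum_Basis:
  fixes B :: "'a::euclidean_space \<Rightarrow> 'b::euclidean_space \<Rightarrow> 'c::real_vector"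
  assumes "bilinear B"
  shows "B u v = (\<Sum>b\<in>Basis. \<Sum>c\<in>Basis. (u \<bullet> b) *\<^sub>R (v \<bullet> c) *\<^sub>R B b c)"
proof -
  have l: "linear (\<lambda>u. B u v)" "\<And>b. linear (B b)" using assms by (auto simp: bilinear_def)
  have "B u v = (\<Sum>b\<in>Basis. (u \<bullet> b) *\<^sub>R B b v)" by (rule linear_eq_sum_Basis[OF l(1)])
  also have "\<dots> = (\<Sum>b\<in>Basis. (u \<bullet> b) *\<^sub>R (\<Sum>c\<in>Basis. (v \<bullet> c) *\<^sub>R B b c))"
    by (intro sum.cong refl arg_cong2[where f=scaleR] linear_eq_sum_Basis l)
  finally show ?thesis by (simp add: scaleR_sum_right)
qed

section \<open>C^k maps and their closure properties\<close>

lemma Ck_on_imp_continuous_on: "Ck_on k S f \<Longrightarrow> continuous_on S f"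
  by (cases k) (auto intro!: continuous_at_imp_continuous_on differentiable_imp_continuous_within)

text \<open>\<open>frechet_derivative\<close> at a point depends on the values nearby, so agreement
  on S passes to the derivatives only because S is open.\<close>

lemma Ck_on_cong:
  assumes "open S" "\<And>x. x \<in> S \<Longrightarrow> f x = g x" "Ck_on k S f"
  shows "Ck_on k S g"
  using assms(2,3)
proof (induction k arbitrary: f g)
  case 0
  then show ?case using continuous_on_cong[of S S f g] by auto
next
  case (Suc k)
  have D: "(g has_derivative fd f x) (at x)" if "x \<in> S" for x
    by (rule has_derivative_transform_within_open[OF _ assms(1) that, of f])
      (use Suc.prems that in \<open>auto simp: frechet_derivative_works[symmetric]\<close>)
  have eq: "fd g x = fd f x" if "x \<in> S" for x
    using frechet_derivative_at[OF D[OF that]] by simp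
  show ?case
    using D Suc.prems Suc.IH[of "\<lambda>x. fd f x _" "\<lambda>x. fd g x _"] eq
    by (auto simp: differentiable_def)
qed

lemma Ck_on_subset: "Ck_on k S f \<Longrightarrow> T \<subseteq> S \<Longrightarrow> Ck_on k T f"
  by (induction k arbitrary: f) (auto intro: continuous_on_subset)

lemma Ck_on_SucD: "Ck_on (Suc k) S f \<Longrightarrow> Ck_on k S f"
proof (induction k arbitrary: f)
  case 0
  then show ?case using Ck_on_imp_continuous_on[OF 0] by simp
next
  case (Suc k)
  then show ?case by (metis Ck_on.simps(2))
qed

text \<open>Uniqueness of the derivative lets the closure proofs exhibit f' in any convenient form
  and reason about that instead of \<open>frechet_derivative\<close>.\<close>

lemma Ck_on_SucI:
  assumes "open S" "\<And>x. x \<in> S \<Longrightarrow> (f has_derivative f' x) (at x)"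
    "\<And>v. Ck_on k S (\<lambda>x. f' x v)"
  shows "Ck_on (Suc k) S f"
proof -
  have "Ck_on k S (\<lambda>x. fd f x v)" for v
    by (rule Ck_on_cong[OF assms(1) _ assms(3)[of v]])
      (use frechet_derivative_at[OF assms(2)] in \<open>auto dest: fun_cong\<close>)
  then show ?thesis using assms(2) by (auto simp: differentiable_def)
qed

lemma Ck_on_const: "open S \<Longrightarrow> Ck_on k S (\<lambda>x. c)"
  by (induction k arbitrary: c) (auto intro: continuous_on_const)

lemma Ck_on_has_derivative:
  "Ck_on (Suc k) S f \<Longrightarrow> x \<in> S \<Longrightarrow> (f has_derivative fd f x) (at x)"
  by (simp add: frechet_derivative_works)

lemma Ck_on_bounded_linear:
  assumes "bounded_linear h" "open S" "Ck_on k S f"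
  shows "Ck_on k S (\<lambda>x. h (f x))"
  using assms(3)
proof (induction k arbitrary: f)
  case 0
  then show ?case using bounded_linear.continuous_on[OF assms(1)] by auto
next
  case (Suc k)
  show ?case
    by (rule Ck_on_SucI[OF assms(2)
          bounded_linear.has_derivative[OF assms(1) Ck_on_has_derivative[OF Suc.prems]]])
      (use Suc in auto)
qed

lemma Ck_on_add:
  assumes "open S" "Ck_on k S f" "Ck_on k S g"
  shows "Ck_on k S (\<lambda>x. f x + g x)"
  using assms(2,3)
proof (induction k arbitrary: f g)
  case 0
  then show ?case by (auto intro: continuous_on_add)
next
  case (Suc k)
  show ?case
    by (rule Ck_on_SucI[OF assms(1) has_derivative_add[OF Ck_on_has_derivative[OF Suc.prems(1)]
          Ck_on_has_derivative[OF Suc.prems(2)]]])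
      (use Suc in auto)
qed

lemma Ck_on_bounded_bilinear:
  assumes "bounded_bilinear h" "open S" "Ck_on k S f" "Ck_on k S g"
  shows "Ck_on k S (\<lambda>x. h (f x) (g x))"
  using assms(3,4)
proof (induction k arbitrary: f g)
  case 0
  then show ?case using bounded_bilinear.continuous_on[OF assms(1)] by auto
next
  case (Suc k)
  show ?case
    by (rule Ck_on_SucI[OF assms(2) bounded_bilinear.FDERIV[OF assms(1)
            Ck_on_has_derivative[OF Suc.prems(1)] Ck_on_has_derivative[OF Suc.prems(2)]]])
      (use Suc Ck_on_SucD[OF Suc.prems(1)] Ck_on_SucD[OF Suc.prems(2)] in
        \<open>auto intro!: Ck_on_add[OF assms(2)]\<close>)
qed

lemma Ck_on_sum:
  assumes "open S" "finite I" "\<And>i. i \<in> I \<Longrightarrow> Ck_on k S (f i)"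
  shows "Ck_on k S (\<lambda>x. \<Sum>i\<in>I. f i x)"
  using assms(2,3) by (induction I rule: finite_induct) (auto intro: Ck_on_const Ck_on_add assms(1))

lemma Ck_on_compose:
  fixes f :: "'a::euclidean_space \<Rightarrow> 'b::euclidean_space" and g :: "'b \<Rightarrow> 'c::real_normed_vector"
  assumes "open S" "f ` S \<subseteq> T" "Ck_on k T g" "Ck_on k S f"
  shows "Ck_on k S (\<lambda>x. g (f x))"
  using assms(3,4)
proof (induction k arbitrary: g)
  case 0
  then show ?case using assms(2) by (auto intro: continuous_on_compose2)
next
  case (Suc k)
  let ?f' = "\<lambda>x. fd f x" and ?g' = "\<lambda>x. fd g x"
  have D: "((\<lambda>x. g (f x)) has_derivative (\<lambda>v. \<Sum>b\<in>Basis. (?f' x v \<bullet> b) *\<^sub>R ?g' (f x) b)) (at x)"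
    if "x \<in> S" for x
  proof -
    have g: "(g has_derivative ?g' (f x)) (at (f x))"
      using Ck_on_has_derivative[OF Suc.prems(1)] that assms(2) by auto
    have "((\<lambda>x. g (f x)) has_derivative (\<lambda>v. ?g' (f x) (?f' x v))) (at x)"
      using diff_chain_at[OF Ck_on_has_derivative[OF Suc.prems(2) that] g] by (simp add: o_def)
    \<comment> \<open>In the chain rule the direction \<open>?f' x v\<close> moves with x, while
      \<open>Ck_on\<close> speaks of fixed directions. Expanding it in the basis leaves products of
      C^k functions, one factor being covered by the induction hypothesis.\<close>
    moreover have "(\<lambda>v. ?g' (f x) (?f' x v)) = (\<lambda>v. \<Sum>b\<in>Basis. (?f' x v \<bullet> b) *\<^sub>R ?g' (f x) b)"
      by (rule ext) (rule linear_eq_sum_Basis[OF has_derivative_linear[OF g]])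
    ultimately show ?thesis by (rule has_derivative_eq_rhs)
  qed
  have f: "Ck_on k S f" by (rule Ck_on_SucD[OF Suc.prems(2)])
  show ?case
  proof (rule Ck_on_SucI[OF assms(1) D])
    fix v
    have 1: "Ck_on k S (\<lambda>x. ?g' (f x) b)" for b
      by (rule Suc.IH[OF _ f]) (use Suc.prems(1) in simp)
    have 2: "Ck_on k S (\<lambda>x. ?f' x v \<bullet> b)" for b
      by (rule Ck_on_bounded_linear[OF bounded_linear_inner_left assms(1)]) (use Suc.prems(2) in simp)
    show "Ck_on k S (\<lambda>x. \<Sum>b\<in>Basis. (?f' x v \<bullet> b) *\<^sub>R ?g' (f x) b)"
      by (intro Ck_on_sum[OF assms(1) finite_Basis]
          Ck_on_bounded_bilinear[OF bounded_bilinear_scaleR assms(1)] 1 2)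
  qed auto
qed

section \<open>Smooth maps\<close>

named_theorems smooth_intros

lemma smooth_on_cong:
  "open S \<Longrightarrow> smooth_on S f \<Longrightarrow> (\<And>x. x \<in> S \<Longrightarrow> f x = g x) \<Longrightarrow> smooth_on S g"
  unfolding smooth_on_def using Ck_on_cong by blast

lemma smooth_on_subset: "smooth_on S f \<Longrightarrow> T \<subseteq> S \<Longrightarrow> smooth_on T f"
  unfolding smooth_on_def using Ck_on_subset by blast

lemma smooth_on_differentiable: "smooth_on S f \<Longrightarrow> x \<in> S \<Longrightarrow> f differentiable (at x)"
  unfolding smooth_on_def by (metis Ck_on.simps(2))

lemma smooth_on_has_derivative:
  "smooth_on S f \<Longrightarrow> x \<in> S \<Longrightarrow> (f has_derivative fd f x) (at x)"
  using smooth_on_differentiable frechet_derivative_works by blast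

lemma smooth_on_frechet_derivative [smooth_intros]:
  "smooth_on S f \<Longrightarrow> smooth_on S (\<lambda>x. fd f x v)"
  unfolding smooth_on_def by (metis Ck_on.simps(2))

lemma smooth_on_continuous_on: "smooth_on S f \<Longrightarrow> continuous_on S f"
  unfolding smooth_on_def using Ck_on_imp_continuous_on by blast

lemma smooth_on_const [smooth_intros]: "open S \<Longrightarrow> smooth_on S (\<lambda>x. c)"
  unfolding smooth_on_def using Ck_on_const by blast

lemma smooth_on_bounded_linear:
  "bounded_linear h \<Longrightarrow> open S \<Longrightarrow> smooth_on S f \<Longrightarrow> smooth_on S (\<lambda>x. h (f x))"
  unfolding smooth_on_def using Ck_on_bounded_linear by blast

lemma smooth_on_bounded_bilinear:
  "bounded_bilinear h \<Longrightarrow> open S \<Longrightarrow> smooth_on S f \<Longrightarrow> smooth_on S g \<Longrightarrow>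
    smooth_on S (\<lambda>x. h (f x) (g x))"
  unfolding smooth_on_def using Ck_on_bounded_bilinear by blast

lemma smooth_on_add [smooth_intros]:
  "open S \<Longrightarrow> smooth_on S f \<Longrightarrow> smooth_on S g \<Longrightarrow> smooth_on S (\<lambda>x. f x + g x)"
  unfolding smooth_on_def using Ck_on_add by blast

lemma smooth_on_sum [smooth_intros]:
  assumes "open S" "\<And>i. i \<in> I \<Longrightarrow> smooth_on S (f i)"
  shows "smooth_on S (\<lambda>x. \<Sum>i\<in>I. f i x)"
proof (cases "finite I")
  case True
  then show ?thesis using assms Ck_on_sum unfolding smooth_on_def by blast
qed (simp add: smooth_on_const assms)

lemma smooth_on_compose:
  fixes f :: "'a::euclidean_space \<Rightarrow> 'b::euclidean_space"
  shows "open S \<Longrightarrow> f ` S \<subseteq> T \<Longrightarrow> smooth_on T g \<Longrightarrow> smooth_on S f \<Longrightarrow> smooth_on S (\<lambda>x. g (f x))"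
  unfolding smooth_on_def using Ck_on_compose by blast

lemma smooth_on_ident [smooth_intros]:
  assumes "open S" shows "smooth_on S (\<lambda>x. x)"
proof -
  have "Ck_on k S (\<lambda>x. x)" for k
    by (cases k) (auto intro: continuous_on_id Ck_on_const assms)
  then show ?thesis by (simp add: smooth_on_def)
qed

lemmas smooth_on_scaleR [smooth_intros] = smooth_on_bounded_bilinear[OF bounded_bilinear_scaleR]
lemmas smooth_on_inner [smooth_intros] = smooth_on_bounded_bilinear[OF bounded_bilinear_inner]
lemmas smooth_on_fst [smooth_intros] = smooth_on_bounded_linear[OF bounded_linear_fst]
lemmas smooth_on_snd [smooth_intros] = smooth_on_bounded_linear[OF bounded_linear_snd]
lemmas smooth_on_minus [smooth_intros] =
  smooth_on_bounded_linear[OF bounded_linear_minus[OF bounded_linear_ident]]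

lemma smooth_on_mult [smooth_intros]:
  fixes f g :: "'a::euclidean_space \<Rightarrow> real"
  shows "open S \<Longrightarrow> smooth_on S f \<Longrightarrow> smooth_on S g \<Longrightarrow> smooth_on S (\<lambda>x. f x * g x)"
  by (rule smooth_on_bounded_bilinear[OF bounded_bilinear_mult])

lemma smooth_on_diff [smooth_intros]:
  "open S \<Longrightarrow> smooth_on S f \<Longrightarrow> smooth_on S g \<Longrightarrow> smooth_on S (\<lambda>x. f x - g x)"
  using smooth_on_add[OF _ _ smooth_on_minus, of S f g] by simp

lemma smooth_on_Pair [smooth_intros]:
  assumes "open S" "smooth_on S f" "smooth_on S g"
  shows "smooth_on S (\<lambda>x. (f x, g x))"
proof -
  have 1: "bounded_linear (\<lambda>a::'b. (a, 0::'c))" "bounded_linear (\<lambda>b::'c. (0::'b, b))"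
    by (auto intro: bounded_linear_Pair bounded_linear_ident bounded_linear_zero)
  have "smooth_on S (\<lambda>x. (f x, 0::'c) + (0::'b, g x))"
    by (intro smooth_on_add smooth_on_bounded_linear[OF 1(1)] smooth_on_bounded_linear[OF 1(2)] assms)
  then show ?thesis by simp
qed

lemma has_derivative_compose_fst:
  "(f has_derivative f') (at x) \<Longrightarrow> ((\<lambda>y. f (fst y)) has_derivative (\<lambda>h. f' (fst h))) (at (x, p))"
  by (rule has_derivative_compose[of fst fst "(x, p)" UNIV f]) (auto intro!: derivative_eq_intros)

lemma has_derivative_compose_snd:
  "(f has_derivative f') (at x) \<Longrightarrow> ((\<lambda>y. f (snd y)) has_derivative (\<lambda>h. f' (snd h))) (at (p, x))"
  by (rule has_derivative_compose[of snd snd "(p, x)" UNIV f]) (auto intro!: derivative_eq_intros)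

lemma smooth_on_compose_fst:
  fixes g :: "'a::euclidean_space \<Rightarrow> 'c::real_normed_vector"
  assumes "open (S \<times> (T::'b::euclidean_space set))" "smooth_on S g"
  shows "smooth_on (S \<times> T) (\<lambda>y. g (fst y))"
  by (rule smooth_on_compose[OF assms(1) _ assms(2) smooth_on_fst[OF assms(1) smooth_on_ident[OF
      assms(1)]]]) auto

lemma smooth_on_compose_snd:
  fixes g :: "'b::euclidean_space \<Rightarrow> 'c::real_normed_vector"
  assumes "open ((S::'a::euclidean_space set) \<times> T)" "smooth_on T g"
  shows "smooth_on (S \<times> T) (\<lambda>y. g (snd y))"
  by (rule smooth_on_compose[OF assms(1) _ assms(2) smooth_on_snd[OF assms(1) smooth_on_ident[OF
      assms(1)]]]) auto

lemma smooth_on_power [smooth_intros]: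
  fixes f :: "'a::euclidean_space \<Rightarrow> real"
  assumes "open S" "smooth_on S f"
  shows "smooth_on S (\<lambda>x. f x ^ k)"
  by (induction k) (auto intro!: smooth_intros assms)

lemma Ck_on_inverse: "Ck_on k {x::real. x \<noteq> 0} inverse"
proof (induction k)
  case 0
  then show ?case by (auto intro!: continuous_intros)
next
  case (Suc k)
  have op: "open {x::real. x \<noteq> 0}" by (auto intro!: open_Collect_neq continuous_intros)
  show ?case
  proof (rule Ck_on_SucI[OF op, where f' = "\<lambda>x v. - (inverse x * v * inverse x)"])
    show "(inverse has_derivative (\<lambda>v. - (inverse x * v * inverse x))) (at x)"
      if "x \<in> {x. x \<noteq> 0}" for x :: real
      using that has_derivative_inverse'[of x UNIV] by simp
    show "Ck_on k {x. x \<noteq> 0} (\<lambda>x. - (inverse x * v * inverse x))" for v :: real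
      by (intro Ck_on_bounded_linear[OF bounded_linear_minus[OF bounded_linear_ident] op]
          Ck_on_bounded_bilinear[OF bounded_bilinear_mult op] Suc Ck_on_const[OF op])
  qed
qed

lemma smooth_on_inverse [smooth_intros]:
  fixes f :: "'a::euclidean_space \<Rightarrow> real"
  assumes "open S" "smooth_on S f" "\<And>x. x \<in> S \<Longrightarrow> f x \<noteq> 0"
  shows "smooth_on S (\<lambda>x. inverse (f x))"
  by (rule smooth_on_compose[OF assms(1), of f "{x. x \<noteq> 0}" inverse])
    (use assms Ck_on_inverse in \<open>auto simp: smooth_on_def\<close>)

lemma smooth_on_divide [smooth_intros]:
  fixes f g :: "'a::euclidean_space \<Rightarrow> real"
  assumes "open S" "smooth_on S f" "smooth_on S g" "\<And>x. x \<in> S \<Longrightarrow> g x \<noteq> 0"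
  shows "smooth_on S (\<lambda>x. f x / g x)"
  unfolding divide_inverse by (intro smooth_intros assms)

section \<open>Families of linear and bilinear maps with moving arguments\<close>

lemma smooth_on_linear_family:
  fixes L :: "'a::euclidean_space \<Rightarrow> 'b::euclidean_space \<Rightarrow> 'c::real_normed_vector"
  assumes "open S" "\<And>x. x \<in> S \<Longrightarrow> linear (L x)" "\<And>u. smooth_on S (\<lambda>x. L x u)" "smooth_on S f"
  shows "smooth_on S (\<lambda>x. L x (f x))"
  by (rule smooth_on_cong[OF assms(1), of "\<lambda>x. \<Sum>b\<in>Basis. (f x \<bullet> b) *\<^sub>R L x b"])
    (auto intro!: smooth_intros assms linear_eq_sum_Basis[symmetric])

lemma smooth_on_bilinear_family:
  fixes B :: "'a::euclidean_space \<Rightarrow> 'b::euclidean_space \<Rightarrow> 'c::euclidean_space \<Rightarrow> 'd::real_normed_vector"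
  assumes "open S" "\<And>x. x \<in> S \<Longrightarrow> bilinear (B x)" "\<And>u v. smooth_on S (\<lambda>x. B x u v)"
    "smooth_on S f" "smooth_on S g"
  shows "smooth_on S (\<lambda>x. B x (f x) (g x))"
  by (rule smooth_on_cong[OF assms(1),
        of "\<lambda>x. \<Sum>b\<in>Basis. \<Sum>c\<in>Basis. (f x \<bullet> b) *\<^sub>R (g x \<bullet> c) *\<^sub>R B x b c"])
    (intro smooth_intros assms bounded_linear_ident | simp only: bilinear_eq_sum_Basis[OF
        assms(2), symmetric])+

text \<open>Derivatives are given for fixed arguments of L only; expanding the moving argument in
  the basis reduces the product rule for \<open>L y (f y)\<close> to finitely many scalar
  multiples.\<close>

lemma has_derivative_linear_family:
  fixes L :: "'a::real_normed_vector \<Rightarrow> 'b::euclidean_space \<Rightarrow> 'c::real_normed_vector"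
  assumes "open S" "x \<in> S" "\<And>y. y \<in> S \<Longrightarrow> linear (L y)"
    "\<And>u. ((\<lambda>y. L y u) has_derivative L' u) (at x)" "(f has_derivative f') (at x)"
  shows "((\<lambda>y. L y (f y)) has_derivative (\<lambda>h. L' (f x) h + L x (f' h))) (at x)"
proof -
  \<comment> \<open>Linearity of L' in u comes from uniqueness of the derivative of
    \<open>L y u\<close> in y.\<close>
  have L': "L' u h = (\<Sum>b\<in>Basis. (u \<bullet> b) *\<^sub>R L' b h)" for u h
  proof -
    have "((\<lambda>y. \<Sum>b\<in>Basis. (u \<bullet> b) *\<^sub>R L y b) has_derivative (\<lambda>h. \<Sum>b\<in>Basis. (u \<bullet> b) *\<^sub>R L' b h)) (at x)"
      by (auto intro!: derivative_eq_intros assms)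
    then have "((\<lambda>y. L y u) has_derivative (\<lambda>h. \<Sum>b\<in>Basis. (u \<bullet> b) *\<^sub>R L' b h)) (at x)"
      by (rule has_derivative_transform_within_open[OF _ assms(1,2)])
        (simp add: linear_eq_sum_Basis[OF assms(3), symmetric])
    from has_derivative_unique[OF this assms(4)[of u]] show ?thesis by metis
  qed
  have "((\<lambda>y. \<Sum>b\<in>Basis. (f y \<bullet> b) *\<^sub>R L y b) has_derivative
      (\<lambda>h. \<Sum>b\<in>Basis. (f x \<bullet> b) *\<^sub>R L' b h + (f' h \<bullet> b) *\<^sub>R L x b)) (at x)"
    by (auto intro!: derivative_eq_intros assms)
  then have "((\<lambda>y. L y (f y)) has_derivative
      (\<lambda>h. \<Sum>b\<in>Basis. (f x \<bullet> b) *\<^sub>R L' b h + (f' h \<bullet> b) *\<^sub>R L x b)) (at x)"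
    by (rule has_derivative_transform_within_open[OF _ assms(1,2)])
      (simp add: linear_eq_sum_Basis[OF assms(3), symmetric])
  then show ?thesis
    by (simp add: sum.distrib L'[symmetric] linear_eq_sum_Basis[OF assms(3)[OF assms(2)], symmetric])
qed

lemma has_derivative_bilinear_family:
  fixes B :: "'a::real_normed_vector \<Rightarrow> 'b::euclidean_space \<Rightarrow> 'c::euclidean_space \<Rightarrow>
      'd::real_normed_vector"
  assumes "open S" "x \<in> S" "\<And>y. y \<in> S \<Longrightarrow> bilinear (B y)"
    "\<And>u v. ((\<lambda>y. B y u v) has_derivative B' u v) (at x)"
    "(f has_derivative f') (at x)" "(g has_derivative g') (at x)"
  shows "((\<lambda>y. B y (f y) (g y)) has_derivative
    (\<lambda>h. B' (f x) (g x) h + B x (f' h) (g x) + B x (f x) (g' h))) (at x)"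
proof -
  have l: "linear (\<lambda>u. B y u v)" "linear (B y u)" if "y \<in> S" for y u v
    using assms(3)[OF that] by (auto simp: bilinear_def)
  have "((\<lambda>y. B y u (g y)) has_derivative (\<lambda>h. B' u (g x) h + B x u (g' h))) (at x)" for u
    by (rule has_derivative_linear_family[OF assms(1,2) l(2) assms(4,6)])
  from has_derivative_linear_family[OF assms(1,2) l(1) this assms(5)]
  have "((\<lambda>y. B y (f y) (g y)) has_derivative
    (\<lambda>h. B' (f x) (g x) h + B x (f x) (g' h) + B x (f' h) (g x))) (at x)" by simp
  then show ?thesis by (simp add: algebra_simps)
qed

subsection \<open>Symmetry of second derivatives\<close>

text \<open>The mean value theorem twice: for the increment in direction v as a function of the step
  a along u, then for \<open>?Du\<close> along v. The mixed difference on the left is symmetric in u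
  and v, and this is what the symmetry of second derivatives rests on.\<close>

lemma mixed_difference_eq:
  fixes f :: "'a::euclidean_space \<Rightarrow> real"
  assumes f: "Ck_on 2 S f" and t: "t > 0"
    and S: "\<And>a b. 0 \<le> a \<Longrightarrow> a \<le> t \<Longrightarrow> 0 \<le> b \<Longrightarrow> b \<le> t \<Longrightarrow> x + a *\<^sub>R u + b *\<^sub>R v \<in> S"
  shows "\<exists>a b. 0 \<le> a \<and> a \<le> t \<and> 0 \<le> b \<and> b \<le> t \<and>
    f (x + t *\<^sub>R u + t *\<^sub>R v) - f (x + t *\<^sub>R u) - f (x + t *\<^sub>R v) + f x =
    t\<^sup>2 * fd (\<lambda>y. fd f y u) (x + a *\<^sub>R u + b *\<^sub>R v) v"
proof -
  let ?Du = "\<lambda>y. fd f y u"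
  have f1: "(f has_derivative fd f y) (at y)"
    and f2: "(?Du has_derivative fd ?Du y) (at y)" if "y \<in> S" for y
    using f that by (auto simp: numeral_2_eq_2 frechet_derivative_works[symmetric])
  let ?\<phi> = "\<lambda>a. f (x + a *\<^sub>R u + t *\<^sub>R v) - f (x + a *\<^sub>R u)"
  have 1: "(?\<phi> has_real_derivative (?Du (x + a *\<^sub>R u + t *\<^sub>R v) - ?Du (x + a *\<^sub>R u))) (at a)"
    if "0 \<le> a" "a \<le> t" for a
  proof -
    have a: "x + a *\<^sub>R u + t *\<^sub>R v \<in> S" "x + a *\<^sub>R u \<in> S"
      using S[of a t] S[of a 0] that t by auto
    note d = f1[OF a(1)] f1[OF a(2)]
    have *: "((\<lambda>a. f (x + a *\<^sub>R u + b *\<^sub>R v)) has_derivative (\<lambda>h. fd f (x + a *\<^sub>R u + b *\<^sub>R v) (h *\<^sub>R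
        u))) (at a)"
      if "b = t \<or> b = 0" for b
      using that d
      by (auto intro!: has_derivative_compose[of "\<lambda>a. x + a *\<^sub>R u + b *\<^sub>R v" "\<lambda>h. h *\<^sub>R u" a UNIV f]
          has_derivative_compose[of "\<lambda>a. x + a *\<^sub>R u" "\<lambda>h. h *\<^sub>R u" a UNIV f]
          derivative_eq_intros)
    have "(\<lambda>h. fd f (x + a *\<^sub>R u + t *\<^sub>R v) (h *\<^sub>R u) -
        fd f (x + a *\<^sub>R u) (h *\<^sub>R u)) =
      (\<lambda>h. (?Du (x + a *\<^sub>R u + t *\<^sub>R v) - ?Du (x + a *\<^sub>R u)) * h)"
      using linear_cmul[OF has_derivative_linear[OF d(1)]] linear_cmul[OF has_derivative_linear[OF d(2)]]
      by (auto simp: algebra_simps)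
    with has_derivative_diff[OF *[of t] *[of 0]] show ?thesis
      by (simp add: has_field_derivative_def)
  qed
  from MVT2[OF t 1] obtain a where a: "0 < a" "a < t"
    "?\<phi> t - ?\<phi> 0 = t * (?Du (x + a *\<^sub>R u + t *\<^sub>R v) - ?Du (x + a *\<^sub>R u))"
    by auto
  let ?\<psi> = "\<lambda>b. ?Du (x + a *\<^sub>R u + b *\<^sub>R v)"
  have 2: "(?\<psi> has_real_derivative fd ?Du (x + a *\<^sub>R u + b *\<^sub>R v) v) (at b)"
    if "0 \<le> b" "b \<le> t" for b
  proof -
    have d: "(?Du has_derivative fd ?Du (x + a *\<^sub>R u + b *\<^sub>R v)) (at (x + a *\<^sub>R u + b *\<^sub>R v))"
      using f2 S[of a b] a that by auto
    have "(?\<psi> has_derivative (\<lambda>h. fd ?Du (x + a *\<^sub>R u + b *\<^sub>R v) (h *\<^sub>R v))) (at b)"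
      by (rule has_derivative_compose[of "\<lambda>b. x + a *\<^sub>R u + b *\<^sub>R v" "\<lambda>h. h *\<^sub>R v" b UNIV ?Du, OF _ d])
        (auto intro!: derivative_eq_intros)
    moreover have "(\<lambda>h. fd ?Du (x + a *\<^sub>R u + b *\<^sub>R v) (h *\<^sub>R v)) =
      (\<lambda>h. fd ?Du (x + a *\<^sub>R u + b *\<^sub>R v) v * h)"
      using linear_cmul[OF has_derivative_linear[OF d]] by auto
    ultimately show ?thesis by (simp add: has_field_derivative_def)
  qed
  from MVT2[OF t 2] obtain b where b: "0 < b" "b < t"
    "?\<psi> t - ?\<psi> 0 = t * fd ?Du (x + a *\<^sub>R u + b *\<^sub>R v) v"
    by auto
  show ?thesis
    using a b by (intro exI[of _ a] exI[of _ b]) (auto simp: power2_eq_square algebra_simps)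
qed

text \<open>The same mixed difference is t^2 times either second derivative, each taken at some
  point of a small parallelogram at x. Hence the two functions share a value arbitrarily close to x,
  and continuity makes them agree at x.\<close>

lemma second_derivative_symmetric_real:
  fixes f :: "'a::euclidean_space \<Rightarrow> real"
  assumes S: "open S" "x \<in> S" and f: "Ck_on 2 S f"
  shows "fd (\<lambda>y. fd f y u) x v =
    fd (\<lambda>y. fd f y v) x u" (is "?A x = ?B x")
proof (rule ccontr)
  assume "?A x \<noteq> ?B x"
  define \<epsilon> where "\<epsilon> = \<bar>?A x - ?B x\<bar> / 2"
  have \<epsilon>: "\<epsilon> > 0" using \<open>?A x \<noteq> ?B x\<close> by (simp add: \<epsilon>_def)
  have "isCont ?A x" "isCont ?B x"
    using f S by (auto simp: numeral_2_eq_2 continuous_on_eq_continuous_at)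
  then have "\<forall>\<^sub>F y in nhds x. dist (?A y) (?A x) < \<epsilon> \<and> dist (?B y) (?B x) < \<epsilon> \<and> y \<in> S"
    using \<epsilon> S eventually_nhds_in_open[OF S]
    by (intro eventually_conj tendstoD) (auto simp: isCont_def tendsto_nhds_iff)
  then obtain r where r: "r > 0" "\<And>y. dist y x < r \<Longrightarrow> dist (?A y) (?A x) < \<epsilon> \<and> dist (?B y) (?B x) <
      \<epsilon> \<and> y \<in> S"
    by (auto simp: eventually_nhds_metric)
  \<comment> \<open>Small enough for the parallelogram spanned by t u and t v to stay within
    distance r of x; the summand 1 covers u = v = 0.\<close>
  define t where "t = r / (2 * (norm u + norm v + 1))"
  have t: "t > 0" using r by (auto simp: t_def intro!: divide_pos_pos add_nonneg_pos)
  have "t * (norm u + norm v) \<le> t * (norm u + norm v + 1)" using t by simp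
  also have "\<dots> = r / 2"
    using add_nonneg_pos[of "norm u + norm v" 1] by (simp add: t_def field_simps)
  finally have tr: "t * (norm u + norm v) < r" using r by simp
  have near: "dist (x + a *\<^sub>R w + b *\<^sub>R z) x < r"
    if "0 \<le> a" "a \<le> t" "0 \<le> b" "b \<le> t" "norm w + norm z = norm u + norm v" for a b w z
  proof -
    have "dist (x + a *\<^sub>R w + b *\<^sub>R z) x = norm (a *\<^sub>R w + b *\<^sub>R z)" by (simp add: dist_norm)
    also have "\<dots> \<le> a * norm w + b * norm z"
      using norm_triangle_ineq[of "a *\<^sub>R w" "b *\<^sub>R z"] that by simp
    also have "\<dots> \<le> t * norm w + t * norm z"
      by (intro add_mono mult_right_mono that norm_ge_zero)
    also have "\<dots> = t * (norm u + norm v)" by (simp only: that(5)[symmetric] distrib_left)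
    finally show ?thesis using tr by simp
  qed
  obtain a b where ab: "0 \<le> a" "a \<le> t" "0 \<le> b" "b \<le> t"
    "f (x + t *\<^sub>R u + t *\<^sub>R v) - f (x + t *\<^sub>R u) - f (x + t *\<^sub>R v) + f x = t\<^sup>2 * ?A (x + a *\<^sub>R u + b *\<^sub>R v)"
    using mixed_difference_eq[OF f t, of x u v] near r(2) by metis
  obtain c d where cd: "0 \<le> c" "c \<le> t" "0 \<le> d" "d \<le> t"
    "f (x + t *\<^sub>R v + t *\<^sub>R u) - f (x + t *\<^sub>R v) - f (x + t *\<^sub>R u) + f x = t\<^sup>2 * ?B (x + c *\<^sub>R v + d *\<^sub>R u)"
    using mixed_difference_eq[OF f t, of x v u] near[of _ _ v u] r(2) by (metis add.commute)
  have "t\<^sup>2 * ?A (x + a *\<^sub>R u + b *\<^sub>R v) = t\<^sup>2 * ?B (x + c *\<^sub>R v + d *\<^sub>R u)"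
    using ab(5) cd(5) by (simp add: algebra_simps)
  then have "?A (x + a *\<^sub>R u + b *\<^sub>R v) = ?B (x + c *\<^sub>R v + d *\<^sub>R u)" using t by simp
  moreover have "dist (?A (x + a *\<^sub>R u + b *\<^sub>R v)) (?A x) < \<epsilon>" using near[of a b u v] ab r by auto
  moreover have "dist (?B (x + c *\<^sub>R v + d *\<^sub>R u)) (?B x) < \<epsilon>" using near[of c d v u] cd r by auto
  ultimately show False unfolding \<epsilon>_def dist_real_def by (simp add: abs_if split: if_splits)
qed

lemma second_derivative_symmetric:
  fixes f :: "'a::euclidean_space \<Rightarrow> 'b::euclidean_space"
  assumes S: "open S" "x \<in> S" and f: "smooth_on S f"
  shows "fd (\<lambda>y. fd f y u) x v =
    fd (\<lambda>y. fd f y v) x u"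
proof (rule euclidean_eqI)
  fix b :: 'b assume "b \<in> Basis"
  have fb: "smooth_on S (\<lambda>y. f y \<bullet> b)" by (intro smooth_intros S f)
  have 1: "fd (\<lambda>y. f y \<bullet> b) y w = fd f y w \<bullet> b" if "y \<in> S" for y w
    using frechet_derivative_at[OF bounded_linear.has_derivative[OF bounded_linear_inner_left
          smooth_on_has_derivative[OF f that]], symmetric] by metis
  have 2: "fd (\<lambda>y. fd (\<lambda>y. f y \<bullet> b) y w) x z =
    fd (\<lambda>y. fd f y w) x z \<bullet> b" for w z
  proof -
    have "((\<lambda>y. fd f y w \<bullet> b) has_derivative
      (\<lambda>z. fd (\<lambda>y. fd f y w) x z \<bullet> b)) (at x)"
      by (intro bounded_linear.has_derivative[OF bounded_linear_inner_left]
          smooth_on_has_derivative[OF _ S(2)] smooth_on_frechet_derivative f)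
    then have "((\<lambda>y. fd (\<lambda>y. f y \<bullet> b) y w) has_derivative
      (\<lambda>z. fd (\<lambda>y. fd f y w) x z \<bullet> b)) (at x)"
      by (rule has_derivative_transform_within_open[OF _ S]) (simp add: 1)
    from frechet_derivative_at[OF this, symmetric] show ?thesis by metis
  qed
  show "fd (\<lambda>y. fd f y u) x v \<bullet> b =
    fd (\<lambda>y. fd f y v) x u \<bullet> b"
    using second_derivative_symmetric_real[OF S, of "\<lambda>y. f y \<bullet> b" u v] fb
    by (simp add: 2[symmetric] smooth_on_def)
qed

section \<open>Rules for Frechet derivatives\<close>

lemma fd_eqI: "(f has_derivative f') (at x) \<Longrightarrow> fd f x = f'"
  using frechet_derivative_at by metis

lemma fd_cong:
  assumes "open S" "x \<in> S" "\<And>y. y \<in> S \<Longrightarrow> f y = g y"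
  shows "fd f x = fd g x"
proof -
  have "(f has_derivative F) (at x) \<longleftrightarrow> (g has_derivative F) (at x)" for F
    using has_derivative_transform_within_open[OF _ assms(1,2), of f F UNIV g]
      has_derivative_transform_within_open[OF _ assms(1,2), of g F UNIV f] assms(3) by auto
  then show ?thesis by (simp add: frechet_derivative_def)
qed

lemma fd_bounded_linear:
  assumes "bounded_linear h" "f differentiable (at x)"
  shows "fd (\<lambda>y. h (f y)) x u = h (fd f x u)"
  using fd_eqI[OF bounded_linear.has_derivative[OF assms(1) frechet_derivative_works[THEN iffD1,
      OF assms(2)]]]
  by simp

lemmas fd_fst = fd_bounded_linear[OF bounded_linear_fst]
lemmas fd_snd = fd_bounded_linear[OF bounded_linear_snd]

lemma fd_prod_directions:
  assumes "F differentiable (at (x, y))"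
  shows "fd F (x, y) (u, 0) = fd (\<lambda>x. F (x, y)) x u" "fd F (x, y) (0, v) = fd (\<lambda>y. F (x, y)) y v"
proof -
  have F: "(F has_derivative fd F (x, y)) (at (x, y))"
    using assms frechet_derivative_works by blast
  have "((\<lambda>x. F (x, y)) has_derivative (\<lambda>u. fd F (x, y) (u, 0))) (at x)"
    using F by (intro has_derivative_compose[of "\<lambda>x. (x, y)" "\<lambda>u. (u, 0)" x UNIV F])
      (auto intro!: derivative_eq_intros)
  then show "fd F (x, y) (u, 0) = fd (\<lambda>x. F (x, y)) x u" by (simp add: fd_eqI)
  have "((\<lambda>y. F (x, y)) has_derivative (\<lambda>v. fd F (x, y) (0, v))) (at y)"
    using F by (intro has_derivative_compose[of "\<lambda>y. (x, y)" "\<lambda>v. (0, v)" y UNIV F])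
      (auto intro!: derivative_eq_intros)
  then show "fd F (x, y) (0, v) = fd (\<lambda>y. F (x, y)) y v" by (simp add: fd_eqI)
qed

lemma linear_fd_family:
  fixes L :: "'a::real_normed_vector \<Rightarrow> 'b::real_vector \<Rightarrow> 'c::real_normed_vector"
  assumes "open S" "x \<in> S" "\<And>y. y \<in> S \<Longrightarrow> linear (L y)" "\<And>u. (\<lambda>y. L y u) differentiable (at x)"
  shows "linear (\<lambda>u. fd (\<lambda>y. L y u) x h)"
proof (rule linearI)
  note d = frechet_derivative_works[THEN iffD1, OF assms(4)]
  show "fd (\<lambda>y. L y (a + b)) x h = fd (\<lambda>y. L y a) x h + fd (\<lambda>y. L y b) x h" for a b
    using fd_cong[OF assms(1,2), of "\<lambda>y. L y (a + b)" "\<lambda>y. L y a + L y b"]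
      fd_eqI[OF has_derivative_add[OF d[of a] d[of b]]] by (simp add: linear_add[OF assms(3)])
  show "fd (\<lambda>y. L y (r *\<^sub>R a)) x h = r *\<^sub>R fd (\<lambda>y. L y a) x h" for r a
    using fd_cong[OF assms(1,2), of "\<lambda>y. L y (r *\<^sub>R a)" "\<lambda>y. r *\<^sub>R L y a"]
      fd_eqI[OF has_derivative_scaleR_right[OF d[of a]]] by (simp add: linear_cmul[OF assms(3)])
qed

section \<open>Traces of endomorphisms\<close>

lemma eucl_trace_commute:
  fixes f :: "'v::euclidean_space \<Rightarrow> 'w::euclidean_space" and g :: "'w \<Rightarrow> 'v"
  assumes "linear f" "linear g"
  shows "eucl_trace (\<lambda>y. f (g y)) = eucl_trace (\<lambda>x. g (f x))"
proof -
  have 1: "f (g b) \<bullet> b = (\<Sum>c\<in>Basis. (g b \<bullet> c) * (f c \<bullet> b))" for b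
    by (subst linear_eq_sum_Basis[OF assms(1)]) (simp add: inner_sum_left)
  have 2: "g (f c) \<bullet> c = (\<Sum>b\<in>Basis. (f c \<bullet> b) * (g b \<bullet> c))" for c
    by (subst linear_eq_sum_Basis[OF assms(2)]) (simp add: inner_sum_left)
  show ?thesis unfolding eucl_trace_def 1 2
    by (subst sum.swap) (simp add: mult.commute)
qed

lemma sum_Basis_prod:
  fixes f :: "'a::euclidean_space \<times> 'b::euclidean_space \<Rightarrow> 'c::comm_monoid_add"
  shows "(\<Sum>b\<in>Basis. f b) = (\<Sum>b\<in>Basis. f (b, 0)) + (\<Sum>b\<in>Basis. f (0, b))"
proof -
  have "inj_on (\<lambda>u. (u::'a, 0::'b)) Basis" "inj_on (\<lambda>u. (0::'a, u::'b)) Basis"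
    by (auto intro: inj_onI)
  moreover have "(\<lambda>u. (u::'a, 0::'b)) ` Basis \<inter> (\<lambda>u. (0::'a, u::'b)) ` Basis = {}" by auto
  ultimately show ?thesis
    unfolding Basis_prod_def by (subst sum.union_disjoint) (auto simp: sum.reindex)
qed

text \<open>The trace sees only the two diagonal blocks. The blocks will be base and fibre of a
  cotangent bundle, or the radial and base directions of the cone.\<close>

lemma eucl_trace_prod:
  fixes F :: "'a::euclidean_space \<times> 'b::euclidean_space \<Rightarrow> 'a \<times> 'b"
  shows "eucl_trace F = eucl_trace (\<lambda>u. fst (F (u, 0))) + eucl_trace (\<lambda>v. snd (F (0, v)))"
  unfolding eucl_trace_def by (subst sum_Basis_prod) (auto simp: inner_prod_def)

lemma eucl_trace_add: "eucl_trace (\<lambda>u. f u + g u) = eucl_trace f + eucl_trace g"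
  by (simp add: eucl_trace_def inner_add_left sum.distrib)

lemma eucl_trace_diff: "eucl_trace (\<lambda>u. f u - g u) = eucl_trace f - eucl_trace g"
  by (simp add: eucl_trace_def inner_diff_left sum_subtractf)

lemma eucl_trace_scaleR: "eucl_trace (\<lambda>u. c *\<^sub>R f u) = c * eucl_trace f"
  by (simp add: eucl_trace_def sum_distrib_left)

lemma eucl_trace_ident: "eucl_trace (\<lambda>u::'v::euclidean_space. u) = DIM('v)"
  by (simp add: eucl_trace_def)

text \<open>The source of the factors n - 1 in the Ricci computations: a curvature term
  \<open>l u *\<^sub>R v\<close> contributes l v to the trace, whereas a term
  \<open>c *\<^sub>R u\<close> contributes n c.\<close>

lemma eucl_trace_rank_one:
  assumes "linear (l :: 'v::euclidean_space \<Rightarrow> real)"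
  shows "eucl_trace (\<lambda>u. l u *\<^sub>R v) = l v"
  using linear_eq_sum_Basis[OF assms, of v] by (simp add: eucl_trace_def mult.commute)

lemma eucl_trace_real: "eucl_trace (f :: real \<Rightarrow> real) = f 1"
  by (simp add: eucl_trace_def)

section \<open>Christoffel symbols and curvature in coordinates\<close>

text \<open>Data in a single chart, without a transformation law, so that symbols written down by
  hand, such as \<open>pw_christoffel\<close> and \<open>thomas_christoffel\<close>, fall under it
  as well as the components of a connection.\<close>

definition smooth_christoffel :: "'v::euclidean_space set \<Rightarrow> ('v \<Rightarrow> 'v \<Rightarrow> 'v \<Rightarrow> 'v) \<Rightarrow> bool" where
  "smooth_christoffel S \<Gamma> \<longleftrightarrow> open S \<and> (\<forall>x\<in>S. bilinear (\<Gamma> x)) \<and> (\<forall>u v. smooth_on S (\<lambda>x. \<Gamma> x u v))"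

context
  fixes S :: "'v::euclidean_space set" and \<Gamma>
  assumes \<Gamma>: "smooth_christoffel S \<Gamma>"
begin

lemma smooth_christoffel_open: "open S"
  using \<Gamma> by (simp add: smooth_christoffel_def)

lemma smooth_christoffel_bilinear: "x \<in> S \<Longrightarrow> bilinear (\<Gamma> x)"
  using \<Gamma> by (simp add: smooth_christoffel_def)

lemma smooth_christoffel_linear: "x \<in> S \<Longrightarrow> linear (\<Gamma> x u)" "x \<in> S \<Longrightarrow> linear (\<lambda>u. \<Gamma> x u v)"
  using smooth_christoffel_bilinear by (auto simp: bilinear_def)

lemma smooth_christoffel_smooth: "smooth_on S (\<lambda>x. \<Gamma> x u v)"
  using \<Gamma> by (simp add: smooth_christoffel_def)

lemma smooth_christoffel_differentiable: "x \<in> S \<Longrightarrow> (\<lambda>x. \<Gamma> x u v) differentiable (at x)"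
  using smooth_on_differentiable[OF smooth_christoffel_smooth] .

lemma smooth_christoffel_has_derivative:
  "x \<in> S \<Longrightarrow> ((\<lambda>x. \<Gamma> x u v) has_derivative fd (\<lambda>x. \<Gamma> x u v) x) (at x)"
  using smooth_on_has_derivative[OF smooth_christoffel_smooth] .

lemma linear_fd_christoffel:
  assumes "x \<in> S"
  shows "linear (\<lambda>u. fd (\<lambda>x. \<Gamma> x u v) x h)" "linear (\<lambda>v. fd (\<lambda>x. \<Gamma> x u v) x h)"
    "linear (fd (\<lambda>x. \<Gamma> x u v) x)"
  using linear_fd_family[OF smooth_christoffel_open assms, of "\<lambda>x u. \<Gamma> x u v"]
    linear_fd_family[OF smooth_christoffel_open assms, of "\<lambda>x v. \<Gamma> x u v"]
    linear_frechet_derivative[OF smooth_christoffel_differentiable[OF assms]]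
    smooth_christoffel_differentiable[OF assms] smooth_christoffel_linear by auto

lemma linear_curvature:
  assumes "x \<in> S"
  shows "linear (\<lambda>u. curvature \<Gamma> x u v w)" "linear (\<lambda>v. curvature \<Gamma> x u v w)" "linear (\<lambda>w.
      curvature \<Gamma> x u v w)"
proof -
  note l = smooth_christoffel_linear[OF assms]
  have c: "linear (\<lambda>v. \<Gamma> x u (\<Gamma> x v w))" "linear (\<lambda>w. \<Gamma> x u (\<Gamma> x v w))" for u v w
    using linear_compose[OF l(2) l(1)] linear_compose[OF l(1) l(1)] by (simp_all add: o_def)
  show "linear (\<lambda>u. curvature \<Gamma> x u v w)" "linear (\<lambda>v. curvature \<Gamma> x u v w)" "linear (\<lambda>w.
      curvature \<Gamma> x u v w)"
    unfolding curvature_def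
    by (rule linear_compose_add linear_compose_sub linear_fd_christoffel[OF assms] l c)+
qed

lemma smooth_on_curvature: "smooth_on S (\<lambda>x. curvature \<Gamma> x u v w)"
  unfolding curvature_def
  by (intro smooth_intros smooth_christoffel_open smooth_christoffel_smooth
    smooth_on_linear_family[where L="\<lambda>x. \<Gamma> x _"] smooth_christoffel_linear)

lemma bilinear_ricci: "x \<in> S \<Longrightarrow> bilinear (ricci \<Gamma> x)"
  unfolding bilinear_def ricci_def eucl_trace_def
  using linear_curvature[of x]
  by (auto intro!: linear_compose_sum bounded_linear.linear[OF bounded_linear_inner_left]
    linear_compose[unfolded o_def, of _ "\<lambda>x. x \<bullet> _"])

lemma smooth_on_ricci: "smooth_on S (\<lambda>x. ricci \<Gamma> x u v)"
  unfolding ricci_def eucl_trace_def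
  by (intro smooth_intros smooth_on_curvature smooth_christoffel_open)

end

section \<open>Curvature under changes of coordinates\<close>

lemma curvature_cong:
  assumes "open S" "x \<in> S" "\<And>y. y \<in> S \<Longrightarrow> \<Gamma> y = \<Gamma>' y"
  shows "curvature \<Gamma> x = curvature \<Gamma>' x"
proof -
  have "fd (\<lambda>y. \<Gamma> y a b) x = fd (\<lambda>y. \<Gamma>' y a b) x" for a b
    by (rule fd_cong[OF assms(1,2)]) (simp add: assms(3))
  then show ?thesis using assms(3)[OF assms(2)] by (intro ext) (simp only: curvature_def)
qed

lemma ricci_cong:
  assumes "open S" "x \<in> S" "\<And>y. y \<in> S \<Longrightarrow> \<Gamma> y = \<Gamma>' y"
  shows "ricci \<Gamma> x = ricci \<Gamma>' x"
  using curvature_cong[OF assms] by (intro ext) (simp only: ricci_def)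

text \<open>Differentiating the transformation law of \<open>\<Gamma>\<close> and antisymmetrising removes the third
  derivatives of \<open>\<phi>\<close>.\<close>

lemma curvature_transform:
  assumes \<Gamma>: "smooth_christoffel S \<Gamma>" and \<Gamma>': "smooth_christoffel T \<Gamma>'"
    and \<phi>: "smooth_on S \<phi>" "\<phi> ` S \<subseteq> T" and x: "x \<in> S"
    and law: "\<And>y u v. y \<in> S \<Longrightarrow>
      \<Gamma>' (\<phi> y) (fd \<phi> y u) (fd \<phi> y v) = fd \<phi> y (\<Gamma> y u v) - fd (\<lambda>z. fd \<phi> z v) y u"
  shows "curvature \<Gamma>' (\<phi> x) (fd \<phi> x u) (fd \<phi> x v) (fd \<phi> x w) = fd \<phi> x (curvature \<Gamma> x u v w)"
proof -
  let ?J = "fd \<phi> x"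
  define H where "H = (\<lambda>u v. fd (\<lambda>z. fd \<phi> z v) x u)"
  define K where "K = (\<lambda>u v w. fd (\<lambda>y. fd (\<lambda>z. fd \<phi> z w) y v) x u)"
  have S: "open S" and T: "open T" using \<Gamma> \<Gamma>' by (auto simp: smooth_christoffel_def)
  have \<phi>x: "\<phi> x \<in> T" using \<phi> x by auto
  have J: "((\<lambda>y. fd \<phi> y v) has_derivative (\<lambda>u. H u v)) (at x)" for v
    unfolding H_def by (intro smooth_on_has_derivative[OF _ x] smooth_intros \<phi>)
  have lin: "linear ?J" by (rule linear_frechet_derivative[OF smooth_on_differentiable[OF \<phi>(1) x]])
  \<comment> \<open>The transformation law differentiated at x in direction \<open>?J u\<close> on
    the left and u on the right, by the product rules for families.\<close>
  have key: "fd (\<lambda>y. \<Gamma>' y (?J v) (?J w)) (\<phi> x) (?J u) + \<Gamma>' (\<phi> x) (H u v) (?J w) + \<Gamma>' (\<phi> x) (?J v)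
      (H u w) =
      H u (\<Gamma> x v w) + ?J (fd (\<lambda>y. \<Gamma> y v w) x u) - K u v w" for u v w
  proof -
    have d: "((\<lambda>y. \<Gamma>' (\<phi> y) a b) has_derivative (\<lambda>h. fd (\<lambda>y. \<Gamma>' y a b) (\<phi> x) (?J h))) (at x)" for a b
      by (rule has_derivative_compose[OF smooth_on_has_derivative[OF \<phi>(1) x]
            smooth_christoffel_has_derivative[OF \<Gamma>' \<phi>x]])
    have 1: "((\<lambda>y. \<Gamma>' (\<phi> y) (fd \<phi> y v) (fd \<phi> y w)) has_derivative
      (\<lambda>h. fd (\<lambda>y. \<Gamma>' y (?J v) (?J w)) (\<phi> x) (?J h) + \<Gamma>' (\<phi> x) (H h v) (?J w) + \<Gamma>' (\<phi> x) (?J v) (H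
          h w))) (at x)"
      by (rule has_derivative_bilinear_family[OF S x _ d J J])
        (use \<phi> smooth_christoffel_bilinear[OF \<Gamma>'] in auto)
    have 2: "((\<lambda>y. fd \<phi> y (\<Gamma> y v w)) has_derivative (\<lambda>h. H h (\<Gamma> x v w) + ?J (fd (\<lambda>y. \<Gamma> y v w) x
        h))) (at x)"
      by (rule has_derivative_linear_family[OF S x _ J smooth_christoffel_has_derivative[OF \<Gamma> x]])
        (intro linear_frechet_derivative smooth_on_differentiable[OF \<phi>(1)])
    have 3: "((\<lambda>y. fd (\<lambda>z. fd \<phi> z w) y v) has_derivative (\<lambda>h. K h v w)) (at x)"
      unfolding K_def by (intro smooth_on_has_derivative[OF _ x] smooth_intros \<phi>)
    have "((\<lambda>y. fd \<phi> y (\<Gamma> y v w) - fd (\<lambda>z. fd \<phi> z w) y v) has_derivative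
      (\<lambda>h. fd (\<lambda>y. \<Gamma>' y (?J v) (?J w)) (\<phi> x) (?J h) + \<Gamma>' (\<phi> x) (H h v) (?J w) + \<Gamma>' (\<phi> x) (?J v) (H
          h w))) (at x)"
      by (rule has_derivative_transform_within_open[OF 1 S x]) (simp add: law)
    from has_derivative_unique[OF this has_derivative_diff[OF 2 3]] show ?thesis by metis
  qed
  have Hsym: "H u v = H v u" for u v unfolding H_def by (rule second_derivative_symmetric[OF S x \<phi>(1)])
  have Ksym: "K u v w = K v u w" for u v w
    unfolding K_def by (rule second_derivative_symmetric[OF S x smooth_on_frechet_derivative[OF \<phi>(1)]])
  \<comment> \<open>The inner value \<open>\<Gamma>' (\<phi> x) (?J v) (?J w)\<close> is a value of
    \<open>?J\<close> minus a Hessian value, and only the first part can be transformed once more.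
    The Hessian terms left over cancel those in \<open>key\<close>.\<close>
  have nested: "\<Gamma>' (\<phi> x) (?J u) (\<Gamma>' (\<phi> x) (?J v) (?J w)) =
      ?J (\<Gamma> x u (\<Gamma> x v w)) - H u (\<Gamma> x v w) - \<Gamma>' (\<phi> x) (?J u) (H v w)" for u v w
    by (simp add: law[OF x] linear_diff[OF smooth_christoffel_linear(1)[OF \<Gamma>' \<phi>x]] H_def)
  have "curvature \<Gamma>' (\<phi> x) (?J u) (?J v) (?J w) =
      ?J (fd (\<lambda>y. \<Gamma> y v w) x u) - ?J (fd (\<lambda>y. \<Gamma> y u w) x v) + ?J (\<Gamma> x u (\<Gamma> x v w)) - ?J (\<Gamma> x v (\<Gamma>
          x u w))"
    unfolding curvature_def nested using arg_cong2[where f=minus, OF key[of v w u] key[of u w v]]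
    by (simp add: Hsym[of v u] Ksym[of v u w] algebra_simps)
  then show ?thesis by (simp add: curvature_def linear_add[OF lin] linear_diff[OF lin])
qed

text \<open>The first argument of the curvature, over which the trace is taken, is written as J
  applied to K u; cyclicity of the trace then cancels J against its inverse K.\<close>

lemma ricci_transform:
  assumes \<Gamma>: "smooth_christoffel S \<Gamma>" and \<Gamma>': "smooth_christoffel T \<Gamma>'"
    and \<phi>: "smooth_on S \<phi>" "\<phi> ` S \<subseteq> T" and x: "x \<in> S"
    and law: "\<And>y u v. y \<in> S \<Longrightarrow>
      \<Gamma>' (\<phi> y) (fd \<phi> y u) (fd \<phi> y v) = fd \<phi> y (\<Gamma> y u v) - fd (\<lambda>z. fd \<phi> z v) y u"
    and K: "linear K" "\<And>u. K (fd \<phi> x u) = u" "\<And>v. fd \<phi> x (K v) = v"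
  shows "ricci \<Gamma>' (\<phi> x) (fd \<phi> x v) (fd \<phi> x w) = ricci \<Gamma> x v w"
proof -
  let ?J = "fd \<phi> x"
  have lin: "linear ?J" by (rule linear_frechet_derivative[OF smooth_on_differentiable[OF \<phi>(1) x]])
  have "ricci \<Gamma>' (\<phi> x) (?J v) (?J w) = eucl_trace (\<lambda>u. ?J (curvature \<Gamma> x (K u) v w))"
    unfolding ricci_def
    using curvature_transform[OF \<Gamma> \<Gamma>' \<phi> x law, of "K _" v w] by (simp add: K)
  also have "\<dots> = eucl_trace (\<lambda>u. curvature \<Gamma> x (K (?J u)) v w)"
    by (rule eucl_trace_commute[OF lin])
      (rule linear_compose[OF K(1) linear_curvature(1)[OF \<Gamma> x], unfolded o_def])
  finally show ?thesis by (simp add: K ricci_def)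
qed

section \<open>Levi-Civita connections\<close>

text \<open>Twice the Christoffel symbols of the first kind: the Koszul formula for constant fields,
  whose brackets vanish.\<close>

definition koszul :: "('v::euclidean_space \<Rightarrow> 'v \<Rightarrow> 'v \<Rightarrow> real) \<Rightarrow> 'v \<Rightarrow> 'v \<Rightarrow> 'v \<Rightarrow> 'v \<Rightarrow> real" where
  "koszul G x u v z = fd (\<lambda>y. G y v z) x u + fd (\<lambda>y. G y u z) x v - fd (\<lambda>y. G y u v) x z"

definition nondegenerate :: "('v::euclidean_space \<Rightarrow> 'v \<Rightarrow> real) \<Rightarrow> bool" where
  "nondegenerate \<beta> \<longleftrightarrow> bilinear \<beta> \<and> (\<forall>w. (\<forall>z. \<beta> w z = 0) \<longrightarrow> w = 0)"

text \<open>Resolves the definite description in \<open>levi_civita\<close>: two solutions differ by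
  a vector orthogonal to everything, hence by 0. It thus suffices to guess symbols and to verify the
  Koszul formula for them.\<close>

lemma levi_civita_eqI:
  assumes "nondegenerate (G x)" "\<And>z. 2 * G x w z = koszul G x u v z"
  shows "levi_civita G x u v = w"
  unfolding levi_civita_def koszul_def[symmetric]
proof (rule the_equality)
  fix w' assume *: "\<forall>z. 2 * G x w' z = koszul G x u v z"
  have l: "linear (\<lambda>w. G x w z)" for z using assms(1) by (simp add: nondegenerate_def bilinear_def)
  have "G x (w' - w) z = 0" for z
    using *[rule_format, of z] assms(2)[of z] by (simp add: linear_diff[OF l])
  then show "w' = w" using assms(1) unfolding nondegenerate_def by fastforce
qed (simp add: assms)

text \<open>Differentiating \<open>law\<close> adds terms in which G' pairs a Hessian value of
  \<phi> with a Jacobian value. In the Koszul combination they cancel by the symmetry of the Hessian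
  and of G', except for \<open>2 * ?G (H u v) (?J z)\<close>, which is the inhomogeneous term in the
  transformation of Christoffel symbols.\<close>

lemma levi_civita_transform:
  assumes S: "open S" "x \<in> S" and \<phi>: "smooth_on S \<phi>" "\<phi> ` S \<subseteq> T"
    and T: "open T" and G': "\<And>y. y \<in> T \<Longrightarrow> nondegenerate (G' y)" "\<And>u v. smooth_on T (\<lambda>y. G' y u v)"
      "\<And>y u v. y \<in> T \<Longrightarrow> G' y u v = G' y v u"
    and law: "\<And>y u v. y \<in> S \<Longrightarrow> G y u v = G' (\<phi> y) (fd \<phi> y u) (fd \<phi> y v)"
    and K: "linear K" "\<And>u. K (fd \<phi> x u) = u" "\<And>v. fd \<phi> x (K v) = v"
    and \<Lambda>: "\<And>u v z. 2 * G' (\<phi> x) (\<Lambda> u v) z = koszul G' (\<phi> x) u v z"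
  shows "levi_civita G x u v = K (\<Lambda> (fd \<phi> x u) (fd \<phi> x v) + fd (\<lambda>z. fd \<phi> z v) x u)"
proof (rule levi_civita_eqI)
  let ?J = "fd \<phi> x"
  let ?G = "G' (\<phi> x)"
  define H where "H = (\<lambda>u v. fd (\<lambda>z. fd \<phi> z v) x u)"
  have \<phi>x: "\<phi> x \<in> T" using \<phi> S by auto
  have bl: "bilinear ?G" using G'(1)[OF \<phi>x] by (simp add: nondegenerate_def)
  then have lin: "linear ?J" "linear (\<lambda>u. ?G u v)" "linear (?G v)" for v
    using linear_frechet_derivative[OF smooth_on_differentiable[OF \<phi>(1) S(2)]]
    by (auto simp: bilinear_def)
  show nd: "nondegenerate (G x)"
    unfolding nondegenerate_def law[OF S(2), abs_def]
  proof (intro conjI allI impI)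
    show "bilinear (\<lambda>u v. ?G (?J u) (?J v))"
      unfolding bilinear_def using lin by (auto intro: linear_compose[unfolded o_def])
    fix w assume "\<forall>z. ?G (?J w) (?J z) = 0"
    then have "\<forall>z. ?G (?J w) z = 0" by (metis K(3))
    then have "?J w = 0" using G'(1)[OF \<phi>x] by (simp add: nondegenerate_def)
    then show "w = 0" by (metis K(2) lin(1) linear_0)
  qed
  have J: "((\<lambda>y. fd \<phi> y v) has_derivative (\<lambda>u. H u v)) (at x)" for v
    unfolding H_def by (intro smooth_on_has_derivative[OF _ S(2)] smooth_intros \<phi>)
  have Hsym: "H u v = H v u" for u v unfolding H_def by (rule second_derivative_symmetric[OF S \<phi>(1)])
  have key: "fd (\<lambda>y. G y v z) x u =
    fd (\<lambda>y. G' y (?J v) (?J z)) (\<phi> x) (?J u) + ?G (H u v) (?J z) + ?G (?J v) (H u z)" for u v z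
  proof -
    have d: "((\<lambda>y. G' (\<phi> y) a b) has_derivative (\<lambda>h. fd (\<lambda>y. G' y a b) (\<phi> x) (?J h))) (at x)" for a b
      by (rule has_derivative_compose[OF smooth_on_has_derivative[OF \<phi>(1) S(2)]
            smooth_on_has_derivative[OF G'(2) \<phi>x]])
    have "((\<lambda>y. G' (\<phi> y) (fd \<phi> y v) (fd \<phi> y z)) has_derivative
      (\<lambda>h. fd (\<lambda>y. G' y (?J v) (?J z)) (\<phi> x) (?J h) + ?G (H h v) (?J z) + ?G (?J v) (H h z))) (at x)"
      by (rule has_derivative_bilinear_family[OF S _ d J J])
        (use \<phi> G'(1) in \<open>auto simp: nondegenerate_def\<close>)
    then have "((\<lambda>y. G y v z) has_derivative
      (\<lambda>h. fd (\<lambda>y. G' y (?J v) (?J z)) (\<phi> x) (?J h) + ?G (H h v) (?J z) + ?G (?J v) (H h z))) (at x)"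
      by (rule has_derivative_transform_within_open[OF _ S]) (simp add: law)
    from fd_eqI[OF this] show ?thesis by simp
  qed
  fix z
  have "2 * G x (K (\<Lambda> (?J u) (?J v) + H u v)) z = 2 * ?G (\<Lambda> (?J u) (?J v)) (?J z) + 2 * ?G (H u v)
      (?J z)"
    by (simp add: law[OF S(2)] K linear_add[OF lin(2)])
  also have "\<dots> = koszul G x u v z"
    unfolding \<Lambda> koszul_def key using Hsym[of u v] Hsym[of u z] Hsym[of v z]
      G'(3)[OF \<phi>x, of "?J v" "H z u"] G'(3)[OF \<phi>x, of "?J u" "H z v"] by simp
  finally show "2 * G x (K (\<Lambda> (?J u) (?J v) + fd (\<lambda>z. fd \<phi> z v) x u)) z = koszul G x u v z"
    by (simp add: H_def)
qed

section \<open>Projective changes and symmetry of the Ricci tensor\<close>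

lemma log_derivative_has_derivative:
  fixes f :: "'v::euclidean_space \<Rightarrow> real"
  assumes f: "smooth_on S f" "x \<in> S" "f x \<noteq> 0"
  shows "((\<lambda>y. fd f y v / f y) has_derivative
    (\<lambda>u. fd (\<lambda>y. fd f y v) x u / f x - fd f x u * fd f x v / (f x)\<^sup>2)) (at x)"
  by (rule has_derivative_eq_rhs[OF has_derivative_divide'[OF
        smooth_on_has_derivative[OF smooth_on_frechet_derivative[OF f(1)] f(2)]
        smooth_on_has_derivative[OF f(1,2)] f(3)]])
    (use f(3) in \<open>auto simp: fun_eq_iff power2_eq_square field_simps\<close>)

lemma log_derivative_closed:
  fixes f :: "'v::euclidean_space \<Rightarrow> real"
  assumes S: "open S" "x \<in> S" and f: "smooth_on S f" "f x \<noteq> 0"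
  shows "fd (\<lambda>y. fd f y v / f y) x u = fd (\<lambda>y. fd f y u / f y) x v"
  using second_derivative_symmetric[OF S f(1), of v u]
  by (simp add: fd_eqI[OF log_derivative_has_derivative[OF f(1) S(2) f(2)]])

text \<open>The tensor \<open>P\<close> is the covariant derivative of \<Upsilon> minus the square
  of \<Upsilon>. Closedness of \<Upsilon> makes it symmetric, so the curvature changes only by
  \<open>P u w *\<^sub>R v - P v w *\<^sub>R u\<close>; the trace over u of the first term is P v w,
  that of the second n P v w.\<close>

lemma ricci_projective_change:
  fixes \<Gamma> :: "'v::euclidean_space \<Rightarrow> 'v \<Rightarrow> 'v \<Rightarrow> 'v"
  assumes \<Gamma>: "smooth_christoffel S \<Gamma>" and sym: "\<And>y u v. y \<in> S \<Longrightarrow> \<Gamma> y u v = \<Gamma> y v u" and x: "x \<in> S"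
    and \<Upsilon>: "\<And>y. y \<in> S \<Longrightarrow> linear (\<Upsilon> y)" "\<And>u. (\<lambda>y. \<Upsilon> y u) differentiable (at x)"
      "\<And>u v. fd (\<lambda>y. \<Upsilon> y v) x u = fd (\<lambda>y. \<Upsilon> y u) x v"
    and \<Gamma>': "\<And>y u v. y \<in> S \<Longrightarrow> \<Gamma>' y u v = \<Gamma> y u v + \<Upsilon> y u *\<^sub>R v + \<Upsilon> y v *\<^sub>R u"
  shows "ricci \<Gamma>' x v w = ricci \<Gamma> x v w -
    (real DIM('v) - 1) * (fd (\<lambda>y. \<Upsilon> y w) x v - \<Upsilon> x v * \<Upsilon> x w - \<Upsilon> x (\<Gamma> x v w))"
proof -
  have S: "open S" by (rule smooth_christoffel_open[OF \<Gamma>])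
  define P where "P = (\<lambda>u w. fd (\<lambda>y. \<Upsilon> y w) x u - \<Upsilon> x u * \<Upsilon> x w - \<Upsilon> x (\<Gamma> x u w))"
  note lin = smooth_christoffel_linear[OF \<Gamma> x] \<Upsilon>(1)[OF x]
  have d: "fd (\<lambda>y. \<Gamma>' y v w) x u =
    fd (\<lambda>y. \<Gamma> y v w) x u + fd (\<lambda>y. \<Upsilon> y v) x u *\<^sub>R w + fd (\<lambda>y. \<Upsilon> y w) x u *\<^sub>R v" for u v w
  proof -
    note \<Upsilon>' = frechet_derivative_works[THEN iffD1, OF \<Upsilon>(2)]
    have "((\<lambda>y. \<Gamma> y v w + \<Upsilon> y v *\<^sub>R w + \<Upsilon> y w *\<^sub>R v) has_derivative
      (\<lambda>u. fd (\<lambda>y. \<Gamma> y v w) x u + fd (\<lambda>y. \<Upsilon> y v) x u *\<^sub>R w + fd (\<lambda>y. \<Upsilon> y w) x u *\<^sub>R v)) (at x)"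
      by (intro has_derivative_add has_derivative_scaleR_left \<Upsilon>'
          smooth_christoffel_has_derivative[OF \<Gamma> x])
    moreover have "fd (\<lambda>y. \<Gamma>' y v w) x = fd (\<lambda>y. \<Gamma> y v w + \<Upsilon> y v *\<^sub>R w + \<Upsilon> y w *\<^sub>R v) x"
      by (rule fd_cong[OF S x \<Gamma>'])
    ultimately show ?thesis by (simp add: fd_eqI)
  qed
  have two: "(2 * r) *\<^sub>R z = r *\<^sub>R z + r *\<^sub>R z" for r and z :: 'v
    by (simp add: scaleR_left_distrib[symmetric])
  have "curvature \<Gamma>' x u v w = curvature \<Gamma> x u v w + P u w *\<^sub>R v - P v w *\<^sub>R u" for u
    unfolding curvature_def d \<Gamma>'[OF x]
    using sym[OF x, of v u] \<Upsilon>(3)[of u v]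
    by (simp add: P_def linear_add[OF lin(1)] linear_add[OF lin(3)] linear_cmul[OF lin(1)]
        linear_cmul[OF lin(3)] two algebra_simps)
  moreover have "linear (\<lambda>u. P u w)"
  proof -
    have "linear (\<lambda>u. fd (\<lambda>y. \<Upsilon> y w) x u)"
      by (rule linear_frechet_derivative[OF \<Upsilon>(2)])
    moreover have "linear (\<lambda>u. \<Upsilon> x u * \<Upsilon> x w)"
      using linear_compose[OF lin(3) bounded_linear.linear[OF bounded_linear_mult_left]] by (simp
          add: o_def)
    moreover have "linear (\<lambda>u. \<Upsilon> x (\<Gamma> x u w))"
      using linear_compose[OF lin(2) lin(3)] by (simp add: o_def)
    ultimately show ?thesis unfolding P_def by (intro linear_compose_sub)
  qed
  ultimately have "ricci \<Gamma>' x v w = ricci \<Gamma> x v w + P v w - P v w * DIM('v)"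
    by (simp add: ricci_def eucl_trace_add eucl_trace_diff eucl_trace_rank_one eucl_trace_scaleR
        eucl_trace_ident)
  then show ?thesis by (simp add: P_def algebra_simps)
qed

text \<open>By the Bianchi identity the skew part of the Ricci tensor is the curvature of the induced
  connection on the volume bundle, which is flat.\<close>

lemma ricci_symmetric:
  fixes \<Gamma> :: "'v::euclidean_space \<Rightarrow> 'v \<Rightarrow> 'v \<Rightarrow> 'v" and f :: "'v \<Rightarrow> real"
  assumes \<Gamma>: "smooth_christoffel S \<Gamma>" and sym: "\<And>y u v. y \<in> S \<Longrightarrow> \<Gamma> y u v = \<Gamma> y v u" and x: "x \<in> S"
    and f: "smooth_on S f" "\<And>y. y \<in> S \<Longrightarrow> f y \<noteq> 0" "\<And>y u. y \<in> S \<Longrightarrow> eucl_trace (\<Gamma> y u) = c * (fd f y u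
        / f y)"
  shows "ricci \<Gamma> x v w = ricci \<Gamma> x w v"
proof -
  have S: "open S" by (rule smooth_christoffel_open[OF \<Gamma>])
  note lin = smooth_christoffel_linear[OF \<Gamma> x]
  have d_sym: "fd (\<lambda>y. \<Gamma> y u v) x = fd (\<lambda>y. \<Gamma> y v u) x" for u v
    by (rule fd_cong[OF S x sym])
  have tr: "eucl_trace (\<lambda>u. fd (\<lambda>y. \<Gamma> y v u) x w) = c * fd (\<lambda>y. fd f y v / f y) x w" for v w
  proof -
    have 1: "((\<lambda>y. eucl_trace (\<Gamma> y v)) has_derivative (\<lambda>w. eucl_trace (\<lambda>u. fd (\<lambda>y. \<Gamma> y v u) x w)))
        (at x)"
      unfolding eucl_trace_def
      by (intro has_derivative_sum bounded_linear.has_derivative[OF bounded_linear_inner_left]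
          smooth_christoffel_has_derivative[OF \<Gamma> x])
    have "((\<lambda>y. c * (fd f y v / f y)) has_derivative (\<lambda>w. eucl_trace (\<lambda>u. fd (\<lambda>y. \<Gamma> y v u) x w))) (at x)"
      by (rule has_derivative_transform_within_open[OF 1 S x]) (simp add: f)
    moreover have "((\<lambda>y. c * (fd f y v / f y)) has_derivative (\<lambda>w. c * fd (\<lambda>y. fd f y v / f y) x
        w)) (at x)"
      using log_derivative_has_derivative[OF f(1) x f(2)[OF x], of v]
      by (intro has_derivative_mult_right) (simp add: fd_eqI)
    ultimately have "(\<lambda>w. eucl_trace (\<lambda>u. fd (\<lambda>y. \<Gamma> y v u) x w)) = (\<lambda>w. c * fd (\<lambda>y. fd f y v / f y) x w)"
      by (rule has_derivative_unique)
    then show ?thesis by (rule fun_cong)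
  qed
  \<comment> \<open>The trace of R(v, w) as an endomorphism: the commutator of \<Gamma> v and
    \<Gamma> w is trace-free, and what remains is c times the exterior derivative of d log
    f.\<close>
  have "eucl_trace (\<lambda>u. curvature \<Gamma> x v w u) = 0"
    unfolding curvature_def eucl_trace_add eucl_trace_diff tr
    using eucl_trace_commute[OF lin(1) lin(1), of v w] log_derivative_closed[OF S x f(1) f(2)[OF
        x], of v w]
    by simp
  \<comment> \<open>The first Bianchi identity, from the symmetry of \<Gamma>. Tracing it over u
    compares the two Ricci values, the last term dropping out.\<close>
  moreover have "curvature \<Gamma> x u v w = curvature \<Gamma> x u w v - curvature \<Gamma> x v w u" for u
    unfolding curvature_def d_sym[of w v] d_sym[of w u] d_sym[of v u]
      sym[OF x, of w v] sym[OF x, of w u] sym[OF x, of v u] by simp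
  ultimately show ?thesis by (simp add: ricci_def eucl_trace_diff)
qed

section \<open>Levi-Civita connection and Ricci tensor of a Patterson--Walker metric\<close>

text \<open>The fibre part of the Levi-Civita symbols, paired with z. Testing the Koszul formula on
  vectors (0, \<zeta>) gives \<Gamma> u v as the base part; testing it on (z, 0) then gives this
  expression. \<open>pw_christoffel\<close> recovers the vector from its pairings with the
  basis.\<close>

definition pw_fibre :: "('v::euclidean_space \<Rightarrow> 'v \<Rightarrow> 'v \<Rightarrow> 'v) \<Rightarrow> 'v \<times> 'v \<Rightarrow> 'v \<times> 'v \<Rightarrow> 'v \<times> 'v \<Rightarrow> 'v \<Rightarrow>
    real" where
  "pw_fibre \<Gamma> = (\<lambda>(x, p) (u, \<alpha>) (v, \<beta>) z. 2 * (\<Gamma> x (\<Gamma> x u v) z \<bullet> p) - \<Gamma> x v z \<bullet> \<alpha> - \<Gamma> x u z \<bullet> \<beta>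
     - (fd (\<lambda>x. \<Gamma> x v z) x u + fd (\<lambda>x. \<Gamma> x u z) x v - fd (\<lambda>x. \<Gamma> x u v) x z) \<bullet> p)"

definition pw_christoffel :: "('v::euclidean_space \<Rightarrow> 'v \<Rightarrow> 'v \<Rightarrow> 'v) \<Rightarrow> 'v \<times> 'v \<Rightarrow> 'v \<times> 'v \<Rightarrow> 'v \<times> 'v \<Rightarrow>
    'v \<times> 'v" where
  "pw_christoffel \<Gamma> y X Y = (\<Gamma> (fst y) (fst X) (fst Y), \<Sum>b\<in>Basis. pw_fibre \<Gamma> y X Y b *\<^sub>R b)"

lemma nondegenerate_patterson_walker:
  assumes "bilinear (D i x)"
  shows "nondegenerate (patterson_walker D i (x, p))"
  unfolding nondegenerate_def
proof (intro conjI allI impI)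
  have l: "linear (D i x u)" "linear (\<lambda>u. D i x u v)" for u v
    using assms by (auto simp: bilinear_def)
  show "bilinear (patterson_walker D i (x, p))"
    unfolding bilinear_def patterson_walker_def
    by (auto intro!: linearI simp: linear_add[OF l(1)] linear_add[OF l(2)] linear_cmul[OF l(1)]
        linear_cmul[OF l(2)]
        inner_add_left inner_add_right algebra_simps)
  fix w assume *: "\<forall>z. patterson_walker D i (x, p) w z = 0"
  obtain u \<alpha> where w: "w = (u, \<alpha>)" by fastforce
  have "u \<bullet> u = 0" using *[rule_format, of "(0, u)"]
    by (simp add: w patterson_walker_def linear_0[OF l(1)] linear_0[OF l(2)])
  then have "u = 0" by simp
  then have "\<alpha> \<bullet> \<alpha> = 0" using *[rule_format, of "(\<alpha>, 0)"]
    by (simp add: w patterson_walker_def linear_0[OF l(1)] linear_0[OF l(2)])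
  then show "w = 0" by (simp add: w \<open>u = 0\<close> zero_prod_def)
qed

context
  fixes S :: "'v::euclidean_space set" and D :: "('i, 'v) connection" and i
  assumes D: "smooth_christoffel S (D i)" and sym: "\<And>x u v. x \<in> S \<Longrightarrow> D i x u v = D i x v u"
begin

lemma pw_fibre_linear:
  assumes "x \<in> S"
  shows "linear (pw_fibre (D i) (x, p) X Y)" "bilinear (\<lambda>X Y. pw_fibre (D i) (x, p) X Y z)"
proof -
  note l = smooth_christoffel_linear[OF D assms] and dl = linear_fd_christoffel[OF D assms]
  show "linear (pw_fibre (D i) (x, p) X Y)"
    unfolding pw_fibre_def case_prod_beta
    by (rule linearI) (simp_all add: linear_add[OF l(1)] linear_cmul[OF l(1)]
        linear_add[OF dl(2)] linear_add[OF dl(3)] linear_cmul[OF dl(2)] linear_cmul[OF dl(3)]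
        inner_add_left inner_diff_left algebra_simps)
  show "bilinear (\<lambda>X Y. pw_fibre (D i) (x, p) X Y z)"
    unfolding bilinear_def pw_fibre_def case_prod_beta
    by (intro conjI allI linearI) (simp_all add: linear_add[OF l(1)] linear_cmul[OF l(1)]
        linear_add[OF l(2)] linear_cmul[OF l(2)]
        linear_add[OF dl(1)] linear_add[OF dl(2)] linear_add[OF dl(3)]
        linear_cmul[OF dl(1)] linear_cmul[OF dl(2)] linear_cmul[OF dl(3)]
        inner_add_left inner_add_right inner_diff_left algebra_simps)
qed

lemma snd_pw_christoffel:
  "x \<in> S \<Longrightarrow> snd (pw_christoffel (D i) (x, p) X Y) \<bullet> z = pw_fibre (D i) (x, p) X Y z"
  using linear_eq_sum_Basis[OF pw_fibre_linear(1), of x p X Y z]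
  by (simp add: pw_christoffel_def inner_sum_left mult.commute inner_commute[of z])

lemma smooth_patterson_walker: "smooth_on (S \<times> UNIV) (\<lambda>y. patterson_walker D i y X Y)"
proof -
  have S: "open (S \<times> (UNIV::'v set))" using smooth_christoffel_open[OF D] by (simp add: open_Times)
  have *: "smooth_on (S \<times> (UNIV::'v set)) (\<lambda>y. D i (fst y) u v)" for u v
    by (rule smooth_on_compose_fst[OF S smooth_christoffel_smooth[OF D]])
  show ?thesis unfolding patterson_walker_def case_prod_beta
    by (intro smooth_intros * S)
qed

lemma patterson_walker_koszul:
  assumes x: "x \<in> S"
  shows "2 * patterson_walker D i (x, p) (pw_christoffel (D i) (x, p) X Y) Z =
    koszul (patterson_walker D i) (x, p) X Y Z"
proof -
  have S: "open (S \<times> (UNIV::'v set))" using smooth_christoffel_open[OF D] by (simp add: open_Times)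
  have d: "fd (\<lambda>y. patterson_walker D i y (v, \<beta>) (z, \<zeta>)) (x, p) (u, \<alpha>) =
    - 2 * (fd (\<lambda>x. D i x v z) x u \<bullet> p + D i x v z \<bullet> \<alpha>)" for v \<beta> z \<zeta> u \<alpha>
  proof -
    have 1: "((\<lambda>y. D i (fst y) v z) has_derivative (\<lambda>h. fd (\<lambda>x. D i x v z) x (fst h))) (at (x, p))"
      by (rule has_derivative_compose_fst[OF smooth_christoffel_has_derivative[OF D x, of v z]])
    have "((\<lambda>y. v \<bullet> \<zeta> + z \<bullet> \<beta> - 2 * (D i (fst y) v z \<bullet> snd y)) has_derivative
      (\<lambda>h. - 2 * (fd (\<lambda>x. D i x v z) x (fst h) \<bullet> p + D i x v z \<bullet> snd h))) (at (x, p))"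
      by (rule has_derivative_eq_rhs[OF has_derivative_diff[OF has_derivative_const
              has_derivative_mult_right[OF has_derivative_inner[OF 1 has_derivative_snd[OF
                  has_derivative_ident]]]]])
        (auto simp: fun_eq_iff algebra_simps)
    then have "((\<lambda>y. patterson_walker D i y (v, \<beta>) (z, \<zeta>)) has_derivative
      (\<lambda>h. - 2 * (fd (\<lambda>x. D i x v z) x (fst h) \<bullet> p + D i x v z \<bullet> snd h))) (at (x, p))"
      by (rule has_derivative_transform_within_open[OF _ S])
        (use x sym[of _ z v] in \<open>auto simp: patterson_walker_def inner_add_left\<close>)
    from fd_eqI[OF this] show ?thesis by simp
  qed
  obtain u \<alpha> v \<beta> z \<zeta> where XYZ: "X = (u, \<alpha>)" "Y = (v, \<beta>)" "Z = (z, \<zeta>)" by (metis surj_pair)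
  have "patterson_walker D i (x, p) (pw_christoffel (D i) (x, p) X Y) Z =
    fst (pw_christoffel (D i) (x, p) X Y) \<bullet> \<zeta> + snd (pw_christoffel (D i) (x, p) X Y) \<bullet> z
      - 2 * (D i x (fst (pw_christoffel (D i) (x, p) X Y)) z \<bullet> p)"
    using sym[OF x, of z "fst (pw_christoffel (D i) (x, p) X Y)"]
    by (simp add: patterson_walker_def case_prod_beta XYZ inner_add_left inner_commute[of z])
  then show ?thesis
    unfolding snd_pw_christoffel[OF x] koszul_def XYZ d
    by (simp add: pw_christoffel_def pw_fibre_def inner_add_left inner_diff_left algebra_simps)
qed

lemma smooth_christoffel_pw: "smooth_christoffel (S \<times> UNIV) (pw_christoffel (D i))"
  unfolding smooth_christoffel_def
proof (intro conjI ballI allI)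
  note oS = smooth_christoffel_open[OF D]
  show S: "open (S \<times> (UNIV::'v set))" using oS by (simp add: open_Times)
  show "bilinear (pw_christoffel (D i) y)" if "y \<in> S \<times> UNIV" for y
  proof -
    have x: "fst y \<in> S" using that by auto
    note l = smooth_christoffel_linear[OF D x]
    have f: "linear (\<lambda>X. pw_fibre (D i) y X Y b)" "linear (\<lambda>Y. pw_fibre (D i) y X Y b)" for X Y b
      using pw_fibre_linear(2)[OF x, of "snd y" b] unfolding bilinear_def prod.collapse by blast+
    show ?thesis unfolding bilinear_def pw_christoffel_def
      by (intro conjI allI linearI)
        (simp_all add: linear_add[OF f(1)] linear_add[OF f(2)] linear_cmul[OF f(1)] linear_cmul[OF f(2)]
          linear_add[OF l(1)] linear_add[OF l(2)] linear_cmul[OF l(1)] linear_cmul[OF l(2)]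
          scaleR_add_left sum.distrib scaleR_sum_right)
  qed
  have lift: "smooth_on (S \<times> (UNIV::'v set)) (\<lambda>y. g (fst y))" if "smooth_on S g" for g :: "'v \<Rightarrow> 'v"
    by (rule smooth_on_compose_fst[OF S that])
  fix X Y
  have 1: "smooth_on S (\<lambda>x. D i x (D i x u v) z)" for u v z
    by (rule smooth_on_linear_family[where L="\<lambda>x u. D i x u z"])
      (use D oS smooth_christoffel_linear[OF D] in \<open>auto simp: smooth_christoffel_def\<close>)
  note sm = smooth_christoffel_smooth[OF D]
  show "smooth_on (S \<times> UNIV) (\<lambda>y. pw_christoffel (D i) y X Y)"
    unfolding pw_christoffel_def pw_fibre_def case_prod_beta
    by (intro smooth_intros S lift[OF sm] lift[OF 1] lift[OF smooth_on_frechet_derivative[OF sm]])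
qed

text \<open>The base directions contribute the trace of the curvature of D, that is Ric(v, w). The
  fibre carries the dual action: the diagonal entries there are those of the map taking b to
  \<open>curvature (D i) x b w v\<close>, and contribute Ric(w, v). All terms containing p sit
  outside the diagonal blocks.\<close>

lemma ricci_patterson_walker:
  assumes x: "x \<in> S"
  shows "ricci (pw_christoffel (D i)) (x, p) (v, \<beta>) (w, \<gamma>) = ricci (D i) x v w + ricci (D i) x w v"
proof -
  let ?\<Lambda> = "pw_christoffel (D i)" and ?Y = "(v, \<beta>)" and ?W = "(w, \<gamma>)"
  have S: "open S" by (rule smooth_christoffel_open[OF D])
  note l = smooth_christoffel_linear[OF D x] and dl = linear_fd_christoffel[OF D x]
  note diff = smooth_christoffel_differentiable[OF smooth_christoffel_pw, of "(x, p)"]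
  have xp: "(x, p) \<in> S \<times> UNIV" using x by simp
  have d_sym: "fd (\<lambda>y. D i y u v) x = fd (\<lambda>y. D i y v u) x" for u v
    by (rule fd_cong[OF S x sym])
  have d1: "fst (fd (\<lambda>y. ?\<Lambda> y Y W) (x, p) X) = fd (\<lambda>x. D i x (fst Y) (fst W)) x (fst X)" for X Y W
  proof -
    have "((\<lambda>y. D i (fst y) (fst Y) (fst W)) has_derivative (\<lambda>h. fd (\<lambda>x. D i x (fst Y) (fst W)) x
        (fst h))) (at (x, p))"
      by (rule has_derivative_compose_fst[OF smooth_christoffel_has_derivative[OF D x, of "fst Y"
          "fst W"]])
    from fd_eqI[OF this] show ?thesis
      using fd_fst[OF diff[OF xp], of Y W X] by (simp add: pw_christoffel_def)
  qed
  have d2: "snd (fd (\<lambda>y. ?\<Lambda> y Y W) (x, p) X) \<bullet> b = fd (\<lambda>y. pw_fibre (D i) y Y W b) (x, p) X" for X Y W b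
  proof -
    have "snd (fd (\<lambda>y. ?\<Lambda> y Y W) (x, p) X) \<bullet> b = fd (\<lambda>y. snd (?\<Lambda> y Y W) \<bullet> b) (x, p) X"
      using fd_bounded_linear[OF bounded_linear_compose[OF bounded_linear_inner_left[of b]
          bounded_linear_snd] diff[OF xp]]
      by simp
    also have "\<dots> = fd (\<lambda>y. pw_fibre (D i) y Y W b) (x, p) X"
    proof (rule fun_cong[OF fd_cong[OF _ xp]])
      show "open (S \<times> (UNIV::'v set))" using S by (simp add: open_Times)
      show "snd (?\<Lambda> y Y W) \<bullet> b = pw_fibre (D i) y Y W b" if "y \<in> S \<times> UNIV" for y
        using snd_pw_christoffel[of "fst y" "snd y" Y W b] that by (auto simp: mem_Times_iff)
    qed
    finally show ?thesis .
  qed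
  have fst: "fst (curvature ?\<Lambda> (x, p) (b, 0) ?Y ?W) = curvature (D i) x b v w" for b
    by (simp add: curvature_def d1) (simp add: pw_christoffel_def)
  have snd: "snd (curvature ?\<Lambda> (x, p) (0, b) ?Y ?W) \<bullet> b = curvature (D i) x b w v \<bullet> b" for b
  proof -
    \<comment> \<open>\<open>pw_fibre\<close> is affine in the fibre coordinate, so the derivative
      in a fibre direction b keeps the terms containing p, with p replaced by b.\<close>
    have a: "fd (\<lambda>y. pw_fibre (D i) y ?Y ?W b) (x, p) (0, b) = 2 * (D i x (D i x v w) b \<bullet> b)
       - (fd (\<lambda>x. D i x w b) x v + fd (\<lambda>x. D i x v b) x w - fd (\<lambda>x. D i x v w) x b) \<bullet> b"
    proof -
      have "(\<lambda>y. pw_fibre (D i) y ?Y ?W b) differentiable (at (x, p))"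
      proof -
        have "(\<lambda>y. snd (?\<Lambda> y ?Y ?W) \<bullet> b) differentiable (at (x, p))"
          using bounded_linear.has_derivative[OF bounded_linear_compose[OF
              bounded_linear_inner_left[of b] bounded_linear_snd]
              frechet_derivative_works[THEN iffD1, OF diff[OF xp]]]
          by (rule differentiableI)
        then obtain F where "((\<lambda>y. snd (?\<Lambda> y ?Y ?W) \<bullet> b) has_derivative F) (at (x, p))"
          by (auto simp: differentiable_def)
        then have "((\<lambda>y. pw_fibre (D i) y ?Y ?W b) has_derivative F) (at (x, p))"
        proof (rule has_derivative_transform_within_open[OF _ _ xp])
          show "open (S \<times> (UNIV::'v set))" using S by (simp add: open_Times)
          show "snd (?\<Lambda> y ?Y ?W) \<bullet> b = pw_fibre (D i) y ?Y ?W b" if "y \<in> S \<times> UNIV" for y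
            using snd_pw_christoffel[of "fst y" "snd y" ?Y ?W b] that by (auto simp: mem_Times_iff)
        qed
        then show ?thesis by (rule differentiableI)
      qed
      from fd_prod_directions(2)[OF this, of b]
      have "fd (\<lambda>y. pw_fibre (D i) y ?Y ?W b) (x, p) (0, b) = fd (\<lambda>p. pw_fibre (D i) (x, p) ?Y ?W
          b) p b" .
      also have "((\<lambda>p. pw_fibre (D i) (x, p) ?Y ?W b) has_derivative
        (\<lambda>h. 2 * (D i x (D i x v w) b \<bullet> h)
         - (fd (\<lambda>x. D i x w b) x v + fd (\<lambda>x. D i x v b) x w - fd (\<lambda>x. D i x v w) x b) \<bullet> h)) (at p)"
        unfolding pw_fibre_def prod.case by (rule derivative_eq_intros refl | simp)+
      from fd_eqI[OF this] have "fd (\<lambda>p. pw_fibre (D i) (x, p) ?Y ?W b) p b = 2 * (D i x (D i x v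
          w) b \<bullet> b)
       - (fd (\<lambda>x. D i x w b) x v + fd (\<lambda>x. D i x v b) x w - fd (\<lambda>x. D i x v w) x b) \<bullet> b" by simp
      finally show ?thesis .
    qed
    \<comment> \<open>For the vertical argument (0, b) every term of \<open>pw_fibre\<close>
      vanishes except the pairing of \<Gamma> with b, so the value no longer depends on p.\<close>
    have b: "fd (\<lambda>y. pw_fibre (D i) y (0, b) ?W b) (x, p) ?Y = - (fd (\<lambda>x. D i x w b) x v \<bullet> b)"
    proof -
      have z: "pw_fibre (D i) y (0, b) ?W b = - (D i (fst y) w b \<bullet> b)" if "y \<in> S \<times> UNIV" for y
      proof -
        have y: "fst y \<in> S" using that by auto
        note l = smooth_christoffel_linear[OF D y] and dl = linear_fd_christoffel[OF D y]
        show ?thesis by (simp add: pw_fibre_def case_prod_beta linear_0[OF l(1)] linear_0[OF l(2)]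
              linear_0[OF dl(1)] linear_0[OF dl(3)])
      qed
      have "((\<lambda>y. - (D i (fst y) w b \<bullet> b)) has_derivative (\<lambda>h. - (fd (\<lambda>x. D i x w b) x (fst h) \<bullet>
          b))) (at (x, p))"
        using smooth_christoffel_has_derivative[OF D x, of w b]
        by (intro has_derivative_minus has_derivative_inner_left
            has_derivative_compose[of fst fst "(x, p)" UNIV "\<lambda>x. D i x w b"])
          (auto intro!: derivative_eq_intros)
      from fd_eqI[OF this] fd_cong[OF _ xp z] S show ?thesis by (simp add: open_Times)
    qed
    have c: "snd (?\<Lambda> (x, p) (0, b) (?\<Lambda> (x, p) ?Y ?W)) \<bullet> b = - (D i x (D i x v w) b \<bullet> b)"
      unfolding snd_pw_christoffel[OF x]
      by (simp add: pw_fibre_def pw_christoffel_def case_prod_beta linear_0[OF l(1)] linear_0[OF l(2)]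
              linear_0[OF dl(1)] linear_0[OF dl(3)])
    \<comment> \<open>The inner value is vertical, so it enters the outer one only through its
      pairing with \<open>D i x v b\<close>.\<close>
    have e: "snd (?\<Lambda> (x, p) ?Y (?\<Lambda> (x, p) (0, b) ?W)) \<bullet> b = D i x w (D i x v b) \<bullet> b"
    proof -
      have 0: "?\<Lambda> (x, p) (0, b) ?W = (0, snd (?\<Lambda> (x, p) (0, b) ?W))"
        by (simp add: pw_christoffel_def linear_0[OF l(2)])
      have "pw_fibre (D i) (x, p) ?Y (0, \<delta>) b = - (\<delta> \<bullet> D i x v b)" for \<delta>
        by (simp add: pw_fibre_def linear_0[OF l(1)] linear_0[OF l(2)] linear_0[OF dl(1)]
            linear_0[OF dl(2)]
            linear_0[OF dl(3)] inner_commute)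
      then have "snd (?\<Lambda> (x, p) ?Y (?\<Lambda> (x, p) (0, b) ?W)) \<bullet> b = - (snd (?\<Lambda> (x, p) (0, b) ?W) \<bullet> D i
          x v b)"
        by (subst 0) (simp only: snd_pw_christoffel[OF x])
      also have "\<dots> = D i x w (D i x v b) \<bullet> b"
        unfolding snd_pw_christoffel[OF x]
        by (simp add: pw_fibre_def linear_0[OF l(1)] linear_0[OF l(2)] linear_0[OF dl(1)]
            linear_0[OF dl(3)])
      finally show ?thesis .
    qed
    show ?thesis
      unfolding curvature_def snd_add snd_diff inner_add_left inner_diff_left d2 a b c e
      using sym[OF x, of "D i x v w" b] sym[OF x, of v b] sym[OF x, of v w] d_sym[of v b] d_sym[of
          v w] by simp
  qed
  have "ricci ?\<Lambda> (x, p) ?Y ?W =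
    eucl_trace (\<lambda>b. fst (curvature ?\<Lambda> (x, p) (b, 0) ?Y ?W)) + eucl_trace (\<lambda>b. snd (curvature ?\<Lambda>
        (x, p) (0, b) ?Y ?W))"
    unfolding ricci_def by (rule eucl_trace_prod)
  also have "eucl_trace (\<lambda>b. snd (curvature ?\<Lambda> (x, p) (0, b) ?Y ?W)) = ricci (D i) x w v"
    unfolding ricci_def eucl_trace_def snd ..
  finally show ?thesis unfolding fst ricci_def .
qed

end

section \<open>The Thomas cone connection is Ricci-flat\<close>

definition thomas_christoffel ::
  "('v::euclidean_space \<Rightarrow> 'v \<Rightarrow> 'v \<Rightarrow> 'v) \<Rightarrow> real \<times> 'v \<Rightarrow> real \<times> 'v \<Rightarrow> real \<times> 'v \<Rightarrow> real \<times> 'v" where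
  "thomas_christoffel \<Gamma> = (\<lambda>(x0, x) (a, u) (b, v).
     (- (x0 / (real DIM('v) - 1)) * ricci \<Gamma> x u v, \<Gamma> x u v + (a / x0) *\<^sub>R v + (b / x0) *\<^sub>R u))"

context
  fixes S :: "'v::euclidean_space set" and \<Gamma>
  assumes \<Gamma>: "smooth_christoffel S \<Gamma>"
begin

lemma smooth_christoffel_thomas: "smooth_christoffel ({0<..} \<times> S) (thomas_christoffel \<Gamma>)"
  unfolding smooth_christoffel_def
proof (intro conjI ballI allI)
  note oS = smooth_christoffel_open[OF \<Gamma>]
  show S: "open ({0::real<..} \<times> S)" using oS by (simp add: open_Times)
  show "bilinear (thomas_christoffel \<Gamma> y)" if "y \<in> {0<..} \<times> S" for y
  proof -
    have x: "snd y \<in> S" using that by auto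
    note l = smooth_christoffel_linear[OF \<Gamma> x]
    have r: "linear (ricci \<Gamma> (snd y) u)" "linear (\<lambda>u. ricci \<Gamma> (snd y) u v)" for u v
      using bilinear_ricci[OF \<Gamma> x] by (auto simp: bilinear_def)
    show ?thesis unfolding bilinear_def thomas_christoffel_def case_prod_beta
      by (intro conjI allI linearI)
        (simp_all add: linear_add[OF l(1)] linear_add[OF l(2)] linear_cmul[OF l(1)] linear_cmul[OF l(2)]
          linear_add[OF r(1)] linear_add[OF r(2)] linear_cmul[OF r(1)] linear_cmul[OF r(2)]
          algebra_simps add_divide_distrib)
  qed
  have lift: "smooth_on ({0::real<..} \<times> S) (\<lambda>y. g (snd y))" if "smooth_on S g" for g :: "'v \<Rightarrow>
      'w::real_normed_vector"
    by (rule smooth_on_compose_snd[OF S that])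
  fix X Y
  have 1: "smooth_on ({0::real<..} \<times> S) (\<lambda>y. c / fst y)" for c
    by (intro smooth_intros S) auto
  show "smooth_on ({0<..} \<times> S) (\<lambda>y. thomas_christoffel \<Gamma> y X Y)"
    unfolding thomas_christoffel_def case_prod_beta divide_inverse[of "fst _" "real DIM('v) - 1"]
    by (intro smooth_intros S lift[OF smooth_on_ricci[OF \<Gamma>]] lift[OF smooth_christoffel_smooth[OF \<Gamma>]] 1)
qed

text \<open>The radial direction contributes nothing to the trace. In base directions the radial
  symbol -x0 Ric / (n - 1) meets the symbols 1 / x0 and adds \<open>- (ricci \<Gamma> x v w / k)
  *\<^sub>R e + (ricci \<Gamma> x e w / k) *\<^sub>R v\<close> with k = n - 1 to the curvature of
  \<Gamma>. The trace of this is Ric (1 - n) / (n - 1) = -Ric.\<close>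

lemma ricci_thomas_christoffel:
  assumes sym: "\<And>x u v. x \<in> S \<Longrightarrow> \<Gamma> x u v = \<Gamma> x v u" and x: "x \<in> S" "x0 > 0" and n: "DIM('v) \<ge> 2"
  shows "ricci (thomas_christoffel \<Gamma>) (x0, x) (b, v) (c, w) = 0"
proof -
  let ?T = "thomas_christoffel \<Gamma>" and ?Y = "(b, v)" and ?W = "(c, w)" and ?m = "real DIM('v) - 1"
  have m: "?m \<noteq> 0" using n by auto
  have x': "(x0, x) \<in> {0<..} \<times> S" using x by simp
  note diff = smooth_christoffel_differentiable[OF smooth_christoffel_thomas x']
  note l = smooth_christoffel_linear[OF \<Gamma> x(1)]
  have r: "linear (ricci \<Gamma> x u)" "linear (\<lambda>u. ricci \<Gamma> x u v)" for u v
    using bilinear_ricci[OF \<Gamma> x(1)] by (auto simp: bilinear_def)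
  have d1: "fst (fd (\<lambda>y. ?T y Y W) (x0, x) (1, 0)) = - (1 / ?m) * ricci \<Gamma> x (snd Y) (snd W)" for Y W
  proof -
    have "fst (fd (\<lambda>y. ?T y Y W) (x0, x) (1, 0)) = fst (fd (\<lambda>x0. ?T (x0, x) Y W) x0 1)"
      by (simp add: fd_prod_directions(1)[OF diff])
    also have "((\<lambda>x0. ?T (x0, x) Y W) has_derivative
      (\<lambda>h. (- (h / ?m) * ricci \<Gamma> x (snd Y) (snd W),
         - (fst Y * h / x0\<^sup>2) *\<^sub>R snd W - (fst W * h / x0\<^sup>2) *\<^sub>R snd Y))) (at x0)"
      unfolding thomas_christoffel_def case_prod_beta using x(2) m
      by (auto intro!: derivative_eq_intros simp: power2_eq_square)
    from fd_eqI[OF this] have "fst (fd (\<lambda>x0. ?T (x0, x) Y W) x0 1) = - (1 / ?m) * ricci \<Gamma> x (snd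
        Y) (snd W)" by simp
    finally show ?thesis .
  qed
  have d2: "snd (fd (\<lambda>y. ?T y Y W) (x0, x) X) = fd (\<lambda>x. \<Gamma> x (snd Y) (snd W)) x (snd X)
     - (fst X * fst Y / x0\<^sup>2) *\<^sub>R snd W - (fst X * fst W / x0\<^sup>2) *\<^sub>R snd Y" for X Y W
  proof -
    have 1: "((\<lambda>y. \<Gamma> (snd y) (snd Y) (snd W)) has_derivative (\<lambda>h. fd (\<lambda>x. \<Gamma> x (snd Y) (snd W)) x
        (snd h))) (at (x0, x))"
      by (rule has_derivative_compose_snd[OF smooth_christoffel_has_derivative[OF \<Gamma> x(1), of "snd
          Y" "snd W"]])
    have 2: "((\<lambda>y::real \<times> 'v. (k / fst y) *\<^sub>R z) has_derivative (\<lambda>h. - (fst h * k / x0\<^sup>2) *\<^sub>R z)) (at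
        (x0, x))" for k z
      using x(2) by (auto intro!: derivative_eq_intros simp: power2_eq_square)
    have "((\<lambda>y. snd (?T y Y W)) has_derivative (\<lambda>h. fd (\<lambda>x. \<Gamma> x (snd Y) (snd W)) x (snd h)
       + - (fst h * fst Y / x0\<^sup>2) *\<^sub>R snd W + - (fst h * fst W / x0\<^sup>2) *\<^sub>R snd Y)) (at (x0, x))"
      unfolding thomas_christoffel_def case_prod_beta snd_conv by (intro has_derivative_add 1 2)
    from fd_eqI[OF this] show ?thesis using fd_snd[OF diff, of Y W X] by simp
  qed
  have d3: "fst (fd (\<lambda>y. ?T y (1, 0) W) (x0, x) X) = 0" for X W
  proof -
    have "fd (\<lambda>y. fst (?T y (1, 0) W)) (x0, x) = fd (\<lambda>y. 0) (x0, x)"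
    proof (rule fd_cong[OF _ x'])
      show "open ({0::real<..} \<times> S)" using smooth_christoffel_open[OF \<Gamma>] by (simp add: open_Times)
      fix y :: "real \<times> 'v" assume "y \<in> {0<..} \<times> S"
      then have "linear (\<lambda>u. ricci \<Gamma> (snd y) u (snd W))" using bilinear_ricci[OF \<Gamma>] by (auto simp:
          bilinear_def)
      from linear_0[OF this] show "fst (?T y (1, 0) W) = 0"
        by (simp add: thomas_christoffel_def case_prod_beta)
    qed
    then show ?thesis using fd_fst[OF diff, of "(1, 0)" W X] by simp
  qed
  have 1: "fst (curvature ?T (x0, x) (1, 0) ?Y ?W) = 0"
    unfolding curvature_def fst_add fst_diff d1 d3
    using x(2) m by (simp add: thomas_christoffel_def linear_0[OF l(1)] linear_0[OF l(2)]
        linear_0[OF r(1)] linear_0[OF r(2)]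
        linear_cmul[OF r(1)] linear_cmul[OF r(2)])
  define k where "k = ?m"
  have 2: "snd (curvature ?T (x0, x) (0, e) ?Y ?W) =
    curvature \<Gamma> x e v w - (ricci \<Gamma> x v w / k) *\<^sub>R e + (ricci \<Gamma> x e w / k) *\<^sub>R v" for e
    unfolding curvature_def snd_add snd_diff d2
    using x(2) sym[OF x(1), of e v] by (simp add: thomas_christoffel_def k_def[symmetric]
        linear_add[OF l(1)] linear_cmul[OF l(1)]
        power2_eq_square algebra_simps)
  have "ricci ?T (x0, x) ?Y ?W = eucl_trace (\<lambda>e. snd (curvature ?T (x0, x) (0, e) ?Y ?W))"
  proof -
    have lin: "linear (\<lambda>X. curvature ?T (x0, x) X ?Y ?W)"
      by (rule linear_curvature(1)[OF smooth_christoffel_thomas x'])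
    have "eucl_trace (\<lambda>e::real. fst (curvature ?T (x0, x) (e, 0) ?Y ?W)) = 0"
      unfolding eucl_trace_real 1 ..
    then show ?thesis unfolding ricci_def by (simp add: eucl_trace_prod)
  qed
  also have "\<dots> = ricci \<Gamma> x v w - ricci \<Gamma> x v w / ?m * DIM('v) + ricci \<Gamma> x v w / ?m"
  proof -
    have "linear (\<lambda>e. ricci \<Gamma> x e w / ?m)"
      using linear_compose[OF r(2) bounded_linear.linear[OF bounded_linear_divide]] by (simp add: o_def)
    from eucl_trace_rank_one[OF this] show ?thesis
      unfolding 2 k_def eucl_trace_add eucl_trace_diff by (simp add: eucl_trace_scaleR
          eucl_trace_ident ricci_def)
  qed
  also have "\<dots> = 0" using m by (simp add: field_simps)
  finally show ?thesis .
qed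

end

section \<open>Atlases and covector bundles\<close>

text \<open>The part of the manifold structure that concerns charts only.  It suffices for all local
  arguments, and the (weighted) cotangent bundles, the Thomas cone and the ambient space inherit it
  from \<open>N\<close>.\<close>

definition smooth_atlas :: "('i, 'a, 'v::euclidean_space) atlas \<Rightarrow> bool" where
  "smooth_atlas A \<longleftrightarrow> (\<Union>i\<in>indices A. cdom A i) = points A \<and>
     (\<forall>i\<in>indices A. inj_on (coord A i) (cdom A i)) \<and>
     (\<forall>i\<in>indices A. \<forall>j\<in>indices A.
        open (overlap A i j) \<and> smooth_on (overlap A i j) (trans_map A i j))"

lemma smooth_manifold_imp_smooth_atlas: "smooth_manifold A \<Longrightarrow> smooth_atlas A"
  by (simp add: smooth_manifold_def smooth_atlas_def)

lemma img_eq_overlap: "img A i = overlap A i i"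
  by (simp add: img_def overlap_def)

lemma overlap_subset_img: "overlap A i j \<subseteq> img A i"
  by (auto simp: img_def overlap_def)

lemma overlapE:
  assumes "x \<in> overlap A i j"
  obtains q where "q \<in> cdom A i" "q \<in> cdom A j" "x = coord A i q"
  using assms by (auto simp: overlap_def)

lemma inv_coord_coord:
  "inj_on (coord A i) (cdom A i) \<Longrightarrow> q \<in> cdom A i \<Longrightarrow> inv_coord A i (coord A i q) = q"
  by (simp add: inv_coord_def)

lemma trans_map_coord:
  "inj_on (coord A i) (cdom A i) \<Longrightarrow> q \<in> cdom A i \<Longrightarrow> trans_map A i j (coord A i q) = coord A j q"
  by (simp add: trans_map_def inv_coord_coord)

lemma indices_covector_bundle [simp]: "indices (covector_bundle c A) = indices A"
  by (simp add: covector_bundle_def)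

lemma cdom_covector_bundle:
  "cdom (covector_bundle c A) i = {(q, \<eta>). (q, \<eta>) \<in> points (covector_bundle c A) \<and> q \<in> cdom A i}"
  by (auto simp: covector_bundle_def)

lemma coord_covector_bundle [simp]: "coord (covector_bundle c A) i (q, \<eta>) = (coord A i q, \<eta> i)"
  by (simp add: covector_bundle_def)

lemma points_covector_bundle:
  "(q, \<eta>) \<in> points (covector_bundle c A) \<longleftrightarrow> q \<in> points A \<and>
     (\<forall>i\<in>indices A. \<forall>j\<in>indices A. q \<in> cdom A i \<inter> cdom A j \<longrightarrow>
        (\<forall>v. \<eta> j \<bullet> jac A i j (coord A i q) v = c i j (coord A i q) * (\<eta> i \<bullet> v))) \<and>
     (\<forall>i. \<not> (i \<in> indices A \<and> q \<in> cdom A i) \<longrightarrow> \<eta> i = 0)"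
  by (simp add: covector_bundle_def)

lemma indices_cotangent [simp]: "indices (cotangent A) = indices A"
  by (simp add: cotangent_def)

section \<open>Transition maps and Jacobians of a smooth atlas\<close>

context
  fixes A :: "('i, 'a, 'v::euclidean_space) atlas"
  assumes A: "smooth_atlas A"
begin

lemma atlas_inj: "i \<in> indices A \<Longrightarrow> inj_on (coord A i) (cdom A i)"
  using A by (simp add: smooth_atlas_def)

lemma atlas_cover: "(\<Union>i\<in>indices A. cdom A i) = points A"
  using A by (simp add: smooth_atlas_def)

lemma atlas_trans_map_coord:
  "i \<in> indices A \<Longrightarrow> q \<in> cdom A i \<Longrightarrow> trans_map A i j (coord A i q) = coord A j q"
  using trans_map_coord atlas_inj by metis

lemma open_overlap: "i \<in> indices A \<Longrightarrow> j \<in> indices A \<Longrightarrow> open (overlap A i j)"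
  using A by (simp add: smooth_atlas_def)

lemma open_img: "i \<in> indices A \<Longrightarrow> open (img A i)"
  by (simp add: img_eq_overlap open_overlap)

lemma smooth_trans_map:
  "i \<in> indices A \<Longrightarrow> j \<in> indices A \<Longrightarrow> smooth_on (overlap A i j) (trans_map A i j)"
  using A by (simp add: smooth_atlas_def)

lemma coord_in_overlap_iff:
  assumes "i \<in> indices A" "q \<in> cdom A i"
  shows "coord A i q \<in> overlap A i j \<longleftrightarrow> q \<in> cdom A j"
  using atlas_inj[OF assms(1)] assms by (auto simp: overlap_def inj_on_def)

context
  fixes i j x
  assumes ij: "i \<in> indices A" "j \<in> indices A" and x: "x \<in> overlap A i j"
begin

lemma trans_map_in_overlap:
  assumes "k \<in> indices A" "x \<in> overlap A i k"
  shows "trans_map A i j x \<in> overlap A j k"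
proof (rule overlapE[OF x])
  fix q assume "q \<in> cdom A i" "q \<in> cdom A j" "x = coord A i q"
  then show ?thesis using ij assms by (simp add: atlas_trans_map_coord coord_in_overlap_iff)
qed

lemma trans_map_in_img: "trans_map A i j x \<in> img A j"
  using x ij by (auto elim!: overlapE simp: atlas_trans_map_coord img_def)

lemma trans_map_trans_map:
  assumes "x \<in> overlap A i k"
  shows "trans_map A j k (trans_map A i j x) = trans_map A i k x"
proof (rule overlapE[OF x])
  fix q assume "q \<in> cdom A i" "q \<in> cdom A j" "x = coord A i q"
  then show ?thesis using ij assms by (simp add: atlas_trans_map_coord coord_in_overlap_iff)
qed

lemma trans_map_self: "trans_map A i i x = x"
  using x ij by (auto elim!: overlapE simp: atlas_trans_map_coord)

lemma trans_map_inverse: "trans_map A j i (trans_map A i j x) = x"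
  using trans_map_trans_map[of i] trans_map_self x overlap_subset_img[of A i j] by (auto simp:
      img_eq_overlap)

lemma trans_map_has_derivative: "(trans_map A i j has_derivative jac A i j x) (at x)"
  unfolding jac_def by (rule smooth_on_has_derivative[OF smooth_trans_map[OF ij] x])

lemma linear_jac: "linear (jac A i j x)"
  by (rule has_derivative_linear[OF trans_map_has_derivative])

end

lemma smooth_jac:
  "i \<in> indices A \<Longrightarrow> j \<in> indices A \<Longrightarrow> smooth_on (overlap A i j) (\<lambda>x. jac A i j x v)"
  unfolding jac_def by (rule smooth_on_frechet_derivative[OF smooth_trans_map])

lemma jac_jac:
  assumes ijk: "i \<in> indices A" "j \<in> indices A" "k \<in> indices A"
    and x: "x \<in> overlap A i j" "x \<in> overlap A i k"
  shows "jac A j k (trans_map A i j x) (jac A i j x v) = jac A i k x v"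
proof -
  have "((\<lambda>y. trans_map A j k (trans_map A i j y)) has_derivative
      (\<lambda>v. jac A j k (trans_map A i j x) (jac A i j x v))) (at x)"
    by (rule has_derivative_compose[OF trans_map_has_derivative[OF ijk(1,2) x(1)]
          trans_map_has_derivative[OF ijk(2,3)]])
      (rule trans_map_in_overlap[OF ijk(1,2) x(1) ijk(3) x(2)])
  then have "(trans_map A i k has_derivative (\<lambda>v. jac A j k (trans_map A i j x) (jac A i j x v))) (at x)"
    by (rule has_derivative_transform_within_open[of _ _ _ _ "overlap A i j \<inter> overlap A i k"])
      (use ijk x trans_map_trans_map in \<open>auto intro: open_overlap\<close>)
  then show ?thesis using fd_eqI[of "trans_map A i k"] unfolding jac_def[of A i k] by simp
qed

lemma jac_self:
  assumes "i \<in> indices A" "x \<in> img A i"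
  shows "jac A i i x v = v"
proof -
  have "(trans_map A i i has_derivative (\<lambda>v. v)) (at x)"
    by (rule has_derivative_transform_within_open[OF has_derivative_ident open_img[OF assms(1)]
        assms(2)])
      (use assms trans_map_self[of i i] in \<open>auto simp: img_eq_overlap\<close>)
  then show ?thesis by (simp add: jac_def fd_eqI)
qed

lemma jac_inverse:
  assumes ij: "i \<in> indices A" "j \<in> indices A" and x: "x \<in> overlap A i j"
  shows "jac A j i (trans_map A i j x) (jac A i j x v) = v"
    and "jac A i j x (jac A j i (trans_map A i j x) v) = v"
proof -
  have x': "x \<in> img A i" using x overlap_subset_img[of A i j] by blast
  show "jac A j i (trans_map A i j x) (jac A i j x v) = v"
    using jac_jac[OF ij ij(1) x] x' jac_self[OF ij(1) x'] by (simp add: img_eq_overlap)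
  have y: "trans_map A i j x \<in> overlap A j i"
    using trans_map_in_overlap[OF ij x ij(1)] x' by (simp add: img_eq_overlap)
  have y': "trans_map A i j x \<in> img A j" using y overlap_subset_img[of A j i] by blast
  show "jac A i j x (jac A j i (trans_map A i j x) v) = v"
    using jac_jac[OF ij(2,1,2) y] jac_self[OF ij(2) y'] y' trans_map_inverse[OF ij x]
    by (simp add: img_eq_overlap)
qed

lemma smooth_inverse_jac:
  assumes ij: "i \<in> indices A" "j \<in> indices A"
  shows "smooth_on (overlap A i j) (\<lambda>x. jac A j i (trans_map A i j x) v)"
proof (rule smooth_on_compose[OF open_overlap[OF ij] _ smooth_jac[OF ij(2,1)] smooth_trans_map[OF ij]])
  show "trans_map A i j ` overlap A i j \<subseteq> overlap A j i"
    using trans_map_in_overlap[OF ij _ ij(1)] overlap_subset_img[of A i j] by (auto simp: img_eq_overlap)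
qed

lemma torsion_free_connection_smooth_christoffel:
  assumes "torsion_free_connection A D" "i \<in> indices A"
  shows "smooth_christoffel (img A i) (D i)"
  using assms open_img by (simp add: smooth_christoffel_def torsion_free_connection_def
      affine_connection_def)

section \<open>Weighted covectors and the charts of their bundle\<close>

definition weight_cocycle :: "('i \<Rightarrow> 'i \<Rightarrow> 'v \<Rightarrow> real) \<Rightarrow> bool" where
  "weight_cocycle c \<longleftrightarrow> (\<forall>i\<in>indices A. \<forall>j\<in>indices A. smooth_on (overlap A i j) (c i j) \<and>
     (\<forall>x\<in>overlap A i j. c i j x \<noteq> 0 \<and>
       (\<forall>k\<in>indices A. x \<in> overlap A i k \<longrightarrow> c i k x = c j k (trans_map A i j x) * c i j x)))"

lemma weight_cocycle_1: "weight_cocycle (\<lambda>i j x. 1)"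
  unfolding weight_cocycle_def by (auto intro: smooth_on_const open_overlap)

text \<open>The weight times the transposed inverse Jacobian, written out in the basis because
  covectors are represented by vectors.\<close>

definition covector_change :: "('i \<Rightarrow> 'i \<Rightarrow> 'v \<Rightarrow> real) \<Rightarrow> 'i \<Rightarrow> 'i \<Rightarrow> 'v \<Rightarrow> 'v \<Rightarrow> 'v" where
  "covector_change c i j x \<alpha> = (\<Sum>b\<in>Basis. (c i j x * (\<alpha> \<bullet> jac A j i (trans_map A i j x) b)) *\<^sub>R b)"

lemma covector_change_inner:
  assumes ij: "i \<in> indices A" "j \<in> indices A" and x: "x \<in> overlap A i j"
  shows "covector_change c i j x \<alpha> \<bullet> v = c i j x * (\<alpha> \<bullet> jac A j i (trans_map A i j x) v)"
    and "covector_change c i j x \<alpha> \<bullet> jac A i j x w = c i j x * (\<alpha> \<bullet> w)"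
proof -
  have l: "linear (jac A j i (trans_map A i j x))"
    using trans_map_in_overlap[OF ij x ij(1)] x overlap_subset_img[of A i j]
    by (intro linear_jac ij) (auto simp: img_eq_overlap)
  show *: "covector_change c i j x \<alpha> \<bullet> v = c i j x * (\<alpha> \<bullet> jac A j i (trans_map A i j x) v)" for v
    by (subst linear_eq_sum_Basis[OF l])
      (simp add: covector_change_def inner_sum_left inner_sum_right sum_distrib_left
          inner_commute[of v] mult_ac)
  show "covector_change c i j x \<alpha> \<bullet> jac A i j x w = c i j x * (\<alpha> \<bullet> w)"
    by (simp add: * jac_inverse[OF ij x])
qed

context
  fixes c
  assumes c: "weight_cocycle c"
begin

text \<open>For i = j = k the cocycle identity says that c i i x equals its own square; as it is
  nonzero, it is 1.\<close>

lemma weight_cocycle_self: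
  assumes "i \<in> indices A" "x \<in> img A i"
  shows "c i i x = 1"
proof -
  have x: "x \<in> overlap A i i" using assms by (simp add: img_eq_overlap)
  have "c i i x = c i i (trans_map A i i x) * c i i x" "c i i x \<noteq> 0"
    using c assms(1) x unfolding weight_cocycle_def by blast+
  then show ?thesis by (simp add: trans_map_self[OF assms(1) assms(1) x])
qed

lemma covector_component_change:
  assumes "(q, \<eta>) \<in> points (covector_bundle c A)" "i \<in> indices A" "j \<in> indices A" "q \<in> cdom A i"
      "q \<in> cdom A j"
  shows "\<eta> j = covector_change c i j (coord A i q) (\<eta> i)"
proof (rule vector_eq_rdot[THEN iffD1], rule allI)
  fix v
  let ?x = "coord A i q"
  have x: "?x \<in> overlap A i j" using assms by (simp add: coord_in_overlap_iff)
  have "\<eta> j \<bullet> jac A i j ?x (jac A j i (trans_map A i j ?x) v) = c i j ?x * (\<eta> i \<bullet> jac A j i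
      (trans_map A i j ?x) v)"
    using assms by (simp add: points_covector_bundle)
  then show "\<eta> j \<bullet> v = covector_change c i j ?x (\<eta> i) \<bullet> v"
    by (simp add: jac_inverse[OF assms(2,3) x] covector_change_inner[OF assms(2,3) x])
qed

lemma covector_ext:
  assumes "(q, \<eta>) \<in> points (covector_bundle c A)" "(q, \<eta>') \<in> points (covector_bundle c A)"
    "i \<in> indices A" "q \<in> cdom A i" "\<eta> i = \<eta>' i"
  shows "\<eta> = \<eta>'"
proof
  fix j
  show "\<eta> j = \<eta>' j"
  proof (cases "j \<in> indices A \<and> q \<in> cdom A j")
    case True
    then show ?thesis using assms by (simp add: covector_component_change[of q _ i j])
  next
    case False
    then show ?thesis using assms(1,2) by (simp add: points_covector_bundle)
  qed
qed

text \<open>Spreading \<alpha> from the chart i by \<open>covector_change\<close> defines a covector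
  because both the weight and the Jacobians satisfy the cocycle identity. This makes every pair of
  coordinates occur in the bundle charts, so their images are full products with the model
  space.\<close>

lemma covector_exists:
  assumes i: "i \<in> indices A" and q: "q \<in> cdom A i"
  shows "\<exists>\<eta>. (q, \<eta>) \<in> points (covector_bundle c A) \<and> \<eta> i = \<alpha>"
proof -
  let ?x = "coord A i q"
  define \<eta> where "\<eta> = (\<lambda>k. if k \<in> indices A \<and> q \<in> cdom A k then covector_change c i k ?x \<alpha> else 0)"
  have x: "?x \<in> overlap A i k" if "k \<in> indices A" "q \<in> cdom A k" for k
    using that q i by (simp add: coord_in_overlap_iff)
  have "\<eta> k \<bullet> jac A j k (coord A j q) v = c j k (coord A j q) * (\<eta> j \<bullet> v)"
    if jk: "j \<in> indices A" "k \<in> indices A" "q \<in> cdom A j" "q \<in> cdom A k" for j k v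
  proof -
    note xj = x[OF jk(1,3)] and xk = x[OF jk(2,4)]
    have y: "trans_map A i j ?x = coord A j q" by (simp add: atlas_trans_map_coord i q)
    have cc: "c i k ?x = c j k (coord A j q) * c i j ?x"
      using c i jk xj xk y unfolding weight_cocycle_def by metis
    have "jac A k i (trans_map A i k ?x) (jac A j k (coord A j q) v) = jac A j i (coord A j q) v"
    proof -
      have y2: "coord A j q \<in> overlap A j k" "coord A j q \<in> overlap A j i"
        using jk q i by (auto simp: coord_in_overlap_iff)
      show ?thesis using jac_jac[OF jk(1,2) i y2, of v] jk i q
        by (simp add: atlas_trans_map_coord)
    qed
    then show ?thesis
      using jk cc y by (simp add: \<eta>_def covector_change_inner(1)[OF i jk(2) xk]
          covector_change_inner(1)[OF i jk(1) xj])
  qed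
  moreover have "\<eta> i = \<alpha>"
  proof (rule vector_eq_rdot[THEN iffD1], rule allI)
    fix v
    have xi: "?x \<in> img A i" using q by (auto simp: img_def)
    show "\<eta> i \<bullet> v = \<alpha> \<bullet> v"
      using i q covector_change_inner(1)[OF i i x[OF i q], of c \<alpha> v] trans_map_self[OF i i x[OF i q]]
      by (simp add: \<eta>_def jac_self[OF i xi] weight_cocycle_self[OF i xi])
  qed
  moreover have "q \<in> points A" using i q atlas_cover by blast
  ultimately show ?thesis
    by (intro exI[of _ \<eta>]) (auto simp: points_covector_bundle \<eta>_def)
qed

lemma overlap_covector_bundle:
  assumes "i \<in> indices A"
  shows "overlap (covector_bundle c A) i j = overlap A i j \<times> UNIV"
proof (intro set_eqI iffI)
  fix y assume "y \<in> overlap (covector_bundle c A) i j"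
  then show "y \<in> overlap A i j \<times> UNIV" by (auto simp: overlap_def cdom_covector_bundle)
next
  fix y assume "y \<in> overlap A i j \<times> (UNIV :: 'v set)"
  then obtain q p where q: "q \<in> cdom A i" "q \<in> cdom A j" "y = (coord A i q, p)" by (auto simp:
      overlap_def)
  obtain \<eta> where "(q, \<eta>) \<in> points (covector_bundle c A)" "\<eta> i = p"
    using covector_exists[OF assms q(1)] by blast
  then show "y \<in> overlap (covector_bundle c A) i j"
    using q by (auto simp: overlap_def cdom_covector_bundle intro!: image_eqI[of _ _ "(q, \<eta>)"])
qed

lemma img_covector_bundle: "i \<in> indices A \<Longrightarrow> img (covector_bundle c A) i = img A i \<times> UNIV"
  by (simp add: img_eq_overlap overlap_covector_bundle)

lemma inj_coord_covector_bundle: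
  "i \<in> indices A \<Longrightarrow> inj_on (coord (covector_bundle c A) i) (cdom (covector_bundle c A) i)"
  by (rule inj_onI) (use atlas_inj covector_ext in \<open>fastforce simp: cdom_covector_bundle inj_on_def\<close>)

lemma trans_map_covector_bundle:
  assumes ij: "i \<in> indices A" "j \<in> indices A" and x: "x \<in> overlap A i j"
  shows "trans_map (covector_bundle c A) i j (x, p) = (trans_map A i j x, covector_change c i j x p)"
proof -
  obtain q where q: "q \<in> cdom A i" "q \<in> cdom A j" "x = coord A i q" using x by (rule overlapE)
  obtain \<eta> where \<eta>: "(q, \<eta>) \<in> points (covector_bundle c A)" "\<eta> i = p"
    using covector_exists[OF ij(1) q(1)] by blast
  have "trans_map (covector_bundle c A) i j (coord (covector_bundle c A) i (q, \<eta>)) = coord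
      (covector_bundle c A) j (q, \<eta>)"
    by (rule trans_map_coord[OF inj_coord_covector_bundle[OF ij(1)]]) (use q \<eta> in \<open>simp add:
        cdom_covector_bundle\<close>)
  then show ?thesis
    using \<eta> q ij by (simp add: covector_component_change[OF \<eta>(1) ij q(1,2)] atlas_trans_map_coord)
qed

lemma smooth_atlas_covector_bundle: "smooth_atlas (covector_bundle c A)"
  unfolding smooth_atlas_def
proof (intro conjI ballI)
  show "(\<Union>i\<in>indices (covector_bundle c A). cdom (covector_bundle c A) i) = points (covector_bundle c A)"
    by (auto simp: cdom_covector_bundle points_covector_bundle atlas_cover[symmetric])
  fix i assume "i \<in> indices (covector_bundle c A)"
  then have i: "i \<in> indices A" by simp
  then show "inj_on (coord (covector_bundle c A) i) (cdom (covector_bundle c A) i)"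
    by (rule inj_coord_covector_bundle)
  fix j assume "j \<in> indices (covector_bundle c A)"
  then have j: "j \<in> indices A" by simp
  note o = open_overlap[OF i j]
  show o2: "open (overlap (covector_bundle c A) i j)"
    using o by (simp add: overlap_covector_bundle[OF i] open_Times)
  have c': "smooth_on (overlap A i j) (c i j)" using c i j unfolding weight_cocycle_def by blast
  have o3: "open (overlap A i j \<times> (UNIV::'v set))" using o by (simp add: open_Times)
  have "smooth_on (overlap A i j \<times> (UNIV::'v set))
    (\<lambda>y. (trans_map A i j (fst y), covector_change c i j (fst y) (snd y)))"
    unfolding covector_change_def
    by (intro smooth_intros o3 smooth_on_compose_fst[OF o3 smooth_trans_map[OF i j]]
        smooth_on_compose_fst[OF o3 c'] smooth_on_compose_fst[OF o3 smooth_inverse_jac[OF i j]])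
  then show "smooth_on (overlap (covector_bundle c A) i j) (trans_map (covector_bundle c A) i j)"
    unfolding overlap_covector_bundle[OF i]
    by (rule smooth_on_cong[OF o3]) (auto simp: trans_map_covector_bundle[OF i j])
qed

end

subsection \<open>The Patterson--Walker metric on the cotangent bundle\<close>

text \<open>The fibre part is obtained by differentiating the identity that p paired with v equals
  the new covector paired with \<open>jac A i j x v\<close>. This avoids differentiating the inverse
  Jacobian inside \<open>covector_change\<close>, and the result is already paired with Jacobian
  values, as the metric needs it.\<close>

lemma jac_cotangent:
  assumes ij: "i \<in> indices A" "j \<in> indices A" and x: "x \<in> overlap A i j"
  shows "fst (jac (cotangent A) i j (x, p) (u, \<alpha>)) = jac A i j x u"
    and "snd (jac (cotangent A) i j (x, p) (u, \<alpha>)) \<bullet> jac A i j x v =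
      \<alpha> \<bullet> v - covector_change (\<lambda>i j x. 1) i j x p \<bullet> fd (\<lambda>y. jac A i j y v) x u"
proof -
  let ?c = "\<lambda>i j x. 1::real"
  note ov = overlap_covector_bundle[OF weight_cocycle_1 ij(1), of j, folded cotangent_def]
  note tr = trans_map_covector_bundle[OF weight_cocycle_1 ij, folded cotangent_def]
  have o: "open (overlap A i j \<times> (UNIV::'v set))" using open_overlap[OF ij] by (simp add: open_Times)
  have xp: "(x, p) \<in> overlap A i j \<times> UNIV" using x by simp
  have d: "(trans_map (cotangent A) i j has_derivative jac (cotangent A) i j (x, p)) (at (x, p))"
    unfolding jac_def
    by (rule smooth_on_has_derivative[of "overlap A i j \<times> UNIV"])
      (use smooth_atlas_covector_bundle[OF weight_cocycle_1, folded cotangent_def] ij xp in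
        \<open>auto simp: smooth_atlas_def ov[symmetric]\<close>)
  have fst': "((\<lambda>y. trans_map A i j (fst y)) has_derivative (\<lambda>h. jac A i j x (fst h))) (at (x, p))"
    by (rule has_derivative_compose_fst[OF trans_map_has_derivative[OF ij x]])
  have "((\<lambda>y. trans_map A i j (fst y)) has_derivative (\<lambda>h. fst (jac (cotangent A) i j (x, p) h)))
      (at (x, p))"
    by (rule has_derivative_transform_within_open[OF has_derivative_fst[OF d] o xp]) (auto simp: tr)
  from fun_cong[OF has_derivative_unique[OF this fst']]
  show "fst (jac (cotangent A) i j (x, p) (u, \<alpha>)) = jac A i j x u" by simp
  have J: "((\<lambda>y. jac A i j (fst y) v) has_derivative (\<lambda>h. fd (\<lambda>y. jac A i j y v) x (fst h))) (at (x, p))"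
    by (rule has_derivative_compose_fst[OF smooth_on_has_derivative[OF smooth_jac[OF ij] x, of v]])
  have "((\<lambda>y. snd y \<bullet> v) has_derivative (\<lambda>h. snd (trans_map (cotangent A) i j (x, p)) \<bullet> fd (\<lambda>y.
      jac A i j y v) x (fst h)
    + snd (jac (cotangent A) i j (x, p) h) \<bullet> jac A i j (fst (x, p)) v)) (at (x, p))"
    by (rule has_derivative_transform_within_open[OF has_derivative_inner[OF has_derivative_snd[OF
        d] J] o xp])
      (auto simp: tr covector_change_inner(2)[OF ij])
  moreover have "((\<lambda>y. snd y \<bullet> v) has_derivative (\<lambda>h. snd h \<bullet> v)) (at (x, p))"
    by (auto intro!: derivative_eq_intros)
  ultimately have "(\<lambda>h. snd (trans_map (cotangent A) i j (x, p)) \<bullet> fd (\<lambda>y. jac A i j y v) x (fst h)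
    + snd (jac (cotangent A) i j (x, p) h) \<bullet> jac A i j (fst (x, p)) v) = (\<lambda>h. snd h \<bullet> v)"
    by (rule has_derivative_unique)
  from fun_cong[OF this, of "(u, \<alpha>)"]
  show "snd (jac (cotangent A) i j (x, p) (u, \<alpha>)) \<bullet> jac A i j x v =
      \<alpha> \<bullet> v - covector_change (\<lambda>i j x. 1) i j x p \<bullet> fd (\<lambda>y. jac A i j y v) x u"
    by (simp add: tr[OF x])
qed

end

section \<open>Signature and invariance of Patterson--Walker metrics\<close>

lemma has_signatureI:
  assumes "bilinear \<beta>" "\<And>u v. \<beta> u v = \<beta> v u" "subspace V" "subspace W" "dim V = p" "dim W = q"
    "span (V \<union> W) = UNIV" "\<And>u v. u \<in> V \<Longrightarrow> v \<in> W \<Longrightarrow> \<beta> u v = 0"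
    "\<And>u. u \<in> V \<Longrightarrow> u \<noteq> 0 \<Longrightarrow> \<beta> u u > 0" "\<And>v. v \<in> W \<Longrightarrow> v \<noteq> 0 \<Longrightarrow> \<beta> v v < 0"
  shows "has_signature p q \<beta>"
proof -
  have "\<exists>V W. subspace V \<and> subspace W \<and> dim V = p \<and> dim W = q \<and> span (V \<union> W) = UNIV \<and>
      (\<forall>u\<in>V. \<forall>v\<in>W. \<beta> u v = 0) \<and> (\<forall>u\<in>V. u \<noteq> 0 \<longrightarrow> \<beta> u u > 0) \<and> (\<forall>v\<in>W. v \<noteq> 0 \<longrightarrow> \<beta> v v < 0)"
    by (rule exI[of _ V], rule exI[of _ W]) (use assms in simp)
  then show ?thesis using assms(1,2) unfolding has_signature_def by blast
qed

text \<open>The Christoffel term is absorbed by the self-adjoint map s. On the graphs of e id + s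
  over the base the metric is 2 e times the Euclidean one, so e = 1 and e = -1 give complementary
  orthogonal subspaces of either sign.\<close>

lemma has_signature_patterson_walker:
  fixes D :: "('i, 'v::euclidean_space) connection"
  assumes "bilinear (D i x)"
  shows "has_signature DIM('v) DIM('v) (patterson_walker D i (x, p))"
proof -
  let ?g = "patterson_walker D i (x, p)"
  have l: "linear (D i x u)" "linear (\<lambda>u. D i x u v)" for u v
    using assms by (auto simp: bilinear_def)
  define s where "s = (\<lambda>u. \<Sum>b\<in>Basis. ((D i x u b + D i x b u) \<bullet> p / 2) *\<^sub>R b)"
  have ls: "linear s"
    unfolding s_def by (rule linearI)
      (simp_all add: linear_add[OF l(1)] linear_add[OF l(2)] linear_cmul[OF l(1)] linear_cmul[OF l(2)]
        inner_add_left sum.distrib[symmetric] scaleR_sum_right algebra_simps add_divide_distrib)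
  have s: "s u \<bullet> v = (D i x u v + D i x v u) \<bullet> p / 2" for u v
  proof -
    have "linear (\<lambda>v. (D i x u v + D i x v u) \<bullet> p / 2)"
      by (rule linearI) (simp_all add: linear_add[OF l(1)] linear_add[OF l(2)] linear_cmul[OF
          l(1)] linear_cmul[OF l(2)]
        inner_add_left algebra_simps add_divide_distrib)
    from linear_eq_sum_Basis[OF this, of v] show ?thesis
      by (simp add: s_def inner_sum_left inner_commute[of v] mult.commute)
  qed
  have g: "?g (u, \<alpha>) (v, \<beta>) = u \<bullet> \<beta> + v \<bullet> \<alpha> - 2 * (s u \<bullet> v)" for u v \<alpha> \<beta>
    by (simp add: patterson_walker_def s)
  have s_sym: "s u \<bullet> v = s v \<bullet> u" for u v by (simp add: s add.commute)
  define \<iota> where "\<iota> = (\<lambda>e u. (u, e *\<^sub>R u + s u))"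
  have \<iota>: "linear (\<iota> e)" "inj (\<iota> e)" for e
    unfolding \<iota>_def by (auto intro!: linearI injI simp: linear_add[OF ls] linear_cmul[OF ls]
        algebra_simps)
  have g_\<iota>: "?g (\<iota> d u) (\<iota> e v) = (d + e) * (u \<bullet> v)" for d e u v
    using s_sym[of u v] by (simp add: \<iota>_def g inner_add_right inner_commute[of u "s v"]
        inner_commute[of v "s u"] inner_commute[of v u] algebra_simps)
  show ?thesis
  proof (rule has_signatureI[of _ "range (\<iota> 1)" "range (\<iota> (-1))"])
    show "bilinear ?g" using nondegenerate_patterson_walker[of D i x p] assms by (simp add:
        nondegenerate_def)
    show "?g u v = ?g v u" for u v
      by (cases u; cases v) (simp add: g s_sym add.commute)
    show "subspace (range (\<iota> 1))" "subspace (range (\<iota> (- 1)))"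
      using linear_subspace_image[OF \<iota>(1) subspace_UNIV] by blast+
    show "dim (range (\<iota> 1)) = DIM('v)" "dim (range (\<iota> (- 1))) = DIM('v)"
      using dim_image_eq[OF \<iota>(1), of _ UNIV] \<iota>(2) by (auto simp: dim_UNIV)
    show "span (range (\<iota> 1) \<union> range (\<iota> (- 1))) = UNIV"
    proof (intro set_eqI iffI UNIV_I)
      fix y :: "'v \<times> 'v"
      obtain u \<alpha> where y: "y = (u, \<alpha>)" by fastforce
      \<comment> \<open>Solves a + b = u and a - b = \<alpha> - s u, the two components of
        \<open>\<iota> 1 a + \<iota> (-1) b = y\<close>.\<close>
      let ?a = "(1/2) *\<^sub>R (u + \<alpha> - s u)" and ?b = "(1/2) *\<^sub>R (u - \<alpha> + s u)"
      have ab: "?a + ?b = u" "?a - ?b = \<alpha> - s u"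
      proof -
        have "(u + \<alpha> - s u) + (u - \<alpha> + s u) = 2 *\<^sub>R u" "(u + \<alpha> - s u) - (u - \<alpha> + s u) = 2 *\<^sub>R (\<alpha> - s u)"
          by (simp_all add: scaleR_2)
        then show "?a + ?b = u" "?a - ?b = \<alpha> - s u"
          unfolding scaleR_right_distrib[symmetric] scaleR_right_diff_distrib[symmetric] by simp_all
      qed
      have "\<iota> 1 ?a + \<iota> (-1) ?b = (?a + ?b, ?a - ?b + s (?a + ?b))"
        by (simp add: \<iota>_def linear_add[OF ls])
      also have "\<dots> = y" unfolding ab y by simp
      finally have "y = \<iota> 1 ?a + \<iota> (-1) ?b" ..
      then show "y \<in> span (range (\<iota> 1) \<union> range (\<iota> (- 1)))"
        by (simp add: span_add span_base)
    qed
    show "?g u v = 0" if "u \<in> range (\<iota> 1)" "v \<in> range (\<iota> (- 1))" for u v using that by (auto simp: g_\<iota>)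
    show "?g u u > 0" if "u \<in> range (\<iota> 1)" "u \<noteq> 0" for u
      using that linear_0[OF \<iota>(1)] by (auto simp: g_\<iota>)
    show "?g u u < 0" if "u \<in> range (\<iota> (- 1))" "u \<noteq> 0" for u
      using that linear_0[OF \<iota>(1)] by (auto simp: g_\<iota>)
  qed
qed

text \<open>For the transformation law, the Hessian of the transition map enters twice: through the
  fibre part of the Jacobian of the cotangent bundle and through the inhomogeneous term of the
  connection. Paired with the covector, the two contributions cancel.\<close>

lemma pseudo_metric_patterson_walker:
  fixes A :: "('i, 'a, 'v::euclidean_space) atlas"
  assumes A: "smooth_atlas A" and D: "torsion_free_connection A D"
  shows "pseudo_metric (cotangent A) DIM('v) DIM('v) (patterson_walker D)"
  unfolding pseudo_metric_def
proof (intro ballI conjI allI)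
  note w1 = weight_cocycle_1[OF A]
  fix i assume "i \<in> indices (cotangent A)"
  then have i: "i \<in> indices A" by simp
  note img = img_covector_bundle[OF A w1 i, folded cotangent_def]
  note sc = torsion_free_connection_smooth_christoffel[OF A D i]
  have sym: "D i x u v = D i x v u" if "x \<in> img A i" for x u v
    using D i that by (simp add: torsion_free_connection_def)
  show "has_signature DIM('v) DIM('v) (patterson_walker D i y)" if "y \<in> img (cotangent A) i" for y
    using that has_signature_patterson_walker[of D i "fst y" "snd y"] smooth_christoffel_bilinear[OF sc]
    by (auto simp: img)
  show "smooth_on (img (cotangent A) i) (\<lambda>y. patterson_walker D i y X Y)" for X Y
    unfolding img by (rule smooth_patterson_walker) (use sc sym in auto)
  fix j and y X Y :: "'v \<times> 'v"
  assume "j \<in> indices (cotangent A)" and "y \<in> overlap (cotangent A) i j"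
  then have j: "j \<in> indices A" and y: "fst y \<in> overlap A i j"
    using overlap_covector_bundle[OF A w1 i, folded cotangent_def] by auto
  let ?x = "fst y" and ?p = "snd y" and ?u = "fst X" and ?v = "fst Y"
  let ?J = "jac A i j ?x" and ?q = "covector_change A (\<lambda>i j x. 1) i j (fst y) (snd y)"
  let ?H = "\<lambda>u v. fd (\<lambda>y. jac A i j y v) ?x u"
  have law: "D j (trans_map A i j ?x) (?J u) (?J v) = ?J (D i ?x u v) - ?H u v" for u v
    using D i j y by (simp add: torsion_free_connection_def affine_connection_def)
  have f: "fst (jac (cotangent A) i j y X) = ?J (fst X)" for X :: "'v \<times> 'v"
    using jac_cotangent[OF A i j y, of "snd y" "fst X" "snd X"] by auto
  have s: "snd (jac (cotangent A) i j y X) \<bullet> ?J v = snd X \<bullet> v - ?q \<bullet> ?H (fst X) v" for X :: "'v \<times>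
      'v" and v
    using jac_cotangent[OF A i j y, of "snd y" "fst X" "snd X"] by auto
  have t: "trans_map (cotangent A) i j y = (trans_map A i j ?x, ?q)"
    using trans_map_covector_bundle[OF A w1 i j y, folded cotangent_def, of "snd y"] by simp
  have q: "?q \<bullet> ?J v = ?p \<bullet> v" for v
    using covector_change_inner(2)[OF A i j y, of "\<lambda>i j x. 1"] by simp
  have "patterson_walker D j (trans_map (cotangent A) i j y) (jac (cotangent A) i j y X) (jac
      (cotangent A) i j y Y)
    = snd (jac (cotangent A) i j y Y) \<bullet> ?J ?u + snd (jac (cotangent A) i j y X) \<bullet> ?J ?v
      - (D j (trans_map A i j ?x) (?J ?u) (?J ?v) + D j (trans_map A i j ?x) (?J ?v) (?J ?u)) \<bullet> ?q"
    by (simp add: patterson_walker_def case_prod_beta t f inner_commute)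
  also have "\<dots> = snd Y \<bullet> ?u + snd X \<bullet> ?v - (?q \<bullet> ?J (D i ?x ?u ?v) + ?q \<bullet> ?J (D i ?x ?v ?u))"
    unfolding s law by (simp add: inner_add_right inner_diff_right inner_commute[of _ ?q])
  also have "\<dots> = patterson_walker D i y X Y"
    unfolding q by (simp add: patterson_walker_def case_prod_beta inner_add_right inner_commute)
  finally show "patterson_walker D j (trans_map (cotangent A) i j y) (jac (cotangent A) i j y X)
      (jac (cotangent A) i j y Y)
    = patterson_walker D i y X Y" .
qed

section \<open>Transport of metrics\<close>

lemma has_signature_linear_iso:
  fixes \<beta> :: "'v::euclidean_space \<Rightarrow> 'v \<Rightarrow> real" and L :: "'w::euclidean_space \<Rightarrow> 'v"
  assumes \<beta>: "has_signature p q \<beta>" and L: "linear L" and K: "linear K"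
    and inv: "\<And>u. K (L u) = u" "\<And>v. L (K v) = v"
  shows "has_signature p q (\<lambda>u v. \<beta> (L u) (L v))"
proof -
  obtain V W where \<beta>': "bilinear \<beta>" "\<And>u v. \<beta> u v = \<beta> v u" and
    VW: "subspace V" "subspace W" "dim V = p" "dim W = q" "span (V \<union> W) = UNIV"
      "\<And>u v. u \<in> V \<Longrightarrow> v \<in> W \<Longrightarrow> \<beta> u v = 0"
      "\<And>u. u \<in> V \<Longrightarrow> u \<noteq> 0 \<Longrightarrow> \<beta> u u > 0" "\<And>v. v \<in> W \<Longrightarrow> v \<noteq> 0 \<Longrightarrow> \<beta> v v < 0"
    using \<beta> unfolding has_signature_def by blast
  have injK: "inj K" using inv(2) by (metis injI)
  have dimK: "dim (K ` X) = dim X" for X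
    by (rule dim_image_eq[OF K]) (use injK in \<open>auto simp: inj_on_def\<close>)
  have L0: "L u \<noteq> 0" if "u \<noteq> 0" for u using that inv(1)[of u] linear_0[OF K] by auto
  have K0: "K x = 0 \<longleftrightarrow> x = 0" for x using inv(2)[of x] linear_0[OF K] linear_0[OF L] by metis
  show ?thesis
  proof (rule has_signatureI[of _ "K ` V" "K ` W"])
    have "linear (\<lambda>u. \<beta> u v)" "linear (\<beta> u)" for u v using \<beta>'(1) by (auto simp: bilinear_def)
    then show "bilinear (\<lambda>u v. \<beta> (L u) (L v))"
      using linear_compose[OF L] by (auto simp: bilinear_def o_def)
    show "\<beta> (L u) (L v) = \<beta> (L v) (L u)" for u v by (rule \<beta>'(2))
    show "subspace (K ` V)" "subspace (K ` W)" using linear_subspace_image[OF K] VW by auto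
    show "dim (K ` V) = p" "dim (K ` W) = q" by (simp_all add: dimK VW)
    have "span (K ` V \<union> K ` W) = K ` span (V \<union> W)"
      by (simp add: image_Un[symmetric] span_linear_image[OF K])
    also have "\<dots> = UNIV" unfolding VW(5) using inv(1) by (metis surjI)
    finally show "span (K ` V \<union> K ` W) = UNIV" .
  qed (use VW(6-8) L0 in \<open>auto simp: inv K0\<close>)
qed

text \<open>Explicit symbols \<Lambda> are available for G' only. The Levi-Civita symbols of G are
  their pullback \<Gamma> on all of S, not just at y; this is needed because the Ricci tensor
  differentiates them.\<close>

lemma ricci_levi_civita_transform:
  assumes S: "open S" and \<phi>: "smooth_on S \<phi>" "\<phi> ` S \<subseteq> T" and \<psi>: "smooth_on T \<psi>" "\<psi> ` T \<subseteq> S"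
    and inv: "\<And>y. y \<in> S \<Longrightarrow> \<psi> (\<phi> y) = y" "\<And>z. z \<in> T \<Longrightarrow> \<phi> (\<psi> z) = z"
    and G': "\<And>z. z \<in> T \<Longrightarrow> nondegenerate (G' z)" "\<And>u v. smooth_on T (\<lambda>z. G' z u v)"
      "\<And>z u v. z \<in> T \<Longrightarrow> G' z u v = G' z v u"
    and \<Lambda>: "smooth_christoffel T \<Lambda>"
      "\<And>z u v w. z \<in> T \<Longrightarrow> 2 * G' z (\<Lambda> z u v) w = koszul G' z u v w"
    and G: "\<And>y u v. y \<in> S \<Longrightarrow> G y u v = G' (\<phi> y) (fd \<phi> y u) (fd \<phi> y v)"
    and y: "y \<in> S"
  shows "ricci (levi_civita G) y u v = ricci \<Lambda> (\<phi> y) (fd \<phi> y u) (fd \<phi> y v)"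
proof -
  have T: "open T" by (rule smooth_christoffel_open[OF \<Lambda>(1)])
  define K where "K = (\<lambda>y. fd \<psi> (\<phi> y))"
  define \<Gamma> where "\<Gamma> = (\<lambda>y u v. K y (\<Lambda> (\<phi> y) (fd \<phi> y u) (fd \<phi> y v) + fd (\<lambda>z. fd \<phi> z v) y u))"
  have \<phi>T: "\<phi> y \<in> T" if "y \<in> S" for y using \<phi> that by auto
  have lin: "linear (fd \<phi> y)" "linear (K y)" if "y \<in> S" for y
    using smooth_on_differentiable[OF \<phi>(1) that] smooth_on_differentiable[OF \<psi>(1) \<phi>T[OF that]]
    by (auto simp: K_def intro: linear_frechet_derivative)
  have KJ: "K y (fd \<phi> y u) = u" "fd \<phi> y (K y v) = v" if "y \<in> S" for y u v
  proof -
    have "((\<lambda>y. \<psi> (\<phi> y)) has_derivative (\<lambda>u. K y (fd \<phi> y u))) (at y)"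
      unfolding K_def by (rule has_derivative_compose[OF smooth_on_has_derivative[OF \<phi>(1) that]
            smooth_on_has_derivative[OF \<psi>(1) \<phi>T[OF that]]])
    from has_derivative_transform_within_open[OF this S that, of "\<lambda>y. y"]
    have "((\<lambda>y. y) has_derivative (\<lambda>u. K y (fd \<phi> y u))) (at y)" by (simp add: inv)
    from has_derivative_unique[OF this has_derivative_ident] show "K y (fd \<phi> y u) = u" by metis
    have "((\<lambda>z. \<phi> (\<psi> z)) has_derivative (\<lambda>u. fd \<phi> y (K y u))) (at (\<phi> y))"
      using has_derivative_compose[OF smooth_on_has_derivative[OF \<psi>(1) \<phi>T[OF that]], of \<phi> "fd \<phi> y"]
        smooth_on_has_derivative[OF \<phi>(1) that] by (simp add: K_def inv(1)[OF that])
    from has_derivative_transform_within_open[OF this T \<phi>T[OF that], of "\<lambda>z. z"]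
    have "((\<lambda>z. z) has_derivative (\<lambda>u. fd \<phi> y (K y u))) (at (\<phi> y))" by (simp add: inv)
    from has_derivative_unique[OF this has_derivative_ident] show "fd \<phi> y (K y v) = v" by metis
  qed
  have lc: "levi_civita G y = \<Gamma> y" if "y \<in> S" for y
    unfolding \<Gamma>_def
    by (intro ext levi_civita_transform[OF S that \<phi> T G' G lin(2)[OF that] KJ[OF that] \<Lambda>(2)[OF
        \<phi>T[OF that]]])
  have H: "smooth_on S (\<lambda>y. fd (\<lambda>z. fd \<phi> z v) y u)" "smooth_on S (\<lambda>y. fd \<phi> y v)" for u v
    by (intro smooth_intros \<phi>)+
  have \<Gamma>: "smooth_christoffel S \<Gamma>"
    unfolding smooth_christoffel_def
  proof (intro conjI ballI allI S)
    fix y assume y: "y \<in> S"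
    note l = smooth_christoffel_linear[OF \<Lambda>(1) \<phi>T[OF y]] and J = lin(1)[OF y]
    have h: "linear (\<lambda>u. fd (\<lambda>z. fd \<phi> z v) y u)" "linear (\<lambda>v. fd (\<lambda>z. fd \<phi> z v) y u)" for u v
      using linear_frechet_derivative[OF smooth_on_differentiable[OF H(2) y]]
        linear_fd_family[OF S y, of "fd \<phi>"] lin(1) smooth_on_differentiable[OF H(2) y] by auto
    show "bilinear (\<Gamma> y)"
      unfolding bilinear_def \<Gamma>_def
      by (intro conjI allI linearI)
        (simp_all add: linear_add[OF l(1)] linear_add[OF l(2)] linear_cmul[OF l(1)] linear_cmul[OF l(2)]
          linear_add[OF J] linear_cmul[OF J] linear_add[OF h(1)] linear_add[OF h(2)]
          linear_cmul[OF h(1)] linear_cmul[OF h(2)] linear_add[OF lin(2)[OF y]] linear_cmul[OF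
              lin(2)[OF y]]
          scaleR_add_right)
  next
    fix u v
    have 1: "smooth_on S (\<lambda>y. \<Lambda> (\<phi> y) a b)" for a b
      by (rule smooth_on_compose[OF S \<phi>(2) smooth_christoffel_smooth[OF \<Lambda>(1)] \<phi>(1)])
    have 2: "smooth_on S (\<lambda>y. K y a)" for a
      unfolding K_def by (rule smooth_on_compose[OF S \<phi>(2) smooth_on_frechet_derivative[OF \<psi>(1)] \<phi>(1)])
    have 3: "smooth_on S (\<lambda>y. \<Lambda> (\<phi> y) (fd \<phi> y u) (fd \<phi> y v))"
      by (rule smooth_on_bilinear_family[OF S _ 1 H(2) H(2)])
        (rule smooth_christoffel_bilinear[OF \<Lambda>(1) \<phi>T])
    show "smooth_on S (\<lambda>y. \<Gamma> y u v)"
      unfolding \<Gamma>_def by (rule smooth_on_linear_family[OF S lin(2) 2 smooth_on_add[OF S 3 H(1)]])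
  qed
  have "ricci (levi_civita G) y u v = ricci \<Gamma> y u v"
    using ricci_cong[OF S y lc] by simp
  also have "\<dots> = ricci \<Lambda> (\<phi> y) (fd \<phi> y u) (fd \<phi> y v)"
    by (rule ricci_transform[OF \<Gamma> \<Lambda>(1) \<phi> y _ lin(2)[OF y] KJ[OF y], symmetric])
      (simp add: \<Gamma>_def KJ)
  finally show ?thesis .
qed

text \<open>A diffeomorphism that in suitable charts \<open>\<kappa> j\<close> of \<open>A\<close> and \<open>j\<close> of \<open>B\<close> is given by \<open>\<theta> j\<close>, with
  inverse \<open>\<theta>' j\<close>.\<close>

locale chartwise_diffeo =
  fixes A :: "('i, 'a, 'v::euclidean_space) atlas" and B :: "('j, 'b, 'w::euclidean_space) atlas"
    and F :: "'a \<Rightarrow> 'b" and \<kappa> :: "'j \<Rightarrow> 'i" and \<theta> :: "'j \<Rightarrow> 'v \<Rightarrow> 'w" and \<theta>' :: "'j \<Rightarrow> 'w \<Rightarrow> 'v"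
  assumes A: "smooth_atlas A" and B: "smooth_atlas B"
    and \<kappa>: "\<And>j. j \<in> indices B \<Longrightarrow> \<kappa> j \<in> indices A"
    and cover: "\<And>q. q \<in> points A \<Longrightarrow> \<exists>j\<in>indices B. q \<in> cdom A (\<kappa> j)"
    and cdom_iff: "\<And>q j. q \<in> points A \<Longrightarrow> j \<in> indices B \<Longrightarrow> F q \<in> cdom B j \<longleftrightarrow> q \<in> cdom A (\<kappa> j)"
    and coord_F: "\<And>q j. j \<in> indices B \<Longrightarrow> q \<in> cdom A (\<kappa> j) \<Longrightarrow> coord B j (F q) = \<theta> j (coord A (\<kappa> j) q)"
    and smooth_\<theta>: "\<And>j. j \<in> indices B \<Longrightarrow> smooth_on (img A (\<kappa> j)) (\<theta> j)"
    and smooth_\<theta>': "\<And>j. j \<in> indices B \<Longrightarrow> smooth_on (img B j) (\<theta>' j)"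
    and \<theta>'_\<theta>: "\<And>j x. j \<in> indices B \<Longrightarrow> x \<in> img A (\<kappa> j) \<Longrightarrow> \<theta>' j (\<theta> j x) = x"
    and \<theta>'_in: "\<And>j y. j \<in> indices B \<Longrightarrow> y \<in> img B j \<Longrightarrow> \<theta>' j y \<in> img A (\<kappa> j)"
    and \<theta>_\<theta>': "\<And>j y. j \<in> indices B \<Longrightarrow> y \<in> img B j \<Longrightarrow> \<theta> j (\<theta>' j y) = y"
begin

lemma cdom_A_points: "j \<in> indices B \<Longrightarrow> q \<in> cdom A (\<kappa> j) \<Longrightarrow> q \<in> points A"
  using atlas_cover[OF A] \<kappa> by blast

lemma F_cdom: "j \<in> indices B \<Longrightarrow> q \<in> cdom A (\<kappa> j) \<Longrightarrow> F q \<in> cdom B j"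
  using cdom_iff cdom_A_points by blast

lemma \<theta>_in: "j \<in> indices B \<Longrightarrow> x \<in> img A (\<kappa> j) \<Longrightarrow> \<theta> j x \<in> img B j"
  using F_cdom[of j] coord_F[of j] by (auto simp: img_def simp flip: coord_F)

lemma F_preimage:
  assumes "j \<in> indices B" "b \<in> cdom B j"
  obtains q where "q \<in> cdom A (\<kappa> j)" "F q = b" "coord A (\<kappa> j) q = \<theta>' j (coord B j b)"
proof -
  have y: "coord B j b \<in> img B j" using assms by (simp add: img_def)
  obtain q where q: "q \<in> cdom A (\<kappa> j)" "coord A (\<kappa> j) q = \<theta>' j (coord B j b)"
    using \<theta>'_in[OF assms(1) y] by (auto simp: img_def)
  have "coord B j (F q) = coord B j b" using coord_F[OF assms(1) q(1)] q(2) \<theta>_\<theta>'[OF assms(1) y] by simp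
  then have "F q = b"
    using atlas_inj[OF B assms(1)] F_cdom[OF assms(1) q(1)] assms(2) by (auto simp: inj_on_def)
  with q show ?thesis using that by blast
qed

lemma bij_F: "bij_betw F (points A) (points B)"
proof (rule bij_betw_imageI)
  show "inj_on F (points A)"
  proof (rule inj_onI)
    fix q q' assume q: "q \<in> points A" "q' \<in> points A" "F q = F q'"
    obtain j where j: "j \<in> indices B" "q \<in> cdom A (\<kappa> j)" using cover[OF q(1)] by blast
    then have "q' \<in> cdom A (\<kappa> j)" using cdom_iff[OF q(1) j(1)] cdom_iff[OF q(2) j(1)] q(3) by simp
    moreover from this have "coord A (\<kappa> j) q = coord A (\<kappa> j) q'"
      using coord_F[OF j] coord_F[OF j(1), of q'] q(3) \<theta>'_\<theta>[OF j(1)] j(2) by (metis imageI img_def)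
    ultimately show "q = q'" using atlas_inj[OF A \<kappa>[OF j(1)]] j(2) by (auto simp: inj_on_def)
  qed
  show "F ` points A = points B"
  proof (intro set_eqI iffI)
    fix b assume "b \<in> F ` points A"
    then show "b \<in> points B" using cover F_cdom atlas_cover[OF B] by blast
  next
    fix b assume "b \<in> points B"
    then obtain j where "j \<in> indices B" "b \<in> cdom B j" using atlas_cover[OF B] by blast
    then show "b \<in> F ` points A" using F_preimage cdom_A_points by (metis imageI)
  qed
qed

lemma inv_F:
  assumes "j \<in> indices B" "b \<in> cdom B j"
  shows "inv_into (points A) F b \<in> cdom A (\<kappa> j)"
    and "coord A (\<kappa> j) (inv_into (points A) F b) = \<theta>' j (coord B j b)"
proof -
  obtain q where q: "q \<in> cdom A (\<kappa> j)" "F q = b" "coord A (\<kappa> j) q = \<theta>' j (coord B j b)"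
    using F_preimage[OF assms] by blast
  have "inv_into (points A) F b = q"
    using bij_F q(2) cdom_A_points[OF assms(1) q(1)] by (auto simp: bij_betw_def)
  then show "inv_into (points A) F b \<in> cdom A (\<kappa> j)"
    "coord A (\<kappa> j) (inv_into (points A) F b) = \<theta>' j (coord B j b)" using q by auto
qed

lemma inv_F_inv_coord:
  assumes "j \<in> indices B" "y \<in> img B j"
  shows "inv_into (points A) F (inv_coord B j y) \<in> cdom A (\<kappa> j)"
    and "coord A (\<kappa> j) (inv_into (points A) F (inv_coord B j y)) = \<theta>' j y"
  using assms inv_F[OF assms(1)] inv_coord_coord[OF atlas_inj[OF B assms(1)]] by (auto simp: img_def)

lemma diffeomorphism_F: "diffeomorphism A B F"
  unfolding diffeomorphism_def smooth_map_def
proof (intro conjI ballI bij_F)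
  show "F ` points A \<subseteq> points B" "inv_into (points A) F ` points B \<subseteq> points A"
    using bij_F bij_betw_inv_into[OF bij_F] by (auto simp: bij_betw_def)
  fix q assume "q \<in> points A"
  then obtain j where j: "j \<in> indices B" "q \<in> cdom A (\<kappa> j)" using cover by blast
  have "smooth_on (img A (\<kappa> j)) (coord B j \<circ> F \<circ> inv_coord A (\<kappa> j))"
    by (rule smooth_on_cong[OF open_img[OF A \<kappa>[OF j(1)]] smooth_\<theta>[OF j(1)]])
      (auto simp: img_def inv_coord_coord[OF atlas_inj[OF A \<kappa>[OF j(1)]]] coord_F[OF j(1)])
  then show "\<exists>i\<in>indices A. \<exists>j\<in>indices B. q \<in> cdom A i \<and> F ` cdom A i \<subseteq> cdom B j \<and>
      smooth_on (img A i) (coord B j \<circ> F \<circ> inv_coord A i)"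
    using j \<kappa> F_cdom by blast
next
  fix b assume "b \<in> points B"
  then obtain j where j: "j \<in> indices B" "b \<in> cdom B j" using atlas_cover[OF B] by blast
  have "smooth_on (img B j) (coord A (\<kappa> j) \<circ> inv_into (points A) F \<circ> inv_coord B j)"
    by (rule smooth_on_cong[OF open_img[OF B j(1)] smooth_\<theta>'[OF j(1)]]) (simp add:
        inv_F_inv_coord[OF j(1)])
  then show "\<exists>j\<in>indices B. \<exists>i\<in>indices A. b \<in> cdom B j \<and> inv_into (points A) F ` cdom B j \<subseteq> cdom A i \<and>
      smooth_on (img B j) (coord A i \<circ> inv_into (points A) F \<circ> inv_coord B j)"
    using j \<kappa> inv_F(1) by blast
qed

lemma \<theta>'_trans_map:
  assumes jk: "j \<in> indices B" "k \<in> indices B" and y: "y \<in> overlap B j k"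
  shows "\<theta>' j y \<in> overlap A (\<kappa> j) (\<kappa> k)"
    and "\<theta>' k (trans_map B j k y) = trans_map A (\<kappa> j) (\<kappa> k) (\<theta>' j y)"
proof -
  obtain b where b: "b \<in> cdom B j" "b \<in> cdom B k" "y = coord B j b" using y by (rule overlapE)
  let ?q = "inv_into (points A) F b"
  note j = inv_F[OF jk(1) b(1)] and k = inv_F[OF jk(2) b(2)]
  show "\<theta>' j y \<in> overlap A (\<kappa> j) (\<kappa> k)" using j k b by (auto simp: overlap_def intro!:
      image_eqI[of _ _ ?q])
  show "\<theta>' k (trans_map B j k y) = trans_map A (\<kappa> j) (\<kappa> k) (\<theta>' j y)"
    using b j(2) k(2) atlas_trans_map_coord[OF A \<kappa>[OF jk(1)] j(1)]
    by (simp add: atlas_trans_map_coord[OF B jk(1)])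
qed

lemma fd_\<theta>'_inverse:
  assumes j: "j \<in> indices B" and y: "y \<in> img B j"
  shows "fd (\<theta> j) (\<theta>' j y) (fd (\<theta>' j) y u) = u" "fd (\<theta>' j) y (fd (\<theta> j) (\<theta>' j y) v) = v"
proof -
  note x = \<theta>'_in[OF assms]
  note d' = smooth_on_has_derivative[OF smooth_\<theta>'[OF j] y]
  note d = smooth_on_has_derivative[OF smooth_\<theta>[OF j] x]
  have "((\<lambda>y. y) has_derivative (\<lambda>u. fd (\<theta> j) (\<theta>' j y) (fd (\<theta>' j) y u))) (at y)"
    by (rule has_derivative_transform_within_open[OF has_derivative_compose[OF d' d] open_img[OF B j] y])
      (simp add: \<theta>_\<theta>'[OF j])
  from has_derivative_unique[OF this has_derivative_ident]
  show "fd (\<theta> j) (\<theta>' j y) (fd (\<theta>' j) y u) = u" by metis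
  have "(\<theta>' j has_derivative fd (\<theta>' j) y) (at (\<theta> j (\<theta>' j y)))"
    using d' \<theta>_\<theta>'[OF assms] by simp
  from has_derivative_compose[OF d this]
  have "((\<lambda>x. x) has_derivative (\<lambda>v. fd (\<theta>' j) y (fd (\<theta> j) (\<theta>' j y) v))) (at (\<theta>' j y))"
    by (rule has_derivative_transform_within_open[OF _ open_img[OF A \<kappa>[OF j]] x])
      (simp add: \<theta>'_\<theta>[OF j])
  from has_derivative_unique[OF this has_derivative_ident]
  show "fd (\<theta>' j) y (fd (\<theta> j) (\<theta>' j y) v) = v" by metis
qed

context
  fixes G p r
  assumes G: "pseudo_metric A p r G"
begin

lemma metric_law:
  "i \<in> indices A \<Longrightarrow> j \<in> indices A \<Longrightarrow> x \<in> overlap A i j \<Longrightarrow>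
    G j (trans_map A i j x) (jac A i j x u) (jac A i j x v) = G i x u v"
  using G unfolding pseudo_metric_def by blast

text \<open>\<open>transport\<close> selects an arbitrary chart of A around the preimage point. The
  transformation law of G replaces it by \<kappa> j, in which the inverse of F is given by \<theta>'
  j.\<close>

lemma transport_eq:
  assumes j: "j \<in> indices B" and y: "y \<in> img B j"
  shows "transport A B F G j y u v = G (\<kappa> j) (\<theta>' j y) (fd (\<theta>' j) y u) (fd (\<theta>' j) y v)"
proof -
  define h where "h = inv_into (points A) F \<circ> inv_coord B j"
  define i where "i = (SOME i. i \<in> indices A \<and> h y \<in> cdom A i)"
  have hy: "h y \<in> cdom A (\<kappa> j)" "coord A (\<kappa> j) (h y) = \<theta>' j y"
    using inv_F_inv_coord[OF assms] by (auto simp: h_def)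
  have i: "i \<in> indices A" "h y \<in> cdom A i"
    using someI[of "\<lambda>i. i \<in> indices A \<and> h y \<in> cdom A i" "\<kappa> j"] hy \<kappa>[OF j] by (auto simp: i_def)
  note ij = \<kappa>[OF j] i(1)
  have ov: "\<theta>' j y \<in> overlap A (\<kappa> j) i" using hy i by (auto simp: overlap_def intro!: image_eqI[of
      _ _ "h y"])
  have "coord A i (h y) = trans_map A (\<kappa> j) i (\<theta>' j y)"
    using atlas_trans_map_coord[OF A \<kappa>[OF j] hy(1)] hy(2) by metis
  moreover have "fd (coord A i \<circ> h) y u = jac A (\<kappa> j) i (\<theta>' j y) (fd (\<theta>' j) y u)" for u
  proof -
    \<comment> \<open>The part of the image of the chart j that \<theta>' j sends into the overlap
      of \<kappa> j with the selected chart; only there is \<open>coord A i \<circ> h\<close> a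
      composition with a transition map.\<close>
    let ?U = "img B j \<inter> \<theta>' j -` overlap A (\<kappa> j) i"
    have U: "open ?U"
      using continuous_open_preimage[OF smooth_on_continuous_on[OF smooth_\<theta>'[OF j]] open_img[OF B j]
          open_overlap[OF A ij]] .
    have "((\<lambda>y. trans_map A (\<kappa> j) i (\<theta>' j y)) has_derivative
      (\<lambda>u. jac A (\<kappa> j) i (\<theta>' j y) (fd (\<theta>' j) y u))) (at y)"
      by (rule has_derivative_compose[OF smooth_on_has_derivative[OF smooth_\<theta>'[OF j] y]
            trans_map_has_derivative[OF A ij ov]])
    then have "(coord A i \<circ> h has_derivative (\<lambda>u. jac A (\<kappa> j) i (\<theta>' j y) (fd (\<theta>' j) y u))) (at y)"
    proof (rule has_derivative_transform_within_open[OF _ U])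
      show "y \<in> ?U" using y ov by simp
      fix z assume z: "z \<in> ?U"
      then have z': "z \<in> img B j" by simp
      show "trans_map A (\<kappa> j) i (\<theta>' j z) = (coord A i \<circ> h) z"
        using atlas_trans_map_coord[OF A \<kappa>[OF j] inv_F_inv_coord(1)[OF j z'], of i]
            inv_F_inv_coord(2)[OF j z']
        by (simp add: h_def)
    qed
    then show ?thesis by (simp add: fd_eqI)
  qed
  ultimately have "transport A B F G j y u v = G i (trans_map A (\<kappa> j) i (\<theta>' j y))
      (jac A (\<kappa> j) i (\<theta>' j y) (fd (\<theta>' j) y u)) (jac A (\<kappa> j) i (\<theta>' j y) (fd (\<theta>' j) y v))"
    by (simp add: transport_def Let_def h_def[symmetric] i_def[symmetric])
  also have "\<dots> = G (\<kappa> j) (\<theta>' j y) (fd (\<theta>' j) y u) (fd (\<theta>' j) y v)"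
    by (rule metric_law[OF ij ov])
  finally show ?thesis .
qed

lemma pseudo_metric_transport: "pseudo_metric B p r (transport A B F G)"
  unfolding pseudo_metric_def
proof (intro ballI conjI allI)
  fix j assume j: "j \<in> indices B"
  note i = \<kappa>[OF j]
  note d' = smooth_on_has_derivative[OF smooth_\<theta>'[OF j]]
  have sig: "has_signature p r (G (\<kappa> j) x)" if "x \<in> img A (\<kappa> j)" for x
    using G i that unfolding pseudo_metric_def by blast
  show "has_signature p r (transport A B F G j y)" if y: "y \<in> img B j" for y
  proof -
    have "has_signature p r (\<lambda>u v. G (\<kappa> j) (\<theta>' j y) (fd (\<theta>' j) y u) (fd (\<theta>' j) y v))"
      by (rule has_signature_linear_iso[OF sig[OF \<theta>'_in[OF j y]] has_derivative_linear[OF d'[OF y]]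
            has_derivative_linear[OF smooth_on_has_derivative[OF smooth_\<theta>[OF j] \<theta>'_in[OF j y]]]
            fd_\<theta>'_inverse[OF j y]])
    then show ?thesis by (simp add: transport_eq[OF j y, abs_def])
  qed
  fix u v
  have "smooth_on (img B j) (\<lambda>y. G (\<kappa> j) (\<theta>' j y) (fd (\<theta>' j) y u) (fd (\<theta>' j) y v))"
  proof (rule smooth_on_bilinear_family[OF open_img[OF B j], where B="\<lambda>y. G (\<kappa> j) (\<theta>' j y)"])
    show "bilinear (G (\<kappa> j) (\<theta>' j y))" if "y \<in> img B j" for y
      using sig[OF \<theta>'_in[OF j that]] by (simp add: has_signature_def)
    show "smooth_on (img B j) (\<lambda>y. G (\<kappa> j) (\<theta>' j y) a b)" for a b
      by (rule smooth_on_compose[OF open_img[OF B j] _ _ smooth_\<theta>'[OF j], of "img A (\<kappa> j)"])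
        (use \<theta>'_in[OF j] G i in \<open>auto simp: pseudo_metric_def\<close>)
  qed (intro smooth_on_frechet_derivative smooth_\<theta>'[OF j])+
  then show "smooth_on (img B j) (\<lambda>y. transport A B F G j y u v)"
    by (rule smooth_on_cong[OF open_img[OF B j]]) (simp add: transport_eq[OF j])
next
  fix j k y u v
  assume jk: "j \<in> indices B" "k \<in> indices B" and y: "y \<in> overlap B j k"
  note i = \<kappa>[OF jk(1)] \<kappa>[OF jk(2)]
  have yj: "y \<in> img B j" using y overlap_subset_img[of B j k] by blast
  have yk: "trans_map B j k y \<in> img B k" by (rule trans_map_in_img[OF B jk y])
  note dk = smooth_on_has_derivative[OF smooth_\<theta>'[OF jk(2)] yk]
  note dj = smooth_on_has_derivative[OF smooth_\<theta>'[OF jk(1)] yj]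
  note ov = \<theta>'_trans_map(1)[OF jk y]
  have eq: "fd (\<theta>' k) (trans_map B j k y) (jac B j k y u) = jac A (\<kappa> j) (\<kappa> k) (\<theta>' j y) (fd (\<theta>' j)
      y u)" for u
  proof -
    have "((\<lambda>y. \<theta>' k (trans_map B j k y)) has_derivative
      (\<lambda>u. jac A (\<kappa> j) (\<kappa> k) (\<theta>' j y) (fd (\<theta>' j) y u))) (at y)"
      by (rule has_derivative_transform_within_open[OF has_derivative_compose[OF dj
              trans_map_has_derivative[OF A i ov]] open_overlap[OF B jk] y])
        (simp add: \<theta>'_trans_map(2)[OF jk])
    from has_derivative_unique[OF has_derivative_compose[OF trans_map_has_derivative[OF B jk y] dk] this]
    show ?thesis by metis
  qed
  show "transport A B F G k (trans_map B j k y) (jac B j k y u) (jac B j k y v) = transport A B F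
      G j y u v"
    unfolding transport_eq[OF jk(2) yk] transport_eq[OF jk(1) yj] eq \<theta>'_trans_map(2)[OF jk y]
    by (rule metric_law[OF i ov])
qed

lemma ricci_levi_civita_transport:
  assumes \<Lambda>: "smooth_christoffel (img A (\<kappa> j)) \<Lambda>"
      "\<And>x u v w. x \<in> img A (\<kappa> j) \<Longrightarrow> 2 * G (\<kappa> j) x (\<Lambda> x u v) w = koszul (G (\<kappa> j)) x u v w"
    and nd: "\<And>x. x \<in> img A (\<kappa> j) \<Longrightarrow> nondegenerate (G (\<kappa> j) x)"
    and j: "j \<in> indices B" and y: "y \<in> img B j"
  shows "ricci (levi_civita (transport A B F G j)) y u v =
    ricci \<Lambda> (\<theta>' j y) (fd (\<theta>' j) y u) (fd (\<theta>' j) y v)"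
proof (rule ricci_levi_civita_transform[OF open_img[OF B j] smooth_\<theta>'[OF j] _ smooth_\<theta>[OF j] _ _ _
    nd _ _ \<Lambda> _ y])
  show "smooth_on (img A (\<kappa> j)) (\<lambda>z. G (\<kappa> j) z u v)" for u v
    using G \<kappa>[OF j] unfolding pseudo_metric_def by blast
  show "G (\<kappa> j) z u v = G (\<kappa> j) z v u" if "z \<in> img A (\<kappa> j)" for z u v
  proof -
    have "has_signature p r (G (\<kappa> j) z)" using G \<kappa>[OF j] that unfolding pseudo_metric_def by blast
    then show ?thesis unfolding has_signature_def by blast
  qed
qed (use \<theta>'_in[OF j] \<theta>_in[OF j] \<theta>_\<theta>'[OF j] \<theta>'_\<theta>[OF j] transport_eq[OF j] in auto)

end

end

section \<open>Determinants\<close>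

lemma eucl_det_ident: "eucl_det (\<lambda>v::'v::euclidean_space. v) = 1"
proof -
  have "(\<Prod>b\<in>Basis. \<pi> b \<bullet> (b::'v)) = (if \<pi> = id then 1 else 0)" if "\<pi> permutes Basis" for \<pi>
  proof (cases "\<pi> = id")
    case False
    then obtain c where c: "\<pi> c \<noteq> c" by (auto simp: fun_eq_iff)
    then have "c \<in> Basis" using that permutes_not_in by metis
    moreover have "\<pi> c \<bullet> c = 0" using that c \<open>c \<in> Basis\<close> by (simp add: inner_Basis permutes_in_image)
    ultimately show ?thesis using False by (auto intro!: prod_zero)
  qed simp
  then have "eucl_det (\<lambda>v::'v. v) = (\<Sum>\<pi> | \<pi> permutes (Basis :: 'v set). if \<pi> = id then 1 else 0)"
    unfolding eucl_det_def by (intro sum.cong) auto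
  also have "\<dots> = 1" by (simp add: sum.delta finite_permutations permutes_id)
  finally show ?thesis .
qed

text \<open>At the identity only the diagonal term of the Leibniz formula contributes to the derivative: a
  permutation other than the identity moves at least two basis vectors.\<close>

lemma eucl_det_has_derivative_at_ident:
  fixes K :: "'a::real_normed_vector \<Rightarrow> 'v::euclidean_space \<Rightarrow> 'v"
  assumes K: "\<And>v. ((\<lambda>y. K y v) has_derivative K' v) (at x)" "\<And>v. K x v = v"
  shows "((\<lambda>y. eucl_det (K y)) has_derivative (\<lambda>u. eucl_trace (\<lambda>v. K' v u))) (at x)"
proof -
  have "((\<lambda>y. \<Prod>b\<in>Basis. K y (\<pi> b) \<bullet> b) has_derivative
    (\<lambda>u. if \<pi> = id then eucl_trace (\<lambda>v. K' v u) else 0)) (at x)" if \<pi>: "\<pi> permutes Basis" for \<pi>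
  proof -
    have 0: "(\<Prod>j\<in>Basis - {b}. \<pi> j \<bullet> j) = (if \<pi> = id then 1 else 0)" if b: "b \<in> Basis" for b
    proof (cases "\<pi> = id")
      case False
      then obtain c where c: "\<pi> c \<noteq> c" by (auto simp: fun_eq_iff)
      \<comment> \<open>Both c and \<pi> c are moved, so at least one of them differs from the
        omitted index b and makes the product vanish.\<close>
      have "\<pi> (\<pi> c) \<noteq> \<pi> c" using c permutes_inj[OF \<pi>] by (auto dest: injD)
      then obtain d where d: "d \<noteq> b" "\<pi> d \<noteq> d" using c by metis
      then have "d \<in> Basis" using \<pi> permutes_not_in by metis
      moreover have "\<pi> d \<bullet> d = 0" using \<pi> d \<open>d \<in> Basis\<close> by (simp add: inner_Basis permutes_in_image)
      ultimately show ?thesis using False d by (auto intro!: prod_zero)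
    qed (auto intro: prod.neutral)
    have "((\<lambda>y. \<Prod>b\<in>Basis. K y (\<pi> b) \<bullet> b) has_derivative
      (\<lambda>u. \<Sum>b\<in>Basis. (K' (\<pi> b) u \<bullet> b) * (\<Prod>j\<in>Basis - {b}. K x (\<pi> j) \<bullet> j))) (at x)"
      by (intro has_derivative_prod has_derivative_inner_left K)
    then show ?thesis
      by (rule has_derivative_eq_rhs) (auto simp: K 0 eucl_trace_def fun_eq_iff)
  qed
  then have "((\<lambda>y. \<Sum>\<pi> | \<pi> permutes Basis. of_int (sign \<pi>) * (\<Prod>b\<in>Basis. K y (\<pi> b) \<bullet> b)) has_derivative
    (\<lambda>u. \<Sum>\<pi> | \<pi> permutes (Basis :: 'v set). of_int (sign \<pi>) * (if \<pi> = id then eucl_trace (\<lambda>v. K' v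
        u) else 0))) (at x)"
    by (intro has_derivative_sum has_derivative_mult_right) auto
  then show ?thesis
    unfolding eucl_det_def
  proof (rule has_derivative_eq_rhs, intro ext)
    fix u
    have "(\<Sum>\<pi> | \<pi> permutes (Basis :: 'v set). of_int (sign \<pi>) * (if \<pi> = id then eucl_trace (\<lambda>v. K'
        v u) else 0)) =
      (\<Sum>\<pi> | \<pi> permutes (Basis :: 'v set). if \<pi> = id then eucl_trace (\<lambda>v. K' v u) else 0)"
      by (intro sum.cong) (auto simp: sign_id)
    then show "(\<Sum>\<pi> | \<pi> permutes (Basis :: 'v set). of_int (sign \<pi>) * (if \<pi> = id then eucl_trace
        (\<lambda>v. K' v u) else 0)) =
      eucl_trace (\<lambda>v. K' v u)"
      by (simp add: sum.delta finite_permutations permutes_id)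
  qed
qed

lemma eucl_det_compose:
  fixes f g :: "real^'n \<Rightarrow> real^'n"
  assumes "linear f" "linear g"
  shows "eucl_det (\<lambda>v. f (g v)) = eucl_det f * eucl_det g"
  using matrix_compose[of g f] assms by (simp add: eucl_det_eq_det det_mul o_def linear_linear)

text \<open>Jacobi's formula. Composing with the fixed inverse L of M x moves the differentiation to
  the identity, and multiplicativity restores the factor. Near x the determinant of L composed with
  M y is positive, which takes care of the absolute values.\<close>

lemma abs_eucl_det_has_derivative:
  fixes M :: "'a::real_normed_vector \<Rightarrow> real^'n \<Rightarrow> real^'n"
  assumes S: "open S" "x \<in> S" and M: "\<And>y. y \<in> S \<Longrightarrow> linear (M y)" "\<And>v. ((\<lambda>y. M y v) has_derivative
      M' v) (at x)"
    and L: "linear L" "\<And>v. L (M x v) = v"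
  shows "((\<lambda>y. \<bar>eucl_det (M y)\<bar>) has_derivative
    (\<lambda>u. \<bar>eucl_det (M x)\<bar> * eucl_trace (\<lambda>v. L (M' v u)))) (at x)"
proof -
  let ?k = "\<lambda>y. eucl_det (\<lambda>v. L (M y v))"
  have k: "(?k has_derivative (\<lambda>u. eucl_trace (\<lambda>v. L (M' v u)))) (at x)"
    by (rule eucl_det_has_derivative_at_ident)
      (use L bounded_linear.has_derivative[OF _ M(2)] in \<open>auto simp: linear_linear\<close>)
  have kx: "?k x = 1" by (simp add: L eucl_det_ident)
  have mult: "eucl_det L * eucl_det (M y) = ?k y" if "y \<in> S" for y
    using eucl_det_compose[OF L(1) M(1)[OF that]] by simp
  then have inv: "eucl_det (M x) * eucl_det L = 1" using S(2) kx by (simp add: mult.commute)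
  have "\<forall>\<^sub>F y in nhds x. ?k y > 0"
  proof -
    have "(?k \<longlongrightarrow> ?k x) (nhds x)"
      using has_derivative_continuous[OF k] by (simp add: isCont_def tendsto_nhds_iff)
    from order_tendstoD(1)[OF this, of 0] show ?thesis by (simp add: kx)
  qed
  with eventually_nhds_in_open[OF S]
  have ev: "\<forall>\<^sub>F y in nhds x. \<bar>eucl_det (M x)\<bar> * ?k y = \<bar>eucl_det (M y)\<bar>"
  proof eventually_elim
    case (elim y)
    have "eucl_det (M y) = eucl_det (M x) * ?k y"
      using inv mult[OF elim(1)] by (metis mult.assoc mult.left_neutral)
    then show ?case using elim by (simp add: abs_mult)
  qed
  have "((\<lambda>y. \<bar>eucl_det (M x)\<bar> * ?k y) has_derivative (\<lambda>u. \<bar>eucl_det (M x)\<bar> * eucl_trace (\<lambda>v. L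
      (M' v u)))) (at x)"
    by (rule has_derivative_mult_right[OF k])
  then show ?thesis
  proof (rule has_derivative_transform_eventually)
    show "\<forall>\<^sub>F y in at x. \<bar>eucl_det (M x)\<bar> * ?k y = \<bar>eucl_det (M y)\<bar>"
      using ev by (simp add: eventually_at_filter eventually_mono)
    show "\<bar>eucl_det (M x)\<bar> * ?k x = \<bar>eucl_det (M x)\<bar>" by (simp add: kx)
  qed simp
qed

text \<open>A permutation moving the first basis vector sends some other b to it; since
  \<open>?F ?e\<close> is \<open>(c, 0)\<close>, which is orthogonal to b, its term vanishes. The
  remaining permutations are those of the second factor, and c splits off. Jacobians of the cone
  have this shape.\<close>

lemma eucl_det_block_triangular:
  fixes L :: "'v::euclidean_space \<Rightarrow> 'v" and l :: "'v \<Rightarrow> real"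
  assumes l: "linear l" and L: "linear L"
  shows "eucl_det (\<lambda>(a, u). (a * c + l u, L u)) = c * eucl_det L"
proof -
  let ?F = "\<lambda>(a::real, u). (a * c + l u, L u)" and ?e = "(1::real, 0::'v)"
  let ?g = "\<lambda>b::'v. (0::real, b)"
  let ?B = "?g ` Basis"
  have B: "(Basis :: (real \<times> 'v) set) = insert ?e ?B" "?e \<notin> ?B" by (auto simp: Basis_prod_def)
  have fin: "finite ?B" by simp
  have Fe: "?F ?e = (c, 0)" by (simp add: linear_0[OF l] linear_0[OF L])
  have bij: "bij_betw ?g Basis ?B" by (auto simp: bij_betw_def inj_on_def)
  let ?m = "map_permutation Basis ?g"
  let ?t = "\<lambda>\<pi>. of_int (sign \<pi>) * (\<Prod>b\<in>Basis. ?F (\<pi> b) \<bullet> b)"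
  have "eucl_det ?F = (\<Sum>\<pi> | \<pi> permutes insert ?e ?B. ?t \<pi>)"
    by (simp add: eucl_det_def B(1))
  also have "\<dots> = (\<Sum>\<pi> | \<pi> permutes ?B. ?t \<pi>)"
  proof (rule sum.mono_neutral_right)
    show "finite {\<pi>. \<pi> permutes insert ?e ?B}" by (rule finite_permutations) simp
    show "{\<pi>. \<pi> permutes ?B} \<subseteq> {\<pi>. \<pi> permutes insert ?e ?B}" by (auto intro: permutes_subset)
    show "\<forall>\<pi>\<in>{\<pi>. \<pi> permutes insert ?e ?B} - {\<pi>. \<pi> permutes ?B}. ?t \<pi> = 0"
    proof
      fix \<pi> assume \<pi>: "\<pi> \<in> {\<pi>. \<pi> permutes insert ?e ?B} - {\<pi>. \<pi> permutes ?B}"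
      have "\<pi> ?e \<noteq> ?e"
        using \<pi> permutes_superset[of \<pi> "insert ?e ?B" ?B] by auto
      obtain b where b: "b \<in> insert ?e ?B" "\<pi> b = ?e"
        using \<pi> permutes_image[of \<pi> "insert ?e ?B"] by (metis (no_types, lifting) DiffD1 imageE
            insertI1 mem_Collect_eq)
      then have "b \<in> ?B" using \<open>\<pi> ?e \<noteq> ?e\<close> by auto
      then have "?F (\<pi> b) \<bullet> b = 0" using Fe b(2) by auto
      then have "(\<Prod>b\<in>Basis. ?F (\<pi> b) \<bullet> b) = 0" using b(1) by (intro prod_zero) (auto simp: B(1))
      then show "?t \<pi> = 0" by simp
    qed
  qed
  also have "\<dots> = (\<Sum>\<pi> | \<pi> permutes (Basis::'v set). c * (of_int (sign \<pi>) * (\<Prod>b\<in>Basis. L (\<pi> b) \<bullet> b)))"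
  proof (rule sym, rule sum.reindex_bij_witness[of _ "map_permutation ?B (inv_into Basis ?g)" ?m])
    fix \<pi> :: "'v \<Rightarrow> 'v" assume "\<pi> \<in> {\<pi>. \<pi> permutes Basis}"
    then have \<pi>: "\<pi> permutes Basis" by simp
    show "map_permutation ?B (inv_into Basis ?g) (?m \<pi>) = \<pi>"
      by (rule map_permutation_compose_inv[OF bij \<pi>]) (rule inv_into_f_f, auto simp: inj_on_def)
    have m: "?m \<pi> permutes ?B" by (rule map_permutation_permutes[OF bij \<pi>])
    then show "?m \<pi> \<in> {\<pi>. \<pi> permutes ?B}" by simp
    have "?m \<pi> ?e = ?e" by (rule permutes_not_in[OF m B(2)])
    have 1: "?m \<pi> (?g b) = ?g (\<pi> b)" if "b \<in> Basis" for b
      by (rule map_permutation_apply) (use that in \<open>auto simp: inj_on_def\<close>)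
    have "(\<Prod>b\<in>Basis. ?F (?m \<pi> b) \<bullet> b) = (?F ?e \<bullet> ?e) * (\<Prod>b\<in>?B. ?F (?m \<pi> b) \<bullet> b)"
      unfolding B(1) using B(2) fin \<open>?m \<pi> ?e = ?e\<close> by (subst prod.insert) auto
    also have "\<dots> = c * (\<Prod>b\<in>Basis. ?F (?m \<pi> (?g b)) \<bullet> ?g b)"
      using prod.reindex_bij_betw[OF bij, of "\<lambda>b. ?F (?m \<pi> b) \<bullet> b"] Fe by simp
    also have "(\<Prod>b\<in>Basis. ?F (?m \<pi> (?g b)) \<bullet> ?g b) = (\<Prod>b\<in>Basis. L (\<pi> b) \<bullet> b)"
      by (intro prod.cong) (auto simp: 1)
    finally have 2: "(\<Prod>b\<in>Basis. ?F (?m \<pi> b) \<bullet> b) = c * (\<Prod>b\<in>Basis. L (\<pi> b) \<bullet> b)" .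
    have "sign (?m \<pi>) = sign \<pi>" by (rule sign_map_permutation[OF _ \<pi>]) (auto simp: inj_on_def)
    then show "?t (?m \<pi>) = c * (of_int (sign \<pi>) * (\<Prod>b\<in>Basis. L (\<pi> b) \<bullet> b))" by (simp add: 2)
  next
    fix \<pi> assume "\<pi> \<in> {\<pi>. \<pi> permutes ?B}"
    then have \<pi>: "\<pi> permutes ?B" by simp
    show "?m (map_permutation ?B (inv_into Basis ?g) \<pi>) = \<pi>"
      by (rule map_permutation_compose_inv[OF bij_betw_inv_into[OF bij] \<pi>]) (rule f_inv_into_f)
    show "map_permutation ?B (inv_into Basis ?g) \<pi> \<in> {\<pi>. \<pi> permutes Basis}"
      using map_permutation_permutes[OF bij_betw_inv_into[OF bij] \<pi>] by simp
  qed
  also have "\<dots> = c * eucl_det L" by (simp add: eucl_det_def sum_distrib_left)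
  finally show ?thesis .
qed

section \<open>Scales and their connections\<close>

context
  fixes N :: "('i, 'a, 'v::euclidean_space) atlas" and s
  assumes N: "smooth_atlas N" and s: "is_scale N s"
begin

lemma scale_pos: "i \<in> indices N \<Longrightarrow> x \<in> img N i \<Longrightarrow> s i x > 0"
  using s by (simp add: is_scale_def)

lemma smooth_scale: "i \<in> indices N \<Longrightarrow> smooth_on (img N i) (s i)"
  using s by (simp add: is_scale_def)

context
  fixes i j x
  assumes ij: "i \<in> indices N" "j \<in> indices N" and x: "x \<in> overlap N i j"
begin

lemma scale_pos_overlap: "s i x > 0" "s j (trans_map N i j x) > 0"
  using scale_pos[OF ij(1)] scale_pos[OF ij(2) trans_map_in_img[OF N ij x]] x
      overlap_subset_img[of N i j] by auto

lemma scale_trans_map: "s j (trans_map N i j x) = weight_factor 1 N i j x * s i x"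
  using s ij x by (simp add: is_scale_def)

text \<open>A scale trivialises all density bundles: solving its transformation law for the Jacobian
  determinant expresses every weight factor through quotients of values of s, whose smoothness and
  cocycle properties are immediate.\<close>

lemma abs_jac_det_scale: "abs_jac_det N i j x = (s i x / s j (trans_map N i j x)) ^ (DIM('v) + 1)"
proof -
  let ?d = "abs_jac_det N i j x" and ?n = "DIM('v) + 1"
  have eq: "?d powr (- 1 / real ?n) = s j (trans_map N i j x) / s i x"
    using scale_trans_map scale_pos_overlap by (simp add: weight_factor_def field_simps)
  \<comment> \<open>Since \<open>0 powr r = 0\<close>, a vanishing determinant would force s j to
    vanish.\<close>
  then have "?d \<noteq> 0" using scale_pos_overlap by (intro notI) simp
  have "?d \<ge> 0" by (simp add: abs_jac_det_def)
  have "?d powr (1 / real ?n) * ?d powr (- 1 / real ?n) = 1"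
    using \<open>?d \<noteq> 0\<close> by (simp only: powr_add[symmetric]) simp
  then have "?d powr (1 / real ?n) * (s j (trans_map N i j x) / s i x) = 1" unfolding eq .
  then have "s i x / s j (trans_map N i j x) = ?d powr (1 / real ?n)"
    using scale_pos_overlap by (simp add: field_simps)
  then have "(s i x / s j (trans_map N i j x)) ^ ?n = (?d powr (1 / real ?n)) ^ ?n" by simp
  also have "\<dots> = (?d powr (1 / real ?n)) powr real ?n"
    by (rule powr_realpow[symmetric]) (use \<open>?d \<noteq> 0\<close> in simp)
  also have "\<dots> = ?d" using \<open>?d \<ge> 0\<close> by (simp only: powr_powr) simp
  finally show ?thesis ..
qed

lemma weight_factor_1_scale: "weight_factor 1 N i j x = s j (trans_map N i j x) / s i x"
  using scale_trans_map scale_pos_overlap by (simp add: field_simps)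

lemma weight_factor_minus_2_scale: "weight_factor (-2) N i j x = (s i x / s j (trans_map N i j x))\<^sup>2"
proof -
  have "weight_factor (-2) N i j x = weight_factor 1 N i j x powr (-2)"
    by (simp add: weight_factor_def powr_powr)
  also have "\<dots> = (s i x / s j (trans_map N i j x))\<^sup>2"
    using scale_pos_overlap by (simp add: weight_factor_1_scale powr_minus_divide powr_divide
        power_divide)
  finally show ?thesis .
qed

end

lemma smooth_scale_trans_map:
  assumes ij: "i \<in> indices N" "j \<in> indices N"
  shows "smooth_on (overlap N i j) (\<lambda>x. s j (trans_map N i j x))"
  by (rule smooth_on_compose[OF open_overlap[OF N ij] _ smooth_scale[OF ij(2)] smooth_trans_map[OF
      N ij]])
    (use trans_map_in_img[OF N ij] in auto)

text \<open>The weight factor is the coboundary of the square of s, so the cocycle identity is a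
  telescoping product.\<close>

lemma weight_cocycle_minus_2: "weight_cocycle N (weight_factor (-2) N)"
  unfolding weight_cocycle_def[OF N]
proof (intro ballI conjI impI)
  fix i j assume ij: "i \<in> indices N" "j \<in> indices N"
  have "smooth_on (overlap N i j) (\<lambda>x. (s i x / s j (trans_map N i j x))\<^sup>2)"
    using scale_pos_overlap(2)[OF ij]
    by (intro smooth_intros smooth_scale_trans_map[OF ij] open_overlap[OF N ij]
        smooth_on_subset[OF smooth_scale[OF ij(1)] overlap_subset_img]) fastforce
  then show "smooth_on (overlap N i j) (weight_factor (-2) N i j)"
    by (rule smooth_on_cong[OF open_overlap[OF N ij]]) (simp add: weight_factor_minus_2_scale[OF ij])
  fix x assume x: "x \<in> overlap N i j"
  show "weight_factor (-2) N i j x \<noteq> 0"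
    using scale_pos_overlap[OF ij x] by (simp add: weight_factor_minus_2_scale[OF ij x])
  fix k assume k: "k \<in> indices N" and x': "x \<in> overlap N i k"
  show "weight_factor (-2) N i k x = weight_factor (-2) N j k (trans_map N i j x) * weight_factor
      (-2) N i j x"
    using scale_pos_overlap[OF ij x] trans_map_trans_map[OF N ij x x']
    by (simp add: weight_factor_minus_2_scale[OF ij x] weight_factor_minus_2_scale[OF ij(1) k x']
        weight_factor_minus_2_scale[OF ij(2) k trans_map_in_overlap[OF N ij x k x']] power_divide)
qed

end

section \<open>The connection determined by a scale\<close>

context
  fixes N :: "('i, 'a, real^'n) atlas" and s
  assumes N: "smooth_atlas N" and s: "is_scale N s"
begin

text \<open>The logarithm of the determinant is n + 1 times the difference of the logarithms of the
  two components of s. Differentiating it once through Jacobi's formula and once through s gives the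
  relation.\<close>

lemma scale_log_derivative_transform:
  assumes ij: "i \<in> indices N" "j \<in> indices N" and x: "x \<in> overlap N i j"
  shows "fd (s j) (trans_map N i j x) (jac N i j x u) / s j (trans_map N i j x) = fd (s i) x u / s i x
    - eucl_trace (\<lambda>v. jac N j i (trans_map N i j x) (fd (\<lambda>y. jac N i j y v) x u)) / (real CARD('n) + 1)"
proof -
  let ?\<phi> = "trans_map N i j" and ?n = "real CARD('n) + 1"
    and ?t = "eucl_trace (\<lambda>v. jac N j i (trans_map N i j x) (fd (\<lambda>y. jac N i j y v) x u))"
  have x': "x \<in> img N i" using x overlap_subset_img[of N i j] by blast
  have y: "?\<phi> x \<in> overlap N j i"
    using trans_map_in_overlap[OF N ij x ij(1)] x' by (simp add: img_eq_overlap)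
  note pos = scale_pos_overlap[OF N s ij]
  have "((\<lambda>y. \<bar>eucl_det (jac N i j y)\<bar>) has_derivative (\<lambda>u. \<bar>eucl_det (jac N i j x)\<bar> *
      eucl_trace (\<lambda>v. jac N j i (?\<phi> x) (fd (\<lambda>y. jac N i j y v) x u)))) (at x)"
    by (rule abs_eucl_det_has_derivative[OF open_overlap[OF N ij] x linear_jac[OF N ij]
          smooth_on_has_derivative[OF smooth_jac[OF N ij] x] linear_jac[OF N ij(2,1) y]
          jac_inverse(1)[OF N ij x]])
  moreover have "\<bar>eucl_det (jac N i j x)\<bar> > 0"
    using abs_jac_det_scale[OF N s ij x] pos[OF x] by (simp add: abs_jac_det_def)
  ultimately have "((\<lambda>y. ln \<bar>eucl_det (jac N i j y)\<bar>) has_derivative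
    (\<lambda>u. eucl_trace (\<lambda>v. jac N j i (?\<phi> x) (fd (\<lambda>y. jac N i j y v) x u)))) (at x)"
    by (auto intro!: derivative_eq_intros)
  then have 1: "((\<lambda>y. ?n * (ln (s i y) - ln (s j (?\<phi> y)))) has_derivative
    (\<lambda>u. eucl_trace (\<lambda>v. jac N j i (?\<phi> x) (fd (\<lambda>y. jac N i j y v) x u)))) (at x)"
  proof (rule has_derivative_transform_within_open[OF _ open_overlap[OF N ij] x])
    show "ln \<bar>eucl_det (jac N i j y)\<bar> = ?n * (ln (s i y) - ln (s j (?\<phi> y)))" if "y \<in> overlap N i j" for y
    using abs_jac_det_scale[OF N s ij that] pos[OF that]
    by (simp add: abs_jac_det_def ln_realpow ln_mult ln_div algebra_simps)
  qed
  have si: "(s i has_derivative fd (s i) x) (at x)"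
    by (rule smooth_on_has_derivative[OF smooth_scale[OF N s ij(1)] x'])
  have sj: "((\<lambda>y. s j (?\<phi> y)) has_derivative (\<lambda>u. fd (s j) (?\<phi> x) (jac N i j x u))) (at x)"
    by (rule has_derivative_compose[OF trans_map_has_derivative[OF N ij x]
          smooth_on_has_derivative[OF smooth_scale[OF N s ij(2)] trans_map_in_img[OF N ij x]]])
  have "((\<lambda>y. ?n * (ln (s i y) - ln (s j (?\<phi> y)))) has_derivative
    (\<lambda>u. ?n * (fd (s i) x u / s i x - fd (s j) (?\<phi> x) (jac N i j x u) / s j (?\<phi> x)))) (at x)"
    by (rule has_derivative_eq_rhs[OF has_derivative_mult_right[OF has_derivative_diff[OF
          has_derivative_ln[OF pos(1)[OF x] si] has_derivative_ln[OF pos(2)[OF x] sj]]]])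
      (simp add: fun_eq_iff divide_inverse)
  from has_derivative_unique[OF this 1]
  have "?n * (fd (s i) x u / s i x - fd (s j) (?\<phi> x) (jac N i j x u) / s j (?\<phi> x)) = ?t" by metis
  moreover have "?n \<noteq> 0" by simp
  ultimately have "fd (s i) x u / s i x - fd (s j) (?\<phi> x) (jac N i j x u) / s j (?\<phi> x) = ?t / ?n"
    using nonzero_mult_div_cancel_left by metis
  then show ?thesis by simp
qed

text \<open>Tracing the transformation law leaves the trace of the Hessian of the transition map,
  the term that appears divided by n + 1 in \<open>scale_log_derivative_transform\<close>. The two
  cancel in \<open>scale_form\<close>, which is therefore a one-form.\<close>

lemma trace_connection_transform:
  assumes D: "affine_connection N D" and ij: "i \<in> indices N" "j \<in> indices N" and x: "x \<in> overlap N i j"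
  shows "eucl_trace (D j (trans_map N i j x) (jac N i j x u)) = eucl_trace (D i x u)
    - eucl_trace (\<lambda>v. jac N j i (trans_map N i j x) (fd (\<lambda>y. jac N i j y v) x u))"
proof -
  let ?y = "trans_map N i j x"
  have x': "x \<in> img N i" using x overlap_subset_img[of N i j] by blast
  have y: "?y \<in> overlap N j i"
    using trans_map_in_overlap[OF N ij x ij(1)] x' by (simp add: img_eq_overlap)
  note J = linear_jac[OF N ij x] and K = linear_jac[OF N ij(2,1) y]
  have l: "linear (D j ?y (jac N i j x u))"
    using D ij(2) trans_map_in_img[OF N ij x] by (auto simp: affine_connection_def bilinear_def)
  have law: "D j ?y (jac N i j x u) (jac N i j x v) = jac N i j x (D i x u v) - fd (\<lambda>y. jac N i j
      y v) x u" for v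
    using D ij x by (simp add: affine_connection_def)
  have "eucl_trace (D j ?y (jac N i j x u)) = eucl_trace (\<lambda>w. jac N i j x (jac N j i ?y (D j ?y
      (jac N i j x u) w)))"
    by (simp add: jac_inverse(2)[OF N ij x])
  also have "\<dots> = eucl_trace (\<lambda>v. jac N j i ?y (D j ?y (jac N i j x u) (jac N i j x v)))"
    by (rule eucl_trace_commute[OF J]) (rule linear_compose[OF l K, unfolded o_def])
  also have "\<dots> = eucl_trace (\<lambda>v. D i x u v - jac N j i ?y (fd (\<lambda>y. jac N i j y v) x u))"
    by (simp add: law linear_diff[OF K] jac_inverse(1)[OF N ij x])
  finally show ?thesis by (simp add: eucl_trace_diff)
qed

text \<open>The one-form by which a torsion-free connection has to be changed to make the scale parallel.\<close>

definition scale_form :: "('i, real^'n) connection \<Rightarrow> 'i \<Rightarrow> real^'n \<Rightarrow> real^'n \<Rightarrow> real" where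
  "scale_form D i x u = fd (s i) x u / s i x - eucl_trace (D i x u) / (real CARD('n) + 1)"

lemma one_form_scale_form:
  assumes D: "affine_connection N D"
  shows "one_form N (scale_form D)"
  unfolding one_form_def
proof (intro ballI conjI allI)
  fix i assume i: "i \<in> indices N"
  have sc: "bilinear (D i x)" "smooth_on (img N i) (\<lambda>x. D i x u v)" if "x \<in> img N i" for x u v
    using D i that by (auto simp: affine_connection_def)
  show "linear (scale_form D i x)" if x: "x \<in> img N i" for x
  proof -
    have "linear (fd (s i) x)"
      by (rule has_derivative_linear[OF smooth_on_has_derivative[OF smooth_scale[OF N s i] x]])
    moreover have "linear (\<lambda>u. D i x u v)" for v using sc(1)[OF x] by (simp add: bilinear_def)
    ultimately show ?thesis
      unfolding scale_form_def[abs_def] eucl_trace_def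
      by (intro linearI) (simp_all add: linear_add[of "fd (s i) x"] linear_cmul[of "fd (s i) x"]
          linear_add[of "\<lambda>u. D i x u _"] linear_cmul[of "\<lambda>u. D i x u _"]
          add_divide_distrib inner_add_left sum.distrib sum_distrib_left[symmetric] algebra_simps)
  qed
  have "smooth_on (img N i) (\<lambda>x. D i x u v)" for u v
    using D i by (simp add: affine_connection_def)
  then show "smooth_on (img N i) (\<lambda>x. scale_form D i x u)" for u
    unfolding scale_form_def[abs_def] eucl_trace_def using scale_pos[OF N s i]
    by (intro smooth_intros smooth_scale[OF N s i] open_img[OF N i]) fastforce+
  fix j x u assume j: "j \<in> indices N" and x: "x \<in> overlap N i j"
  show "scale_form D j (trans_map N i j x) (jac N i j x u) = scale_form D i x u"
    unfolding scale_form_def scale_log_derivative_transform[OF i j x]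
        trace_connection_transform[OF D i j x]
    by (simp add: diff_divide_distrib)
qed

end

definition add_form :: "('i, 'v::euclidean_space) connection \<Rightarrow> ('i \<Rightarrow> 'v \<Rightarrow> 'v \<Rightarrow> real) \<Rightarrow> ('i, 'v)
    connection" where
  "add_form D \<Upsilon> i x u v = D i x u v + \<Upsilon> i x u *\<^sub>R v + \<Upsilon> i x v *\<^sub>R u"

lemma torsion_free_add_form:
  assumes N: "smooth_atlas N" and D: "torsion_free_connection N D" and \<Upsilon>: "one_form N \<Upsilon>"
  shows "torsion_free_connection N (add_form D \<Upsilon>)"
  unfolding torsion_free_connection_def affine_connection_def
proof (intro conjI ballI allI)
  fix i assume i: "i \<in> indices N"
  note sc = torsion_free_connection_smooth_christoffel[OF N D i]
  show "bilinear (add_form D \<Upsilon> i x)" if x: "x \<in> img N i" for x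
  proof -
    have u: "linear (\<Upsilon> i x)" using \<Upsilon> i x by (simp add: one_form_def)
    note l = smooth_christoffel_linear[OF sc x]
    show ?thesis unfolding bilinear_def add_form_def
      by (intro conjI allI linearI) (simp_all add: linear_add[OF u] linear_cmul[OF u] linear_add[OF l(1)]
          linear_cmul[OF l(1)] linear_add[OF l(2)] linear_cmul[OF l(2)] algebra_simps)
  qed
  have sm: "smooth_on (img N i) (\<lambda>x. \<Upsilon> i x u)" for u using \<Upsilon> i by (simp add: one_form_def)
  show "smooth_on (img N i) (\<lambda>x. add_form D \<Upsilon> i x u v)" for u v
    unfolding add_form_def
    by (intro smooth_intros sm open_img[OF N i] smooth_christoffel_smooth[OF sc])
  show "add_form D \<Upsilon> i x u v = add_form D \<Upsilon> i x v u" if "x \<in> img N i" for x u v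
    using D i that by (simp add: add_form_def torsion_free_connection_def algebra_simps)
  fix j x u v assume j: "j \<in> indices N" and x: "x \<in> overlap N i j"
  note J = linear_jac[OF N i j x]
  have "\<Upsilon> j (trans_map N i j x) (jac N i j x w) = \<Upsilon> i x w" for w
    using \<Upsilon> i j x by (simp add: one_form_def)
  moreover have "D j (trans_map N i j x) (jac N i j x u) (jac N i j x v) =
    jac N i j x (D i x u v) - fd (\<lambda>y. jac N i j y v) x u"
    using D i j x by (simp add: torsion_free_connection_def affine_connection_def)
  ultimately show "add_form D \<Upsilon> j (trans_map N i j x) (jac N i j x u) (jac N i j x v) =
    jac N i j x (add_form D \<Upsilon> i x u v) - fd (\<lambda>y. jac N i j y v) x u"
    by (simp add: add_form_def linear_add[OF J] linear_cmul[OF J])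
qed

lemma eucl_trace_add_form:
  fixes D :: "('i, 'v::euclidean_space) connection"
  assumes "linear (\<Upsilon> i x)"
  shows "eucl_trace (add_form D \<Upsilon> i x u) = eucl_trace (D i x u) + (real DIM('v) + 1) * \<Upsilon> i x u"
  unfolding add_form_def[abs_def]
  by (simp add: eucl_trace_add eucl_trace_scaleR eucl_trace_ident eucl_trace_rank_one[OF assms]
      algebra_simps)

lemma projective_structureD:
  assumes "projective_structure N P"
  obtains D0 where "torsion_free_connection N D0"
    "\<And>D. D \<in> P \<longleftrightarrow> torsion_free_connection N D \<and> projectively_equivalent N D0 D"
proof -
  obtain D0 where D0: "torsion_free_connection N D0" "P = {(D, D'). torsion_free_connection N D \<and>
      torsion_free_connection N D' \<and> projectively_equivalent N D D'} `` {D0}"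
    using assms unfolding projective_structure_def by (auto elim!: quotientE)
  show thesis by (rule that[OF D0(1)]) (simp add: D0)
qed

lemma parallel_scale_trace:
  fixes N :: "('i, 'a, 'v::euclidean_space) atlas"
  assumes "smooth_atlas N" "is_scale N s" "parallel_scale N D s" "i \<in> indices N" "x \<in> img N i"
  shows "eucl_trace (D i x u) = (real DIM('v) + 1) * (fd (s i) x u / s i x)"
  using assms(3-5) scale_pos[OF assms(1,2,4,5)] by (auto simp: parallel_scale_def field_simps)

text \<open>Shows that the choice in \<open>scale_connection\<close> has a candidate: adding
  \<Upsilon> to D0 changes the trace by n \<Upsilon> + \<Upsilon>, and \<open>scale_form\<close> is
  the \<Upsilon> that brings it to (n + 1) d log s.\<close>

lemma scale_connection_works:
  fixes N :: "('i, 'a, real^'n) atlas"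
  assumes N: "smooth_atlas N" and P: "projective_structure N P" and s: "is_scale N s"
  shows "scale_connection N P s \<in> P" "parallel_scale N (scale_connection N P s) s"
proof -
  obtain D0 where D0: "torsion_free_connection N D0"
    "\<And>D. D \<in> P \<longleftrightarrow> torsion_free_connection N D \<and> projectively_equivalent N D0 D"
    using P by (rule projective_structureD) blast
  define D where "D = add_form D0 (scale_form s D0)"
  have of: "one_form N (scale_form s D0)"
    using one_form_scale_form[OF N s] D0(1) by (simp add: torsion_free_connection_def)
  have "torsion_free_connection N D" unfolding D_def by (rule torsion_free_add_form[OF N D0(1) of])
  moreover have "projectively_equivalent N D0 D"
    unfolding projectively_equivalent_def D_def add_form_def using of by blast
  ultimately have "D \<in> P" by (simp add: D0)
  moreover have "parallel_scale N D s"
    unfolding parallel_scale_def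
  proof (intro ballI allI)
    fix i x u assume i: "i \<in> indices N" and x: "x \<in> img N i"
    have "linear (scale_form s D0 i x)" using of i x by (simp add: one_form_def)
    moreover have "(real CARD('n) + 1) * scale_form s D0 i x u =
      (real CARD('n) + 1) * (fd (s i) x u / s i x) - eucl_trace (D0 i x u)"
    proof -
      have "real CARD('n) + 1 \<noteq> 0" by simp
      then show ?thesis unfolding scale_form_def[OF N s] right_diff_distrib by simp
    qed
    ultimately have "eucl_trace (D i x u) = (real DIM(real^'n) + 1) * (fd (s i) x u / s i x)"
      using eucl_trace_add_form[of "scale_form s D0" i x D0 u] by (simp add: D_def)
    then show "fd (s i) x u - eucl_trace (D i x u) / (real DIM(real^'n) + 1) * s i x = 0"
      using scale_pos[OF N s i x] by (simp add: field_simps)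
  qed
  ultimately have "\<exists>D. D \<in> P \<and> parallel_scale N D s" by blast
  from someI_ex[OF this] show "scale_connection N P s \<in> P" "parallel_scale N (scale_connection N P s) s"
    by (simp_all add: scale_connection_def)
qed

text \<open>Both connections are D0 changed by forms U and U'. Their traces are dictated by the
  scales, so U' - U is d log s' - d log s, whichever connections were selected. For s' = e^f s this
  is df.\<close>

lemma scale_connection_change:
  fixes N :: "('i, 'a, real^'n) atlas"
  assumes N: "smooth_atlas N" and P: "projective_structure N P" and s: "is_scale N s" and s':
      "is_scale N s'"
    and i: "i \<in> indices N" and x: "x \<in> img N i"
  defines "\<Upsilon> \<equiv> \<lambda>u. fd (s' i) x u / s' i x - fd (s i) x u / s i x"
  shows "scale_connection N P s' i x u v = scale_connection N P s i x u v + \<Upsilon> u *\<^sub>R v + \<Upsilon> v *\<^sub>R u"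
proof -
  let ?D = "scale_connection N P s" and ?D' = "scale_connection N P s'"
  obtain D0 where "torsion_free_connection N D0" and
    D0: "\<And>D. D \<in> P \<longleftrightarrow> torsion_free_connection N D \<and> projectively_equivalent N D0 D"
    using P by (rule projective_structureD) blast
  have "projectively_equivalent N D0 ?D" "projectively_equivalent N D0 ?D'"
    using scale_connection_works(1)[OF N P s] scale_connection_works(1)[OF N P s'] D0 by auto
  then obtain U U' where
    U: "one_form N U" "\<And>u v. ?D i x u v = D0 i x u v + U i x u *\<^sub>R v + U i x v *\<^sub>R u" and
    U': "one_form N U'" "\<And>u v. ?D' i x u v = D0 i x u v + U' i x u *\<^sub>R v + U' i x v *\<^sub>R u"
    using i x unfolding projectively_equivalent_def by metis
  have lin: "linear (U i x)" "linear (U' i x)" using U(1) U'(1) i x by (auto simp: one_form_def)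
  have "?D i x = add_form D0 U i x" "?D' i x = add_form D0 U' i x"
    by (intro ext; simp add: U(2) U'(2) add_form_def)+
  then have "(real CARD('n) + 1) * (U' i x u - U i x u) = eucl_trace (?D' i x u) - eucl_trace (?D
      i x u)" for u
    using eucl_trace_add_form[of U i x D0 u] eucl_trace_add_form[of U' i x D0 u] lin
    by (simp add: algebra_simps)
  also have "eucl_trace (?D' i x u) - eucl_trace (?D i x u) = (real CARD('n) + 1) * \<Upsilon> u" for u
    unfolding parallel_scale_trace[OF N s scale_connection_works(2)[OF N P s] i x]
      parallel_scale_trace[OF N s' scale_connection_works(2)[OF N P s'] i x]
    by (simp add: \<Upsilon>_def algebra_simps)
  finally have "U' i x u - U i x u = \<Upsilon> u" for u
  proof -
    have "real CARD('n) + 1 \<noteq> 0" by simp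
    then show "(\<And>u. (real CARD('n) + 1) * (U' i x u - U i x u) = (real CARD('n) + 1) * \<Upsilon> u) \<Longrightarrow>
        U' i x u - U i x u = \<Upsilon> u"
      using mult_left_cancel by blast
  qed
  then have "U' i x u = U i x u + \<Upsilon> u" for u by (metis add.commute diff_eq_eq)
  then show ?thesis by (simp add: U(2) U'(2) algebra_simps)
qed

section \<open>The Thomas cone\<close>

lemma indices_thomas_cone [simp]: "indices (thomas_cone N) = Collect (is_scale N) \<times> indices N"
  by (simp add: thomas_cone_def Let_def)

lemma points_thomas_cone:
  "(q, \<sigma>) \<in> points (thomas_cone N) \<longleftrightarrow> q \<in> points N \<and> (\<forall>i\<in>indices N. q \<in> cdom N i \<longrightarrow> \<sigma> i > 0) \<and>
     (\<forall>i\<in>indices N. \<forall>j\<in>indices N. q \<in> cdom N i \<inter> cdom N j \<longrightarrow>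
        \<sigma> j = weight_factor 1 N i j (coord N i q) * \<sigma> i) \<and>
     (\<forall>i. \<not> (i \<in> indices N \<and> q \<in> cdom N i) \<longrightarrow> \<sigma> i = 0)"
  by (simp add: thomas_cone_def Let_def)

lemma cdom_thomas_cone:
  "(q, \<sigma>) \<in> cdom (thomas_cone N) (s, i) \<longleftrightarrow> (q, \<sigma>) \<in> points (thomas_cone N) \<and> q \<in> cdom N i"
  by (simp add: thomas_cone_def Let_def)

lemma coord_thomas_cone [simp]:
  "coord (thomas_cone N) (s, i) (q, \<sigma>) = (\<sigma> i / s i (coord N i q), coord N i q)"
  by (simp add: thomas_cone_def Let_def)

context
  fixes N :: "('i, 'a, 'v::euclidean_space) atlas"
  assumes N: "smooth_atlas N"
begin

lemma thomas_component_ratio: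
  assumes s: "is_scale N s" and q: "(q, \<sigma>) \<in> points (thomas_cone N)"
    and ij: "i \<in> indices N" "j \<in> indices N" "q \<in> cdom N i" "q \<in> cdom N j"
  shows "\<sigma> j / s j (coord N j q) = \<sigma> i / s i (coord N i q)"
proof -
  have x: "coord N i q \<in> overlap N i j" using ij by (simp add: coord_in_overlap_iff[OF N])
  have "\<sigma> j = weight_factor 1 N i j (coord N i q) * \<sigma> i" using q ij unfolding points_thomas_cone by blast
  also have "\<dots> = s j (coord N j q) / s i (coord N i q) * \<sigma> i"
    using weight_factor_1_scale[OF N s ij(1,2) x] ij by (simp add: atlas_trans_map_coord[OF N])
  finally show ?thesis
    using scale_pos_overlap[OF N s ij(1,2) x] ij by (simp add: atlas_trans_map_coord[OF N])
qed

lemma thomas_component_pos: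
  assumes s: "is_scale N s" and q: "(q, \<sigma>) \<in> points (thomas_cone N)" and i: "i \<in> indices N" "q \<in>
      cdom N i"
  shows "\<sigma> i / s i (coord N i q) > 0"
proof -
  have "\<sigma> i > 0" using q i unfolding points_thomas_cone by blast
  moreover have "s i (coord N i q) > 0" using scale_pos[OF N s i(1)] i(2) by (simp add: img_def)
  ultimately show ?thesis by simp
qed

lemma thomas_exists:
  assumes s: "is_scale N s" and i: "i \<in> indices N" "q \<in> cdom N i" and x0: "x0 > 0"
  shows "\<exists>\<sigma>. (q, \<sigma>) \<in> points (thomas_cone N) \<and> \<sigma> i = x0 * s i (coord N i q)"
proof -
  define \<sigma> where "\<sigma> = (\<lambda>k. if k \<in> indices N \<and> q \<in> cdom N k then x0 * s k (coord N k q) else 0)"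
  have 1: "\<sigma> k = weight_factor 1 N j k (coord N j q) * \<sigma> j"
    if jk: "j \<in> indices N" "k \<in> indices N" "q \<in> cdom N j" "q \<in> cdom N k" for j k
  proof -
    have x: "coord N j q \<in> overlap N j k" using jk by (simp add: coord_in_overlap_iff[OF N])
    show ?thesis using jk scale_trans_map[OF N s jk(1,2) x] by (simp add: \<sigma>_def
        atlas_trans_map_coord[OF N])
  qed
  have 2: "\<sigma> k > 0" if "k \<in> indices N" "q \<in> cdom N k" for k
    using that x0 scale_pos[OF N s that(1), of "coord N k q"] by (auto simp: \<sigma>_def img_def)
  have 3: "q \<in> points N" using i atlas_cover[OF N] by blast
  have 4: "\<sigma> k = 0" if "\<not> (k \<in> indices N \<and> q \<in> cdom N k)" for k
    using that by (auto simp: \<sigma>_def)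
  have "(q, \<sigma>) \<in> points (thomas_cone N)"
    unfolding points_thomas_cone using 1 2 3 4 by blast
  then show ?thesis using i by (intro exI[of _ \<sigma>]) (simp add: \<sigma>_def)
qed

lemma thomas_ext:
  assumes "(q, \<sigma>) \<in> points (thomas_cone N)" "(q, \<sigma>') \<in> points (thomas_cone N)"
    "i \<in> indices N" "q \<in> cdom N i" "\<sigma> i = \<sigma>' i"
  shows "\<sigma> = \<sigma>'"
proof
  fix k
  show "\<sigma> k = \<sigma>' k"
  proof (cases "k \<in> indices N \<and> q \<in> cdom N k")
    case True
    then have "\<sigma> k = weight_factor 1 N i k (coord N i q) * \<sigma> i" "\<sigma>' k = weight_factor 1 N i k
        (coord N i q) * \<sigma>' i"
      using assms(1-4) unfolding points_thomas_cone by blast+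
    then show ?thesis using assms(5) by simp
  next
    case False
    then show ?thesis using assms(1,2) unfolding points_thomas_cone by auto
  qed
qed

lemma inj_coord_thomas_cone:
  assumes s: "is_scale N s" and i: "i \<in> indices N"
  shows "inj_on (coord (thomas_cone N) (s, i)) (cdom (thomas_cone N) (s, i))"
proof (rule inj_onI, clarify)
  fix q \<sigma> q' \<sigma>'
  assume q: "(q, \<sigma>) \<in> cdom (thomas_cone N) (s, i)" "(q', \<sigma>') \<in> cdom (thomas_cone N) (s, i)"
    and eq: "coord (thomas_cone N) (s, i) (q, \<sigma>) = coord (thomas_cone N) (s, i) (q', \<sigma>')"
  have qq: "q \<in> cdom N i" "q' \<in> cdom N i" using q by (auto simp: cdom_thomas_cone)
  then have "q = q'" using eq atlas_inj[OF N i] by (auto simp: inj_on_def)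
  moreover have "s i (coord N i q) > 0" using scale_pos[OF N s i] qq by (auto simp: img_def)
  ultimately have "\<sigma> i = \<sigma>' i" using eq by simp
  then show "q = q' \<and> \<sigma> = \<sigma>'"
    using \<open>q = q'\<close> thomas_ext[of q \<sigma> \<sigma>' i] q i qq by (auto simp: cdom_thomas_cone)
qed

section \<open>Coordinate changes of the cone\<close>

context
  fixes s s' i j
  assumes s: "is_scale N s" "is_scale N s'" and ij: "i \<in> indices N" "j \<in> indices N"
begin

lemma overlap_thomas_cone: "overlap (thomas_cone N) (s, i) (s', j) = {0<..} \<times> overlap N i j"
proof (intro set_eqI iffI)
  fix y assume "y \<in> overlap (thomas_cone N) (s, i) (s', j)"
  then obtain q \<sigma> where q: "(q, \<sigma>) \<in> points (thomas_cone N)" "q \<in> cdom N i" "q \<in> cdom N j"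
    "y = (\<sigma> i / s i (coord N i q), coord N i q)"
    by (auto simp: overlap_def cdom_thomas_cone)
  then show "y \<in> {0<..} \<times> overlap N i j"
    using thomas_component_pos[OF s(1) q(1) ij(1) q(2)] by (auto simp: overlap_def)
next
  fix y assume "y \<in> {0::real<..} \<times> overlap N i j"
  then obtain q x0 where q: "q \<in> cdom N i" "q \<in> cdom N j" "x0 > 0" "y = (x0, coord N i q)"
    by (auto simp: overlap_def)
  obtain \<sigma> where \<sigma>: "(q, \<sigma>) \<in> points (thomas_cone N)" "\<sigma> i = x0 * s i (coord N i q)"
    using thomas_exists[OF s(1) ij(1) q(1) q(3)] by blast
  have "s i (coord N i q) > 0" using scale_pos[OF N s(1) ij(1)] q by (auto simp: img_def)
  then have "y = coord (thomas_cone N) (s, i) (q, \<sigma>)" using q \<sigma> by simp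
  then show "y \<in> overlap (thomas_cone N) (s, i) (s', j)"
    unfolding overlap_def by (rule image_eqI) (use q \<sigma> in \<open>simp add: cdom_thomas_cone\<close>)
qed

text \<open>The same point of the cone is x0 times s and x0' times s', whence the factor s / s'. The
  ratio of two scales is a function on N, so it may be evaluated in the source chart i although the
  target chart is j.\<close>

lemma trans_map_thomas_cone:
  assumes x: "x \<in> overlap N i j" "x0 > 0"
  shows "trans_map (thomas_cone N) (s, i) (s', j) (x0, x) = (x0 * (s i x / s' i x), trans_map N i j x)"
proof -
  obtain q where q: "q \<in> cdom N i" "q \<in> cdom N j" "x = coord N i q" using x(1) by (rule overlapE)
  obtain \<sigma> where \<sigma>: "(q, \<sigma>) \<in> points (thomas_cone N)" "\<sigma> i = x0 * s i (coord N i q)"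
    using thomas_exists[OF s(1) ij(1) q(1) x(2)] by blast
  have pos: "s i x > 0" using scale_pos[OF N s(1) ij(1)] q by (auto simp: img_def)
  have "trans_map (thomas_cone N) (s, i) (s', j) (coord (thomas_cone N) (s, i) (q, \<sigma>)) =
      coord (thomas_cone N) (s', j) (q, \<sigma>)"
    by (rule trans_map_coord[OF inj_coord_thomas_cone[OF s(1) ij(1)]]) (use q \<sigma> in \<open>simp add:
        cdom_thomas_cone\<close>)
  moreover have "\<sigma> j / s' j (coord N j q) = x0 * (s i x / s' i x)"
    using thomas_component_ratio[OF s(2) \<sigma>(1) ij q(1,2)] \<sigma>(2) q(3) by simp
  ultimately show ?thesis using pos \<sigma>(2) q ij by (simp add: atlas_trans_map_coord[OF N])
qed

lemma smooth_scale_ratio: "smooth_on (img N i) (\<lambda>y. s i y / s' i y)"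
  using scale_pos[OF N s(2) ij(1)]
  by (intro smooth_intros smooth_scale[OF N s(1) ij(1)] smooth_scale[OF N s(2) ij(1)] open_img[OF
      N ij(1)]) fastforce

lemma trans_map_thomas_cone_has_derivative:
  assumes x: "x \<in> overlap N i j" "x0 > 0"
  shows "(trans_map (thomas_cone N) (s, i) (s', j) has_derivative
    (\<lambda>X. (fst X * (s i x / s' i x) + x0 * fd (\<lambda>y. s i y / s' i y) x (snd X), jac N i j x (snd
        X)))) (at (x0, x))"
proof -
  let ?f = "\<lambda>y. s i y / s' i y"
  have x': "x \<in> img N i" using x overlap_subset_img[of N i j] by blast
  have "((\<lambda>y. ?f (snd y)) has_derivative (\<lambda>X. fd ?f x (snd X))) (at (x0, x))"
    by (rule has_derivative_compose_snd[OF smooth_on_has_derivative[OF smooth_scale_ratio x']])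
  from has_derivative_mult[OF has_derivative_fst[OF has_derivative_ident] this]
  have 1: "((\<lambda>y. fst y * ?f (snd y)) has_derivative (\<lambda>X. fst X * ?f x + x0 * fd ?f x (snd X))) (at
      (x0, x))"
    by (simp add: add.commute)
  have 2: "((\<lambda>y. trans_map N i j (snd y)) has_derivative (\<lambda>X. jac N i j x (snd X))) (at (x0, x))"
    by (rule has_derivative_compose_snd[OF trans_map_has_derivative[OF N ij x(1)]])
  show ?thesis
    by (rule has_derivative_transform_within_open[OF has_derivative_Pair[OF 1 2], of "{0<..} \<times>
        overlap N i j"])
      (use x open_overlap[OF N ij] in \<open>auto simp: trans_map_thomas_cone intro: open_Times\<close>)
qed

lemma jac_thomas_cone:
  assumes x: "x \<in> overlap N i j" "x0 > 0"
  shows "jac (thomas_cone N) (s, i) (s', j) (x0, x) X =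
    (fst X * (s i x / s' i x) + x0 * fd (\<lambda>y. s i y / s' i y) x (snd X), jac N i j x (snd X))"
  unfolding jac_def[of "thomas_cone N"] using fd_eqI[OF trans_map_thomas_cone_has_derivative[OF
      x]] by simp

lemma fd_jac_thomas_cone:
  assumes x: "x \<in> overlap N i j" "x0 > 0"
  defines "f \<equiv> \<lambda>y. s i y / s' i y"
  shows "fd (\<lambda>y. jac (thomas_cone N) (s, i) (s', j) y (b, v)) (x0, x) (a, u) =
    (b * fd f x u + a * fd f x v + x0 * fd (\<lambda>y. fd f y v) x u, fd (\<lambda>y. jac N i j y v) x u)"
proof -
  have x': "x \<in> img N i" using x overlap_subset_img[of N i j] by blast
  note sf = smooth_scale_ratio[folded f_def]
  have f: "((\<lambda>y. f (snd y)) has_derivative (\<lambda>X. fd f x (snd X))) (at (x0, x))"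
    by (rule has_derivative_compose_snd[OF smooth_on_has_derivative[OF sf x']])
  have f': "((\<lambda>y. fd f (snd y) v) has_derivative (\<lambda>X. fd (\<lambda>y. fd f y v) x (snd X))) (at (x0, x))"
    by (rule has_derivative_compose_snd[OF smooth_on_has_derivative[OF
        smooth_on_frechet_derivative[OF sf] x', of v]])
  have j: "((\<lambda>y. jac N i j (snd y) v) has_derivative (\<lambda>X. fd (\<lambda>y. jac N i j y v) x (snd X))) (at
      (x0, x))"
    by (rule has_derivative_compose_snd[OF smooth_on_has_derivative[OF smooth_jac[OF N ij] x(1), of v]])
  have "((\<lambda>y. (b * f (snd y) + fst y * fd f (snd y) v, jac N i j (snd y) v)) has_derivative
    (\<lambda>X. (b * fd f x (snd X) + (x0 * fd (\<lambda>y. fd f y v) x (snd X) + fst X * fd f x v),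
      fd (\<lambda>y. jac N i j y v) x (snd X)))) (at (x0, x))"
    using has_derivative_Pair[OF has_derivative_add[OF has_derivative_mult_right[OF f, of b]
          has_derivative_mult[OF has_derivative_fst[OF has_derivative_ident] f']] j] by simp
  then have "((\<lambda>y. jac (thomas_cone N) (s, i) (s', j) y (b, v)) has_derivative
    (\<lambda>X. (b * fd f x (snd X) + (x0 * fd (\<lambda>y. fd f y v) x (snd X) + fst X * fd f x v),
      fd (\<lambda>y. jac N i j y v) x (snd X)))) (at (x0, x))"
    by (rule has_derivative_transform_within_open[of _ _ _ _ "{0<..} \<times> overlap N i j"])
      (use x open_overlap[OF N ij] in \<open>auto simp: jac_thomas_cone f_def intro: open_Times\<close>)
  from fd_eqI[OF this] show ?thesis by simp
qed

end

lemma img_thomas_cone: "is_scale N s \<Longrightarrow> i \<in> indices N \<Longrightarrow> img (thomas_cone N) (s, i) = {0<..} \<times> img N i"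
  by (simp add: img_eq_overlap overlap_thomas_cone)

text \<open>The charts are indexed by scales, so one scale has to be at hand for them to cover the
  cone.\<close>

lemma smooth_atlas_thomas_cone:
  assumes s0: "is_scale N s0"
  shows "smooth_atlas (thomas_cone N)"
  unfolding smooth_atlas_def
proof (intro conjI ballI)
  show "(\<Union>k\<in>indices (thomas_cone N). cdom (thomas_cone N) k) = points (thomas_cone N)"
  proof (intro set_eqI iffI)
    fix c assume "c \<in> points (thomas_cone N)"
    moreover obtain q \<sigma> where c: "c = (q, \<sigma>)" by fastforce
    moreover from calculation have "q \<in> points N" by (simp add: points_thomas_cone)
    then obtain i where "i \<in> indices N" "q \<in> cdom N i" using atlas_cover[OF N] by blast
    ultimately show "c \<in> (\<Union>k\<in>indices (thomas_cone N). cdom (thomas_cone N) k)"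
      using s0 by (intro UN_I[of "(s0, i)"]) (auto simp: cdom_thomas_cone)
  qed (auto simp: cdom_thomas_cone)
  fix k assume "k \<in> indices (thomas_cone N)"
  then obtain s i where k: "k = (s, i)" "is_scale N s" "i \<in> indices N" by auto
  show "inj_on (coord (thomas_cone N) k) (cdom (thomas_cone N) k)"
    unfolding k(1) by (rule inj_coord_thomas_cone[OF k(2,3)])
  fix l assume "l \<in> indices (thomas_cone N)"
  then obtain s' j where l: "l = (s', j)" "is_scale N s'" "j \<in> indices N" by auto
  have o: "open ({0::real<..} \<times> overlap N i j)" using open_overlap[OF N k(3) l(3)] by (simp add:
      open_Times)
  show "open (overlap (thomas_cone N) k l)"
    unfolding k(1) l(1) overlap_thomas_cone[OF k(2) l(2) k(3) l(3)] by (rule o)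
  have "smooth_on ({0::real<..} \<times> overlap N i j)
      (\<lambda>y. (fst y * (s i (snd y) / s' i (snd y)), trans_map N i j (snd y)))"
    by (rule smooth_on_Pair[OF o smooth_on_mult[OF o smooth_on_fst[OF o smooth_on_ident[OF o]]
          smooth_on_compose_snd[OF o smooth_on_subset[OF smooth_scale_ratio[OF k(2) l(2) k(3)
              k(3)] overlap_subset_img]]]
          smooth_on_compose_snd[OF o smooth_trans_map[OF N k(3) l(3)]]])
  then show "smooth_on (overlap (thomas_cone N) k l) (trans_map (thomas_cone N) k l)"
    unfolding k(1) l(1) overlap_thomas_cone[OF k(2) l(2) k(3) l(3)]
    by (rule smooth_on_cong[OF o]) (auto simp: trans_map_thomas_cone[OF k(2) l(2) k(3) l(3)])
qed

end

lemma thomas_connection_eq: "thomas_connection N P (s, i) = thomas_christoffel (scale_connection N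
    P s i)"
  by (intro ext) (simp add: thomas_connection_def thomas_christoffel_def Let_def case_prod_beta)

section \<open>Invariance of the cone connection\<close>

context
  fixes N :: "('i, 'a, real^'n) atlas" and P
  assumes N: "smooth_atlas N" and P: "projective_structure N P" and n: "CARD('n) \<ge> 2"
begin

lemma torsion_free_scale_connection:
  assumes "is_scale N s"
  shows "torsion_free_connection N (scale_connection N P s)"
  using scale_connection_works(1)[OF N P assms] P by (auto elim!: projective_structureD)

lemma scale_connection_symmetric:
  assumes "is_scale N s" "i \<in> indices N" "x \<in> img N i"
  shows "scale_connection N P s i x u v = scale_connection N P s i x v u"
  using torsion_free_scale_connection[OF assms(1)] assms(2,3) by (simp add: torsion_free_connection_def)

lemma smooth_christoffel_scale_connection:
  assumes "is_scale N s" "i \<in> indices N"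
  shows "smooth_christoffel (img N i) (scale_connection N P s i)"
  by (rule torsion_free_connection_smooth_christoffel[OF N torsion_free_scale_connection[OF
      assms(1)] assms(2)])

lemma scale_connection_transform:
  assumes s: "is_scale N s" and ij: "i \<in> indices N" "j \<in> indices N" and x: "x \<in> overlap N i j"
  shows "scale_connection N P s j (trans_map N i j x) (jac N i j x u) (jac N i j x v) =
    jac N i j x (scale_connection N P s i x u v) - fd (\<lambda>y. jac N i j y v) x u"
  using torsion_free_scale_connection[OF s] ij x by (simp add: torsion_free_connection_def
      affine_connection_def)

text \<open>The constant in \<open>ricci_symmetric\<close> is n + 1 here, the trace being (n + 1) d
  log s. The symmetry makes the radial component of the cone symbols symmetric, as torsion-freeness
  requires.\<close>

lemma ricci_scale_connection_symmetric:
  assumes s: "is_scale N s" and i: "i \<in> indices N" and x: "x \<in> img N i"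
  shows "ricci (scale_connection N P s i) x u v = ricci (scale_connection N P s i) x v u"
proof (rule ricci_symmetric[OF smooth_christoffel_scale_connection[OF s i]
    scale_connection_symmetric[OF s i] x
      smooth_scale[OF N s i]])
  show "s i y \<noteq> 0" if "y \<in> img N i" for y using scale_pos[OF N s i that] by simp
  show "eucl_trace (scale_connection N P s i y u) = (real DIM(real^'n) + 1) * (fd (s i) y u / s i y)"
    if "y \<in> img N i" for y u
    by (rule parallel_scale_trace[OF N s scale_connection_works(2)[OF N P s] i that])
qed

lemma log_derivative_scale_ratio:
  assumes s: "is_scale N s" and s': "is_scale N s'" and i: "i \<in> indices N" and x: "x \<in> img N i"
  defines "f \<equiv> \<lambda>y. s i y / s' i y"
  shows "fd (s' i) x u / s' i x - fd (s i) x u / s i x = - (fd f x u / f x)"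
proof -
  have pos: "s i x > 0" "s' i x > 0" using scale_pos[OF N s i x] scale_pos[OF N s' i x] by auto
  have "(f has_derivative (\<lambda>u. (fd (s i) x u * s' i x - s i x * fd (s' i) x u) / (s' i x * s' i
      x))) (at x)"
    unfolding f_def
    by (rule has_derivative_divide'[OF smooth_on_has_derivative[OF smooth_scale[OF N s i] x]
          smooth_on_has_derivative[OF smooth_scale[OF N s' i] x]]) (use pos in simp)
  from fd_eqI[OF this] show ?thesis using pos by (simp add: f_def field_simps)
qed

text \<open>Here \<Upsilon> is -d log f, and the square of \<Upsilon> cancels the quadratic part of
  its derivative. What is left is minus the covariant Hessian of f divided by f, which is linear in
  the derivatives of f.\<close>

lemma ricci_scale_connection_change:
  assumes s: "is_scale N s" and s': "is_scale N s'" and i: "i \<in> indices N" and x: "x \<in> img N i"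
  defines "f \<equiv> \<lambda>y. s i y / s' i y"
  shows "ricci (scale_connection N P s' i) x u v = ricci (scale_connection N P s i) x u v +
    (real CARD('n) - 1) / f x * (fd (\<lambda>y. fd f y v) x u - fd f x (scale_connection N P s i x u v))"
proof -
  let ?D = "scale_connection N P s i"
  define \<Upsilon> where "\<Upsilon> = (\<lambda>y u. - (fd f y u / f y))"
  note o = open_img[OF N i]
  have sf: "smooth_on (img N i) f" unfolding f_def by (rule smooth_scale_ratio[OF N s s' i i])
  have fx: "f x > 0" using scale_pos[OF N s i x] scale_pos[OF N s' i x] by (simp add: f_def)
  have lin: "linear (fd f y)" if "y \<in> img N i" for y
    by (rule has_derivative_linear[OF smooth_on_has_derivative[OF sf that]])
  have d: "((\<lambda>y. \<Upsilon> y v) has_derivative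
      (\<lambda>u. - (fd (\<lambda>y. fd f y v) x u / f x - fd f x u * fd f x v / (f x)\<^sup>2))) (at x)" for v
    unfolding \<Upsilon>_def using fx by (intro has_derivative_minus log_derivative_has_derivative[OF sf x]) simp
  have "ricci (scale_connection N P s' i) x u v = ricci ?D x u v -
    (real DIM(real^'n) - 1) * (fd (\<lambda>y. \<Upsilon> y v) x u - \<Upsilon> x u * \<Upsilon> x v - \<Upsilon> x (?D x u v))"
  proof (rule ricci_projective_change[OF smooth_christoffel_scale_connection[OF s i]
      scale_connection_symmetric[OF s i] x])
    show "linear (\<Upsilon> y)" if "y \<in> img N i" for y
      unfolding \<Upsilon>_def
      by (rule linearI) (simp_all add: linear_add[OF lin[OF that]] linear_cmul[OF lin[OF that]]
          add_divide_distrib)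
    show "(\<lambda>y. \<Upsilon> y u) differentiable (at x)" for u using d by (rule differentiableI)
    show "fd (\<lambda>y. \<Upsilon> y v) x u = fd (\<lambda>y. \<Upsilon> y u) x v" for u v
      using second_derivative_symmetric[OF o x sf, of v u] by (simp add: fd_eqI[OF d])
    show "scale_connection N P s' i y u v = ?D y u v + \<Upsilon> y u *\<^sub>R v + \<Upsilon> y v *\<^sub>R u" if "y \<in> img N i"
        for y u v
      unfolding \<Upsilon>_def scale_connection_change[OF N P s s' i that]
        log_derivative_scale_ratio[OF s s' i that] by (simp add: f_def)
  qed
  also have "fd (\<lambda>y. \<Upsilon> y v) x u - \<Upsilon> x u * \<Upsilon> x v - \<Upsilon> x (?D x u v) =
    - (fd (\<lambda>y. fd f y v) x u - fd f x (?D x u v)) / f x"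
    unfolding fd_eqI[OF d] using fx by (simp add: \<Upsilon>_def power2_eq_square field_simps)
  finally show ?thesis using fx by (simp add: field_simps)
qed

lemma ricci_scale_connection_transform:
  assumes s: "is_scale N s" and ij: "i \<in> indices N" "j \<in> indices N" and x: "x \<in> overlap N i j"
  shows "ricci (scale_connection N P s j) (trans_map N i j x) (jac N i j x u) (jac N i j x v) =
    ricci (scale_connection N P s i) x u v"
proof -
  let ?D = "scale_connection N P s"
  note sc = smooth_christoffel_scale_connection[OF s]
  have y: "trans_map N i j x \<in> overlap N j i"
    using trans_map_in_overlap[OF N ij x ij(1)] x overlap_subset_img[of N i j] by (auto simp:
        img_eq_overlap)
  \<comment> \<open>The transition map is under control on the overlap only, so the symbols of the
    source chart are restricted to it.\<close>
  have sc': "smooth_christoffel (overlap N i j) (?D i)"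
    unfolding smooth_christoffel_def
    using smooth_christoffel_bilinear[OF sc[OF ij(1)]] overlap_subset_img[of N i j]
    by (intro conjI allI ballI open_overlap[OF N ij]
        smooth_on_subset[OF smooth_christoffel_smooth[OF sc[OF ij(1)]]]) auto
  have "ricci (?D j) (trans_map N i j x) (fd (trans_map N i j) x u) (fd (trans_map N i j) x v) =
      ricci (?D i) x u v"
  proof (rule ricci_transform[OF sc' sc[OF ij(2)] smooth_trans_map[OF N ij] _ x])
    show "trans_map N i j ` overlap N i j \<subseteq> img N j" using trans_map_in_img[OF N ij] by blast
    show "linear (jac N j i (trans_map N i j x))" by (rule linear_jac[OF N ij(2,1) y])
    show "?D j (trans_map N i j y) (fd (trans_map N i j) y u) (fd (trans_map N i j) y v) =
      fd (trans_map N i j) y (?D i y u v) - fd (\<lambda>z. fd (trans_map N i j) z v) y u" if "y \<in> overlap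
          N i j" for y u v
      using scale_connection_transform[OF s ij that] by (simp add: jac_def)
  qed (use jac_inverse[OF N ij x] in \<open>auto simp: jac_def\<close>)
  then show ?thesis by (simp add: jac_def)
qed

lemma torsion_free_thomas_connection: "torsion_free_connection (thomas_cone N) (thomas_connection N P)"
  unfolding torsion_free_connection_def affine_connection_def
proof (intro conjI ballI allI)
  fix k assume "k \<in> indices (thomas_cone N)"
  then obtain s i where k: "k = (s, i)" and s: "is_scale N s" and i: "i \<in> indices N" by auto
  let ?D = "scale_connection N P s i"
  note sc = smooth_christoffel_thomas[OF smooth_christoffel_scale_connection[OF s i]]
  have img: "img (thomas_cone N) k = {0<..} \<times> img N i" unfolding k by (rule img_thomas_cone[OF N s i])
  show "bilinear (thomas_connection N P k y)" if "y \<in> img (thomas_cone N) k" for y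
    using smooth_christoffel_bilinear[OF sc, of y] that[unfolded img] unfolding k
        thomas_connection_eq by blast
  show "smooth_on (img (thomas_cone N) k) (\<lambda>y. thomas_connection N P k y X Y)" for X Y
    unfolding img unfolding k thomas_connection_eq by (rule smooth_christoffel_smooth[OF sc])
  show "thomas_connection N P k y X Y = thomas_connection N P k y Y X" if "y \<in> img (thomas_cone N)
      k" for y X Y
  proof -
    have y: "snd y \<in> img N i" using that unfolding img by auto
    show ?thesis
      unfolding k thomas_connection_eq thomas_christoffel_def case_prod_beta
        ricci_scale_connection_symmetric[OF s i y, of "snd X" "snd Y"]
        scale_connection_symmetric[OF s i y, of "snd X" "snd Y"] by (simp add: algebra_simps)
  qed
  fix l and y X Y :: "real \<times> (real^'n)"
  assume "l \<in> indices (thomas_cone N)" and y: "y \<in> overlap (thomas_cone N) k l"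
  then obtain s' j where l: "l = (s', j)" and s': "is_scale N s'" and j: "j \<in> indices N" by auto
  obtain x0 x where xy: "y = (x0, x)" and x0: "x0 > 0" and x: "x \<in> overlap N i j"
    using y unfolding k l overlap_thomas_cone[OF N s s' i j] by auto
  obtain a u b v where X: "X = (a, u)" and Y: "Y = (b, v)" by fastforce
  have x': "x \<in> img N i" using x overlap_subset_img[of N i j] by blast
  define f where "f = (\<lambda>y. s i y / s' i y)"
  let ?J = "jac N i j x"
  have fx: "f x > 0" using scale_pos[OF N s i x'] scale_pos[OF N s' i x'] by (simp add: f_def)
  have lin: "linear (fd f x)"
    by (rule has_derivative_linear[OF smooth_on_has_derivative[OF smooth_scale_ratio[OF N s s' i
        i] x', folded f_def]])
  have linJ: "linear ?J" by (rule linear_jac[OF N i j x])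
  have D': "scale_connection N P s' j (trans_map N i j x) (?J u) (?J v) =
    ?J (?D x u v) - (fd f x u / f x) *\<^sub>R ?J v - (fd f x v / f x) *\<^sub>R ?J u - fd (\<lambda>y. jac N i j y v) x u"
    unfolding scale_connection_transform[OF s' i j x] scale_connection_change[OF N P s s' i x']
      log_derivative_scale_ratio[OF s s' i x', folded f_def]
    by (simp add: linear_add[OF linJ] linear_diff[OF linJ] linear_cmul[OF linJ] linear_neg[OF
        linJ] f_def)
  define m where "m = real CARD('n) - 1"
  have m: "m \<noteq> 0" using n by (simp add: m_def)
  have Ric': "ricci (scale_connection N P s' j) (trans_map N i j x) (?J u) (?J v) = ricci ?D x u v +
    m / f x * (fd (\<lambda>y. fd f y v) x u - fd f x (?D x u v))"
    unfolding ricci_scale_connection_transform[OF s' i j x] ricci_scale_connection_change[OF s s'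
        i x'] f_def m_def ..
  have J: "jac (thomas_cone N) k l y Z = (fst Z * f x + x0 * fd f x (snd Z), ?J (snd Z))" for Z
    by (simp add: xy k l jac_thomas_cone[OF N s s' i j x x0] f_def)
  have H: "fd (\<lambda>y. jac (thomas_cone N) k l y Y) y X =
    (b * fd f x u + a * fd f x v + x0 * fd (\<lambda>y. fd f y v) x u, fd (\<lambda>y. jac N i j y v) x u)"
    unfolding xy k l X Y fd_jac_thomas_cone[OF N s s' i j x x0] f_def ..
  have t: "trans_map (thomas_cone N) k l y = (x0 * f x, trans_map N i j x)"
    by (simp add: xy k l trans_map_thomas_cone[OF N s s' i j x x0] f_def)
  \<comment> \<open>A velocity a, divided by x0, becomes a / x0 plus the logarithmic derivative of f
    along u. The extra terms cancel the ones by which the connections of the two scales differ in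
    \<open>D'\<close>.\<close>
  have ratio: "(c * f x + x0 * fd f x w) / (x0 * f x) = c / x0 + fd f x w / f x" for c w
    using x0 fx by (simp add: field_simps)
  have "thomas_connection N P l (trans_map (thomas_cone N) k l y) (jac (thomas_cone N) k l y X)
      (jac (thomas_cone N) k l y Y)
    = (- (x0 * f x / m) * (ricci ?D x u v + m / f x * (fd (\<lambda>y. fd f y v) x u - fd f x (?D x u v))),
       ?J (?D x u v) - (fd f x u / f x) *\<^sub>R ?J v - (fd f x v / f x) *\<^sub>R ?J u - fd (\<lambda>y. jac N i j y v) x u
       + (a / x0 + fd f x u / f x) *\<^sub>R ?J v + (b / x0 + fd f x v / f x) *\<^sub>R ?J u)"
    unfolding t J unfolding l thomas_connection_eq thomas_christoffel_def prod.case fst_conv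
        snd_conv X Y Ric' D' ratio
    by (simp add: m_def)
  \<comment> \<open>In the radial component the factor f of the new coordinate x0 f and the
    denominator m cancel the factor m / f in front of the Hessian in \<open>Ric'\<close>.\<close>
  also have "\<dots> = (f x * (- (x0 / m) * ricci ?D x u v) + x0 * fd f x (?D x u v) - x0 * fd (\<lambda>y. fd f
      y v) x u,
      ?J (?D x u v) + (a / x0) *\<^sub>R ?J v + (b / x0) *\<^sub>R ?J u - fd (\<lambda>y. jac N i j y v) x u)"
    using fx m by (simp add: scaleR_add_left right_diff_distrib distrib_left mult.commute)
  also have "\<dots> = jac (thomas_cone N) k l y (thomas_connection N P k y X Y) - fd (\<lambda>y. jac
      (thomas_cone N) k l y Y) y X"
    unfolding J H unfolding k thomas_connection_eq thomas_christoffel_def prod.case xy X Y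
        fst_conv snd_conv
    using x0 by (simp add: m_def linear_add[OF lin] linear_cmul[OF lin] linear_add[OF linJ]
        linear_cmul[OF linJ]
        distrib_left mult.commute)
  finally show "thomas_connection N P l (trans_map (thomas_cone N) k l y) (jac (thomas_cone N) k l
      y X) (jac (thomas_cone N) k l y Y)
    = jac (thomas_cone N) k l y (thomas_connection N P k y X Y) - fd (\<lambda>y. jac (thomas_cone N) k l
        y Y) y X" .
qed

section \<open>The parallel density on the cone\<close>

lemma trace_thomas_connection:
  assumes s: "is_scale N s" and i: "i \<in> indices N" and x: "x \<in> img N i" "x0 > 0"
  shows "eucl_trace (thomas_connection N P (s, i) (x0, x) (a, u)) =
    (real CARD('n) + 1) * (fd (s i) x u / s i x) + real CARD('n) * (a / x0)"
proof -
  let ?D = "scale_connection N P s i"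
  have r: "linear (ricci ?D x u)"
    using bilinear_ricci[OF smooth_christoffel_scale_connection[OF s i] x(1)] by (simp add: bilinear_def)
  have "eucl_trace (thomas_connection N P (s, i) (x0, x) (a, u)) = eucl_trace (\<lambda>v. ?D x u v + (a /
      x0) *\<^sub>R v)"
    unfolding eucl_trace_prod thomas_connection_eq
    by (simp add: thomas_christoffel_def linear_0[OF r] eucl_trace_real)
  then show ?thesis
    using parallel_scale_trace[OF N s scale_connection_works(2)[OF N P s] i x(1), of u]
    by (simp add: eucl_trace_add eucl_trace_scaleR eucl_trace_ident)
qed

lemma special_thomas_connection: "special_connection (thomas_cone N) (thomas_connection N P)"
proof -
  let ?n = "CARD('n)"
  \<comment> \<open>An antiderivative of the trace: by \<open>trace_thomas_connection\<close> its
    logarithm must be n log x0 + (n + 1) log s.\<close>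
  define \<nu> where "\<nu> = (\<lambda>(s :: 'i \<Rightarrow> real^'n \<Rightarrow> real, i) y. fst y ^ ?n * s i (snd y) ^ (?n + 1))"
  have "\<forall>k\<in>indices (thomas_cone N). smooth_on (img (thomas_cone N) k) (\<nu> k) \<and>
    (\<forall>y\<in>img (thomas_cone N) k. \<nu> k y > 0 \<and>
       (\<forall>X. fd (\<nu> k) y X - eucl_trace (thomas_connection N P k y X) * \<nu> k y = 0)) \<and>
    (\<forall>l\<in>indices (thomas_cone N). \<forall>y\<in>overlap (thomas_cone N) k l.
       \<nu> l (trans_map (thomas_cone N) k l y) * abs_jac_det (thomas_cone N) k l y = \<nu> k y)"
  proof (rule ballI)
    fix k assume "k \<in> indices (thomas_cone N)"
    then obtain s i where k: "k = (s, i)" and s: "is_scale N s" and i: "i \<in> indices N" by auto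
    have img: "img (thomas_cone N) k = {0<..} \<times> img N i" unfolding k by (rule img_thomas_cone[OF N s i])
    have o: "open ({0::real<..} \<times> img N i)" using open_img[OF N i] by (simp add: open_Times)
    have "smooth_on (img (thomas_cone N) k) (\<nu> k)"
      unfolding img unfolding \<nu>_def k prod.case
      by (rule smooth_on_mult[OF o smooth_on_power[OF o smooth_on_fst[OF o smooth_on_ident[OF o]]]
            smooth_on_power[OF o smooth_on_compose_snd[OF o smooth_scale[OF N s i]]]])
    moreover have "\<nu> k y > 0 \<and> (\<forall>X. fd (\<nu> k) y X - eucl_trace (thomas_connection N P k y X) * \<nu> k y = 0)"
      if yk: "y \<in> img (thomas_cone N) k" for y
    proof (intro conjI allI)
      obtain x0 x where y: "y = (x0, x)" and x: "x0 > 0" "x \<in> img N i"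
        using yk[unfolded img] by auto
      have sx: "s i x > 0" by (rule scale_pos[OF N s i x(2)])
      show "\<nu> k y > 0" using x sx by (simp add: \<nu>_def k y)
      fix X
      have sd: "((\<lambda>y. s i (snd y)) has_derivative (\<lambda>X. fd (s i) x (snd X))) (at (x0, x))"
        by (rule has_derivative_compose_snd[OF smooth_on_has_derivative[OF smooth_scale[OF N s i] x(2)]])
      have "(\<nu> k has_derivative (\<lambda>X. x0 ^ ?n * (real (?n + 1) * fd (s i) x (snd X) * s i x ^ ?n)
          + real ?n * fst X * x0 ^ (?n - 1) * s i x ^ (?n + 1))) (at (x0, x))"
        unfolding \<nu>_def k prod.case
        using has_derivative_mult[OF has_derivative_power[OF has_derivative_fst[OF
            has_derivative_ident[of "at (x0, x)"]], of ?n]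
            has_derivative_power[OF sd, of "?n + 1"]] by simp
      from fd_eqI[OF this] have d: "fd (\<nu> k) y X = x0 ^ ?n * (real (?n + 1) * fd (s i) x (snd X) *
          s i x ^ ?n)
          + real ?n * fst X * x0 ^ (?n - 1) * s i x ^ (?n + 1)" by (simp add: y)
      have tr: "eucl_trace (thomas_connection N P k y X) =
          (real ?n + 1) * (fd (s i) x (snd X) / s i x) + real ?n * (fst X / x0)"
        using trace_thomas_connection[OF s i x(2,1), of "fst X" "snd X"] by (simp add: k y)
      have \<nu>: "\<nu> k y = x0 ^ ?n * s i x ^ (?n + 1)" by (simp add: k y \<nu>_def)
      have pw: "x0 ^ ?n = x0 * x0 ^ (?n - 1)" using n by (cases ?n) auto
      show "fd (\<nu> k) y X - eucl_trace (thomas_connection N P k y X) * \<nu> k y = 0"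
        unfolding d tr \<nu> pw using x(1) sx by (simp add: field_simps)
    qed
    moreover have "\<nu> l (trans_map (thomas_cone N) k l y) * abs_jac_det (thomas_cone N) k l y = \<nu> k y"
      if lk: "l \<in> indices (thomas_cone N)" and y: "y \<in> overlap (thomas_cone N) k l" for l y
    proof -
      obtain s' j where l: "l = (s', j)" and s': "is_scale N s'" and j: "j \<in> indices N" using lk by auto
      obtain x0 x where xy: "y = (x0, x)" and x0: "x0 > 0" and x: "x \<in> overlap N i j"
        using y unfolding k l overlap_thomas_cone[OF N s s' i j] by auto
      have x': "x \<in> img N i" using x overlap_subset_img[of N i j] by blast
      define f where "f = (\<lambda>y. s i y / s' i y)"
      note pos = scale_pos_overlap[OF N s i j x] scale_pos_overlap[OF N s' i j x]
      have fx: "f x > 0" using pos by (simp add: f_def)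
      have lin: "linear (\<lambda>u. x0 * fd f x u)"
        using linear_compose[OF has_derivative_linear[OF smooth_on_has_derivative[OF
            smooth_scale_ratio[OF N s s' i i] x', folded f_def]]
            bounded_linear.linear[OF bounded_linear_mult_right[of x0]]] by (simp add: o_def)
      have "jac (thomas_cone N) k l y = (\<lambda>(a, u). (a * f x + x0 * fd f x u, jac N i j x u))"
        by (intro ext) (simp add: xy k l jac_thomas_cone[OF N s s' i j x x0] f_def case_prod_beta)
      then have "eucl_det (jac (thomas_cone N) k l y) = f x * eucl_det (jac N i j x)"
        using eucl_det_block_triangular[OF lin linear_jac[OF N i j x], of "f x"] by simp
      then have "abs_jac_det (thomas_cone N) k l y = f x * abs_jac_det N i j x"
        using fx by (simp add: abs_jac_det_def abs_mult)
      \<comment> \<open>The determinant on N is expressed through the target scale s', so that the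
        powers of \<open>s' j\<close> cancel and \<open>f x * s' i x\<close> becomes
        \<open>s i x\<close>. The missing factor f comes from the radial entry of the
        Jacobian.\<close>
      also have "abs_jac_det N i j x = (s' i x / s' j (trans_map N i j x)) ^ (?n + 1)"
        using abs_jac_det_scale[OF N s' i j x] by simp
      finally have d: "abs_jac_det (thomas_cone N) k l y = f x * (s' i x / s' j (trans_map N i j
          x)) ^ (?n + 1)" .
      have "\<nu> l (trans_map (thomas_cone N) k l y) * abs_jac_det (thomas_cone N) k l y =
        (x0 * f x) ^ ?n * s' j (trans_map N i j x) ^ (?n + 1) * (f x * (s' i x / s' j (trans_map N
            i j x)) ^ (?n + 1))"
        unfolding d by (simp add: \<nu>_def xy k l trans_map_thomas_cone[OF N s s' i j x x0] f_def)
      also have "\<dots> = x0 ^ ?n * (f x * s' i x) ^ (?n + 1)"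
        using pos by (simp add: power_mult_distrib power_divide)
      also have "f x * s' i x = s i x" using pos by (simp add: f_def)
      finally show ?thesis by (simp add: \<nu>_def xy k)
    qed
    ultimately show "smooth_on (img (thomas_cone N) k) (\<nu> k) \<and>
      (\<forall>y\<in>img (thomas_cone N) k. \<nu> k y > 0 \<and>
         (\<forall>X. fd (\<nu> k) y X - eucl_trace (thomas_connection N P k y X) * \<nu> k y = 0)) \<and>
      (\<forall>l\<in>indices (thomas_cone N). \<forall>y\<in>overlap (thomas_cone N) k l.
         \<nu> l (trans_map (thomas_cone N) k l y) * abs_jac_det (thomas_cone N) k l y = \<nu> k y)" by blast
  qed
  then show ?thesis
    unfolding special_connection_def using torsion_free_thomas_connection by blast
qed

end

section \<open>The ambient space\<close>

lemma indices_ambient_space [simp]: "indices (ambient_space M) = indices M"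
  by (simp add: ambient_space_def)

lemma points_ambient_space [simp]: "points (ambient_space M) = {0<..} \<times> points M \<times> UNIV"
  by (simp add: ambient_space_def)

lemma cdom_ambient_space [simp]: "cdom (ambient_space M) i = {0<..} \<times> cdom M i \<times> UNIV"
  by (simp add: ambient_space_def)

lemma coord_ambient_space [simp]: "coord (ambient_space M) i (t, m, \<rho>) = (t, coord M i m, \<rho>)"
  by (simp add: ambient_space_def)

lemma overlap_ambient_space: "overlap (ambient_space M) i j = {0<..} \<times> overlap M i j \<times> UNIV"
proof (intro set_eqI iffI)
  fix y assume "y \<in> {0::real<..} \<times> overlap M i j \<times> (UNIV :: real set)"
  then obtain t q \<rho> where "t > 0" "q \<in> cdom M i" "q \<in> cdom M j" "y = (t, coord M i q, \<rho>)"
    by (auto simp: overlap_def)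
  then show "y \<in> overlap (ambient_space M) i j"
    unfolding overlap_def by (intro image_eqI[of _ _ "(t, q, \<rho>)"]) auto
qed (auto simp: overlap_def)

lemma img_ambient_space: "img (ambient_space M) i = {0<..} \<times> img M i \<times> UNIV"
  by (simp add: img_eq_overlap overlap_ambient_space)

lemma smooth_atlas_ambient_space:
  assumes M: "smooth_atlas M"
  shows "smooth_atlas (ambient_space M)"
  unfolding smooth_atlas_def
proof (intro conjI ballI)
  show "(\<Union>i\<in>indices (ambient_space M). cdom (ambient_space M) i) = points (ambient_space M)"
    by (auto simp: atlas_cover[OF M, symmetric])
  fix i assume "i \<in> indices (ambient_space M)"
  then have i: "i \<in> indices M" by simp
  show inj: "inj_on (coord (ambient_space M) i) (cdom (ambient_space M) i)"
    using atlas_inj[OF M i] by (auto simp: inj_on_def)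
  fix j assume "j \<in> indices (ambient_space M)"
  then have j: "j \<in> indices M" by simp
  have o: "open ({0::real<..} \<times> overlap M i j \<times> (UNIV :: real set))"
    using open_overlap[OF M i j] by (intro open_Times) auto
  show "open (overlap (ambient_space M) i j)"
    unfolding overlap_ambient_space by (rule o)
  have o': "open (overlap M i j \<times> (UNIV :: real set))" using open_overlap[OF M i j] by (simp add:
      open_Times)
  have tr: "trans_map (ambient_space M) i j (t, x, \<rho>) = (t, trans_map M i j x, \<rho>)"
    if x: "x \<in> overlap M i j" and t: "t > 0" for t x \<rho>
  proof -
    obtain q where q: "q \<in> cdom M i" "q \<in> cdom M j" "x = coord M i q" using x by (rule overlapE)
    have "trans_map (ambient_space M) i j (coord (ambient_space M) i (t, q, \<rho>)) = coord
        (ambient_space M) j (t, q, \<rho>)"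
      by (rule trans_map_coord[OF inj]) (use q t in simp)
    then show ?thesis using q atlas_trans_map_coord[OF M i q(1), of j] by simp
  qed
  have "smooth_on ({0::real<..} \<times> overlap M i j \<times> (UNIV :: real set))
      (\<lambda>y. (fst y, (\<lambda>z. (trans_map M i j (fst z), snd z)) (snd y)))"
    by (rule smooth_on_Pair[OF o smooth_on_fst[OF o smooth_on_ident[OF o]]
          smooth_on_compose_snd[OF o smooth_on_Pair[OF o' smooth_on_compose_fst[OF o'
              smooth_trans_map[OF M i j]]
              smooth_on_snd[OF o' smooth_on_ident[OF o']]]]])
  then show "smooth_on (overlap (ambient_space M) i j) (trans_map (ambient_space M) i j)"
    unfolding overlap_ambient_space by (rule smooth_on_cong[OF o]) (auto simp: tr)
qed

section \<open>The two constructions\<close>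

lemma indices_weighted_cotangent [simp]: "indices (weighted_cotangent w N) = indices N"
  by (simp add: weighted_cotangent_def)

context
  fixes N :: "('i, 'a, 'v::euclidean_space) atlas" and s
  assumes N: "smooth_atlas N" and s: "is_scale N s"
begin

definition scale_chart :: "'i \<Rightarrow> 'v \<times> 'v \<Rightarrow> 'v \<times> 'v" where
  "scale_chart i y = (fst y, inverse ((s i (fst y))\<^sup>2) *\<^sub>R snd y)"

definition scale_chart_inv :: "'i \<Rightarrow> 'v \<times> 'v \<Rightarrow> 'v \<times> 'v" where
  "scale_chart_inv i y = (fst y, (s i (fst y))\<^sup>2 *\<^sub>R snd y)"

lemmas smooth_atlas_cotangent = smooth_atlas_covector_bundle[OF N weight_cocycle_1[OF N], folded
    cotangent_def]
lemmas img_cotangent = img_covector_bundle[OF N weight_cocycle_1[OF N], folded cotangent_def]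
lemmas smooth_atlas_weighted_cotangent =
  smooth_atlas_covector_bundle[OF N weight_cocycle_minus_2[OF N s], folded weighted_cotangent_def]
lemmas img_weighted_cotangent =
  img_covector_bundle[OF N weight_cocycle_minus_2[OF N s], folded weighted_cotangent_def]

text \<open>The factor of weight -2 is the change of s to the power -2 between the charts, which is
  what the division by the square of s introduces.\<close>

lemma scale_iso_in_points:
  assumes "(q, \<eta>) \<in> points (cotangent N)"
  shows "scale_iso N s (q, \<eta>) \<in> points (weighted_cotangent (-2) N)"
proof -
  have "(\<eta> j /\<^sub>R (s j (coord N j q))\<^sup>2) \<bullet> jac N i j (coord N i q) v =
      weight_factor (-2) N i j (coord N i q) * ((\<eta> i /\<^sub>R (s i (coord N i q))\<^sup>2) \<bullet> v)"
    if ij: "i \<in> indices N" "j \<in> indices N" "q \<in> cdom N i" "q \<in> cdom N j" for i j v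
  proof -
    have x: "coord N i q \<in> overlap N i j" using ij by (simp add: coord_in_overlap_iff[OF N])
    have y: "trans_map N i j (coord N i q) = coord N j q" using ij by (simp add:
        atlas_trans_map_coord[OF N])
    have "\<eta> j \<bullet> jac N i j (coord N i q) v = \<eta> i \<bullet> v"
      using assms ij by (simp add: cotangent_def points_covector_bundle)
    then show ?thesis
      using weight_factor_minus_2_scale[OF N s ij(1,2) x] scale_pos_overlap[OF N s ij(1,2) x]
      by (simp add: y power_divide field_simps)
  qed
  then show ?thesis
    using assms by (auto simp: scale_iso_def weighted_cotangent_def cotangent_def points_covector_bundle)
qed

lemma smooth_scale_chart_inv: "i \<in> indices N \<Longrightarrow> smooth_on (img N i \<times> UNIV) (scale_chart_inv i)"
proof -
  assume i: "i \<in> indices N"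
  have o: "open (img N i \<times> (UNIV :: 'v set))" using open_img[OF N i] by (simp add: open_Times)
  show ?thesis unfolding scale_chart_inv_def[abs_def]
    by (intro smooth_intros o smooth_on_compose_fst[OF o smooth_scale[OF N s i]])
qed

lemma chartwise_diffeo_scale_iso:
  "chartwise_diffeo (cotangent N) (weighted_cotangent (-2) N) (scale_iso N s) (\<lambda>i. i) scale_chart
      scale_chart_inv"
proof
  show "smooth_atlas (cotangent N)" by (rule smooth_atlas_cotangent)
  show "smooth_atlas (weighted_cotangent (-2) N)" by (rule smooth_atlas_weighted_cotangent)
  show "i \<in> indices (cotangent N)" if "i \<in> indices (weighted_cotangent (-2) N)" for i using that by simp
  show "\<exists>i\<in>indices (weighted_cotangent (-2) N). q \<in> cdom (cotangent N) i" if "q \<in> points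
      (cotangent N)" for q
    using that atlas_cover[OF smooth_atlas_cotangent] by auto
  show "scale_iso N s q \<in> cdom (weighted_cotangent (-2) N) i \<longleftrightarrow> q \<in> cdom (cotangent N) i"
    if "q \<in> points (cotangent N)" for q i
    using that scale_iso_in_points[of "fst q" "snd q"]
    by (cases q) (auto simp: weighted_cotangent_def cotangent_def cdom_covector_bundle scale_iso_def)
  show "coord (weighted_cotangent (-2) N) i (scale_iso N s q) = scale_chart i (coord (cotangent N)
      i q)" for i q
    by (cases q) (simp add: weighted_cotangent_def cotangent_def scale_iso_def scale_chart_def)
  fix i assume "i \<in> indices (weighted_cotangent (-2) N)"
  then have i: "i \<in> indices N" by simp
  note img = img_cotangent[OF i] img_weighted_cotangent[OF i]
  have pos: "s i x > 0" if "x \<in> img N i" for x using scale_pos[OF N s i that] .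
  have o: "open (img N i \<times> (UNIV :: 'v set))" using open_img[OF N i] by (simp add: open_Times)
  have "smooth_on (img N i \<times> (UNIV :: 'v set)) (\<lambda>y. inverse ((s i (fst y))\<^sup>2))"
    by (rule smooth_on_inverse[OF o smooth_on_power[OF o smooth_on_compose_fst[OF o
        smooth_scale[OF N s i]]]])
      (use pos in fastforce)
  then show "smooth_on (img (cotangent N) i) (scale_chart i)"
    unfolding img scale_chart_def[abs_def]
    by (intro smooth_on_Pair smooth_on_scaleR smooth_on_fst smooth_on_snd smooth_on_ident o)
  show "smooth_on (img (weighted_cotangent (-2) N) i) (scale_chart_inv i)"
    unfolding img by (rule smooth_scale_chart_inv[OF i])
  show "scale_chart_inv i (scale_chart i y) = y" if "y \<in> img (cotangent N) i" for y
    using that pos[of "fst y"] by (cases y) (auto simp: img scale_chart_def scale_chart_inv_def)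
  show "scale_chart_inv i y \<in> img (cotangent N) i" "scale_chart i (scale_chart_inv i y) = y"
    if "y \<in> img (weighted_cotangent (-2) N) i" for y
    using that pos[of "fst y"] by (cases y, auto simp: img scale_chart_def scale_chart_inv_def)+
qed

section \<open>The identification in coordinates\<close>

definition ident_chart :: "'i \<Rightarrow> (real \<times> 'v) \<times> (real \<times> 'v) \<Rightarrow> real \<times> ('v \<times> 'v) \<times> real" where
  "ident_chart i y = (fst (fst y), scale_chart i (snd (fst y), inverse ((fst (fst y))\<^sup>2) *\<^sub>R snd (snd y)),
     fst (snd y) / fst (fst y))"

definition ident_chart_inv :: "'i \<Rightarrow> real \<times> ('v \<times> 'v) \<times> real \<Rightarrow> (real \<times> 'v) \<times> (real \<times> 'v)" where
  "ident_chart_inv i y = ((fst y, fst (fst (snd y))),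
     (fst y * snd (snd y), (fst y)\<^sup>2 *\<^sub>R snd (scale_chart_inv i (fst (snd y)))))"

lemmas smooth_atlas_cone = smooth_atlas_thomas_cone[OF N s]
lemmas smooth_atlas_cotangent_cone =
  smooth_atlas_covector_bundle[OF smooth_atlas_cone weight_cocycle_1[OF smooth_atlas_cone], folded
      cotangent_def]
lemmas img_cotangent_cone =
  img_covector_bundle[OF smooth_atlas_cone weight_cocycle_1[OF smooth_atlas_cone], folded cotangent_def]

text \<open>For equal scales the ratio s / s is constantly 1, so the Jacobian does not mix radial
  and base directions. This is why x0, y0 and the covector part of a point of the cotangent bundle
  make sense for a fixed scale without reference to a chart of N.\<close>

lemma jac_cone_same_scale:
  assumes ij: "i \<in> indices N" "j \<in> indices N" and x: "x \<in> overlap N i j" "x0 > 0"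
  shows "jac (thomas_cone N) (s, i) (s, j) (x0, x) X = (fst X, jac N i j x (snd X))"
proof -
  have x': "x \<in> img N i" using x overlap_subset_img[of N i j] by blast
  have "fd (\<lambda>y. s i y / s i y) x = fd (\<lambda>y. 1) x"
    by (rule fd_cong[OF open_img[OF N ij(1)] x']) (use scale_pos[OF N s ij(1)] in fastforce)
  then show ?thesis
    using scale_pos[OF N s ij(1) x'] by (simp add: jac_thomas_cone[OF N s s ij x])
qed

text \<open>Frees \<open>identification\<close> from its choice of a chart. The block-diagonal
  Jacobian makes the radial component of \<eta> independent of the chart and lets the base
  components transform as a covector on N.\<close>

lemma identification_eq:
  assumes \<eta>: "((q, \<sigma>), \<eta>) \<in> points (cotangent (thomas_cone N))" and i: "i \<in> indices N" "q \<in> cdom N i"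
  shows "identification N s ((q, \<sigma>), \<eta>) = (\<sigma> i / s i (coord N i q),
    scale_iso N s (q, \<lambda>j. snd (\<eta> (s, j)) /\<^sub>R (\<sigma> i / s i (coord N i q))\<^sup>2), fst (\<eta> (s, i)) / (\<sigma> i / s
        i (coord N i q)))"
    and "(q, \<lambda>j. snd (\<eta> (s, j)) /\<^sub>R (\<sigma> i / s i (coord N i q))\<^sup>2) \<in> points (cotangent N)"
proof -
  have q: "(q, \<sigma>) \<in> points (thomas_cone N)" using \<eta> by (simp add: cotangent_def points_covector_bundle)
  have comp: "\<eta> (s, k) \<bullet> (a, jac N j k (coord N j q) u) = \<eta> (s, j) \<bullet> (a, u)"
    if jk: "j \<in> indices N" "k \<in> indices N" "q \<in> cdom N j" "q \<in> cdom N k" for j k a u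
  proof -
    have x: "coord N j q \<in> overlap N j k" using jk by (simp add: coord_in_overlap_iff[OF N])
    have "(s, j) \<in> indices (thomas_cone N)" "(s, k) \<in> indices (thomas_cone N)" "(q, \<sigma>) \<in> cdom
        (thomas_cone N) (s, j) \<inter> cdom (thomas_cone N) (s, k)"
      using jk s q by (auto simp: cdom_thomas_cone)
    then have "\<eta> (s, k) \<bullet> jac (thomas_cone N) (s, j) (s, k) (coord (thomas_cone N) (s, j) (q, \<sigma>))
        (a, u) = \<eta> (s, j) \<bullet> (a, u)"
      using \<eta> unfolding cotangent_def points_covector_bundle by fastforce
    then show ?thesis
      using jac_cone_same_scale[OF jk(1,2) x thomas_component_pos[OF N s q jk(1,3)]] by simp
  qed
  define i0 where "i0 = (SOME i. i \<in> indices N \<and> q \<in> cdom N i)"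
  have i0: "i0 \<in> indices N" "q \<in> cdom N i0"
    using someI[of "\<lambda>i. i \<in> indices N \<and> q \<in> cdom N i", OF conjI[OF i]] by (auto simp: i0_def)
  have r: "\<sigma> i0 / s i0 (coord N i0 q) = \<sigma> i / s i (coord N i q)"
    by (rule thomas_component_ratio[OF N s q i(1) i0(1) i(2) i0(2)])
  have J0: "jac N i i0 (coord N i q) 0 = 0"
    using linear_0[OF linear_jac[OF N i(1) i0(1)]] i i0 by (simp add: coord_in_overlap_iff[OF N])
  \<comment> \<open>Pairing with the radial vector (1, 0) isolates the radial component.\<close>
  have "fst (\<eta> (s, i0)) = fst (\<eta> (s, i))"
    using comp[OF i(1) i0(1) i(2) i0(2), of 1 0] by (simp add: inner_prod_def J0)
  then show "identification N s ((q, \<sigma>), \<eta>) = (\<sigma> i / s i (coord N i q),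
    scale_iso N s (q, \<lambda>j. snd (\<eta> (s, j)) /\<^sub>R (\<sigma> i / s i (coord N i q))\<^sup>2), fst (\<eta> (s, i)) / (\<sigma> i / s
        i (coord N i q)))"
    using r by (simp add: identification_def Let_def i0_def[symmetric])
  have "snd (\<eta> (s, k)) \<bullet> jac N j k (coord N j q) u = snd (\<eta> (s, j)) \<bullet> u"
    if jk: "j \<in> indices N" "k \<in> indices N" "q \<in> cdom N j" "q \<in> cdom N k" for j k u
    using comp[OF jk, of 0 u] by (simp add: inner_prod_def)
  moreover have "\<eta> (s, j) = 0" if "\<not> (j \<in> indices N \<and> q \<in> cdom N j)" for j
    using \<eta> that by (auto simp: cotangent_def points_covector_bundle cdom_thomas_cone)
  moreover have "q \<in> points N" using i atlas_cover[OF N] by blast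
  ultimately show "(q, \<lambda>j. snd (\<eta> (s, j)) /\<^sub>R (\<sigma> i / s i (coord N i q))\<^sup>2) \<in> points (cotangent N)"
    by (auto simp: cotangent_def points_covector_bundle)
qed

lemma smooth_ident_chart_inv:
  assumes i: "i \<in> indices N"
  shows "smooth_on ({0<..} \<times> (img N i \<times> UNIV) \<times> UNIV) (ident_chart_inv i)"
proof -
  let ?U = "{0::real<..} \<times> (img N i \<times> (UNIV :: 'v set)) \<times> (UNIV :: real set)"
  have o: "open ?U" using open_img[OF N i] by (intro open_Times) auto
  have o': "open ((img N i \<times> (UNIV :: 'v set)) \<times> (UNIV :: real set))"
    using open_img[OF N i] by (intro open_Times) auto
  have "smooth_on ?U (\<lambda>y. (\<lambda>z. scale_chart_inv i (fst z)) (snd y))"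
    by (rule smooth_on_compose_snd[OF o smooth_on_compose_fst[OF o' smooth_scale_chart_inv[OF i]]])
  then show ?thesis unfolding ident_chart_inv_def[abs_def] by (intro smooth_intros o)
qed

lemma chartwise_diffeo_identification:
  "chartwise_diffeo (cotangent (thomas_cone N)) (ambient_space (weighted_cotangent (-2) N))
      (identification N s)
     (\<lambda>i. (s, i)) ident_chart ident_chart_inv"
proof
  let ?M = "weighted_cotangent (-2) N"
  show "smooth_atlas (cotangent (thomas_cone N))" by (rule smooth_atlas_cotangent_cone)
  show "smooth_atlas (ambient_space ?M)" by (rule smooth_atlas_ambient_space[OF
      smooth_atlas_weighted_cotangent])
  show "(s, i) \<in> indices (cotangent (thomas_cone N))" if "i \<in> indices (ambient_space ?M)" for i
      using that s by simp
  show "\<exists>i\<in>indices (ambient_space ?M). c \<in> cdom (cotangent (thomas_cone N)) (s, i)" if c: "c \<in>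
      points (cotangent (thomas_cone N))" for c
  proof -
    obtain q \<sigma> \<eta> where c': "c = ((q, \<sigma>), \<eta>)" by (metis surj_pair)
    have q: "(q, \<sigma>) \<in> points (thomas_cone N)" using c by (simp add: c' cotangent_def
        points_covector_bundle)
    then have "q \<in> points N" by (simp add: points_thomas_cone)
    then obtain i where "i \<in> indices N" "q \<in> cdom N i" using atlas_cover[OF N] by blast
    then show ?thesis
      using c q by (intro bexI[of _ i]) (auto simp: c' cotangent_def cdom_covector_bundle
          cdom_thomas_cone)
  qed
  show "identification N s c \<in> cdom (ambient_space ?M) i \<longleftrightarrow> c \<in> cdom (cotangent (thomas_cone N)) (s, i)"
    if c: "c \<in> points (cotangent (thomas_cone N))" and "i \<in> indices (ambient_space ?M)" for c i
  proof -
    obtain q \<sigma> \<eta> where c': "c = ((q, \<sigma>), \<eta>)" by (metis surj_pair)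
    have q: "(q, \<sigma>) \<in> points (thomas_cone N)" using c by (simp add: c' cotangent_def
        points_covector_bundle)
    then have "q \<in> points N" by (simp add: points_thomas_cone)
    then obtain k where k: "k \<in> indices N" "q \<in> cdom N k" using atlas_cover[OF N] by blast
    note eq = identification_eq[OF c[unfolded c'] k]
    have "scale_iso N s (q, \<lambda>j. snd (\<eta> (s, j)) /\<^sub>R (\<sigma> k / s k (coord N k q))\<^sup>2) \<in> cdom ?M i \<longleftrightarrow> q \<in> cdom N i"
      using scale_iso_in_points[OF eq(2)] by (simp add: weighted_cotangent_def
          cdom_covector_bundle scale_iso_def)
    then show ?thesis
      unfolding c' eq(1) using c q thomas_component_pos[OF N s q k]
      by (simp add: c' cotangent_def cdom_covector_bundle cdom_thomas_cone)
  qed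
  fix i assume "i \<in> indices (ambient_space ?M)"
  then have i: "i \<in> indices N" by simp
  show "coord (ambient_space ?M) i (identification N s c) = ident_chart i (coord (cotangent
      (thomas_cone N)) (s, i) c)"
    if c: "c \<in> cdom (cotangent (thomas_cone N)) (s, i)" for c
  proof -
    obtain q \<sigma> \<eta> where c': "c = ((q, \<sigma>), \<eta>)" by (metis surj_pair)
    have cp: "((q, \<sigma>), \<eta>) \<in> points (cotangent (thomas_cone N))" and q: "q \<in> cdom N i"
      using c by (auto simp: c' cotangent_def cdom_covector_bundle cdom_thomas_cone)
    show ?thesis
      unfolding c' identification_eq(1)[OF cp i q]
      by (simp add: ident_chart_def scale_chart_def weighted_cotangent_def cotangent_def scale_iso_def)
  qed
  have img: "img (cotangent (thomas_cone N)) (s, i) = ({0<..} \<times> img N i) \<times> UNIV"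
    using img_cotangent_cone[of "(s, i)"] s i by (simp add: img_thomas_cone[OF N s i])
  have imgM: "img (ambient_space ?M) i = {0<..} \<times> (img N i \<times> UNIV) \<times> UNIV"
    by (simp add: img_ambient_space img_weighted_cotangent[OF i])
  have pos: "s i x > 0" if "x \<in> img N i" for x using scale_pos[OF N s i that] .
  let ?U = "({0::real<..} \<times> img N i) \<times> (UNIV :: (real \<times> 'v) set)"
  have o: "open ?U" using open_img[OF N i] by (intro open_Times) auto
  have o': "open ({0::real<..} \<times> img N i)" using open_img[OF N i] by (intro open_Times) auto
  have t: "smooth_on ?U (\<lambda>y. fst (fst y))" and x: "smooth_on ?U (\<lambda>y. snd (fst y))"
    by (intro smooth_intros o)+
  have sx: "smooth_on ?U (\<lambda>y. (\<lambda>z. s i (snd z)) (fst y))"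
    by (rule smooth_on_compose_fst[OF o smooth_on_compose_snd[OF o' smooth_scale[OF N s i]]])
  have "smooth_on ?U (\<lambda>y. inverse ((s i (snd (fst y)))\<^sup>2))"
    by (rule smooth_on_inverse[OF o smooth_on_power[OF o sx]]) (use pos in fastforce)
  moreover have "smooth_on ?U (\<lambda>y. inverse ((fst (fst y))\<^sup>2))"
    by (rule smooth_on_inverse[OF o smooth_on_power[OF o t]]) auto
  moreover have "smooth_on ?U (\<lambda>y. fst (snd y) / fst (fst y))"
    by (rule smooth_on_divide[OF o smooth_on_fst[OF o smooth_on_snd[OF o smooth_on_ident[OF o]]] t]) auto
  ultimately show "smooth_on (img (cotangent (thomas_cone N)) (s, i)) (ident_chart i)"
    unfolding img ident_chart_def[abs_def] scale_chart_def fst_conv snd_conv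
    by (intro smooth_on_Pair smooth_on_scaleR smooth_on_snd smooth_on_ident o t x)
  show "smooth_on (img (ambient_space ?M) i) (ident_chart_inv i)"
    unfolding imgM by (rule smooth_ident_chart_inv[OF i])
  show "ident_chart_inv i (ident_chart i y) = y" if y: "y \<in> img (cotangent (thomas_cone N)) (s, i)" for y
  proof -
    obtain x0 x y0 p where y': "y = ((x0, x), (y0, p))" by (metis surj_pair)
    then have "x0 > 0" "x \<in> img N i" using y[unfolded img] by auto
    then show ?thesis using pos[of x]
      by (simp add: y' ident_chart_def ident_chart_inv_def scale_chart_def scale_chart_inv_def
          field_simps)
  qed
  show "ident_chart_inv i y \<in> img (cotangent (thomas_cone N)) (s, i)" "ident_chart i
      (ident_chart_inv i y) = y"
    if y: "y \<in> img (ambient_space ?M) i" for y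
  proof -
    obtain t x p \<rho> where y': "y = (t, (x, p), \<rho>)" by (metis surj_pair)
    then have "t > 0" "x \<in> img N i" using y[unfolded imgM] by auto
    then show "ident_chart_inv i y \<in> img (cotangent (thomas_cone N)) (s, i)" "ident_chart i
        (ident_chart_inv i y) = y"
      using pos[of x]
      by (simp_all add: img y' ident_chart_def ident_chart_inv_def scale_chart_def
          scale_chart_inv_def field_simps)
  qed
qed

text \<open>The derivative of \<open>scale_chart_inv\<close> is left unevaluated: the same vector
  enters \<open>induced_metric\<close>, so the derivatives of s never have to be computed.\<close>

lemma fd_ident_chart_inv:
  assumes i: "i \<in> indices N" and x: "x \<in> img N i" and t: "t > 0"
  shows "fd (ident_chart_inv i) (t, (x, p), \<rho>) (a, (u, \<beta>), b) =
    ((a, u), (a * \<rho> + t * b, (2 * t * a) *\<^sub>R snd (scale_chart_inv i (x, p)) +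
       t\<^sup>2 *\<^sub>R snd (fd (scale_chart_inv i) (x, p) (u, \<beta>))))"
    and "fst (fd (scale_chart_inv i) (x, p) (u, \<beta>)) = u"
proof -
  have o: "open (img N i \<times> (UNIV :: 'v set))" using open_img[OF N i] by (simp add: open_Times)
  have c: "(scale_chart_inv i has_derivative fd (scale_chart_inv i) (x, p)) (at (x, p))"
    by (rule smooth_on_has_derivative[OF smooth_scale_chart_inv[OF i]]) (use x in simp)
  have "fd (\<lambda>y. fst (scale_chart_inv i y)) (x, p) = fst"
    by (rule fd_eqI) (auto simp: scale_chart_inv_def intro!: derivative_eq_intros)
  then show "fst (fd (scale_chart_inv i) (x, p) (u, \<beta>)) = u"
    using fd_fst[OF differentiableI[OF c], of "(u, \<beta>)"] by simp
  let ?y = "(t, (x, p), \<rho>)"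
  have 1: "((\<lambda>y. scale_chart_inv i (fst (snd y))) has_derivative (\<lambda>X. fd (scale_chart_inv i) (x,
      p) (fst (snd X)))) (at ?y)"
    using c by (intro has_derivative_compose[of "\<lambda>y. fst (snd y)" "\<lambda>X. fst (snd X)" ?y UNIV
        "scale_chart_inv i"])
      (auto intro!: derivative_eq_intros)
  have 2: "((\<lambda>y. fst y * snd (snd y)) has_derivative (\<lambda>X. fst X * \<rho> + t * snd (snd X))) (at ?y)"
    by (auto intro!: derivative_eq_intros)
  have 3: "((\<lambda>y. (fst y)\<^sup>2) has_derivative (\<lambda>X. 2 * t * fst X)) (at ?y)"
    by (auto intro!: derivative_eq_intros)
  have 4: "((\<lambda>y. (fst y, fst (fst (snd y)))) has_derivative (\<lambda>X. (fst X, fst (fst (snd X))))) (at ?y)"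
    by (auto intro!: derivative_eq_intros)
  have "(ident_chart_inv i has_derivative (\<lambda>X. ((fst X, fst (fst (snd X))),
    (fst X * \<rho> + t * snd (snd X), t\<^sup>2 *\<^sub>R snd (fd (scale_chart_inv i) (x, p) (fst (snd X))) +
       (2 * t * fst X) *\<^sub>R snd (scale_chart_inv i (x, p)))))) (at ?y)"
    unfolding ident_chart_inv_def[abs_def]
    using has_derivative_Pair[OF 4 has_derivative_Pair[OF 2 has_derivative_scaleR[OF 3
        has_derivative_snd[OF 1]]]] by simp
  from fd_eqI[OF this] show "fd (ident_chart_inv i) (t, (x, p), \<rho>) (a, (u, \<beta>), b) =
    ((a, u), (a * \<rho> + t * b, (2 * t * a) *\<^sub>R snd (scale_chart_inv i (x, p)) +
       t\<^sup>2 *\<^sub>R snd (fd (scale_chart_inv i) (x, p) (u, \<beta>))))" by (simp add: add.commute)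
qed

end

text \<open>With y0 = t \<rho> the pairing of dx0 and dy0 gives the terms in dt dt and dt d\<rho>.
  With y = t^2 q the differential of t^2 produces mixed terms in dt and dx, and the symbols 1 / t of
  the cone produce the same terms with the opposite sign; this is what the division by the square of
  x0 in the identification achieves. The radial symbol -t Ric / (n - 1), paired with t \<rho>,
  yields the part depending on \<rho>.\<close>

lemma patterson_walker_thomas_christoffel:
  fixes D :: "('i, 'v::euclidean_space) connection"
  assumes t: "t \<noteq> 0" and T: "T k = thomas_christoffel (D i)"
  shows "patterson_walker T k ((t, x), (t * \<rho>, t\<^sup>2 *\<^sub>R q))
      ((a, u), (a * \<rho> + t * b, (2 * t * a) *\<^sub>R q + t\<^sup>2 *\<^sub>R \<alpha>))
      ((a', u'), (a' * \<rho> + t * b', (2 * t * a') *\<^sub>R q + t\<^sup>2 *\<^sub>R \<alpha>')) =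
    t\<^sup>2 * (patterson_walker D i (x, q) (u, \<alpha>) (u', \<alpha>') +
      \<rho> / (real DIM('v) - 1) * (ricci (D i) x u u' + ricci (D i) x u' u))
    + 2 * \<rho> * a * a' + t * (a * b' + a' * b)"
proof -
  define m where "m = inverse (real DIM('v) - 1)"
  have T': "thomas_christoffel (D i) (t, x) (a, u) (b, v) = (- (t * m) * ricci (D i) x u v,
      D i x u v + (a / t) *\<^sub>R v + (b / t) *\<^sub>R u)" for a u b v
    by (simp add: thomas_christoffel_def m_def divide_inverse)
  have tt: "t\<^sup>2 * (c / t) = t * c" for c using t by (simp add: power2_eq_square)
  show ?thesis
    unfolding patterson_walker_def T prod.case T' divide_inverse[of \<rho>] m_def[symmetric]
    by (simp add: inner_prod_def inner_add_left inner_add_right inner_commute[of q] tt algebra_simps)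
      (simp add: power2_eq_square t algebra_simps)
qed

section \<open>The transported metric: normal form and Ricci flatness\<close>

context
  fixes N :: "('i, 'a, real^'n) atlas" and P s
  assumes N: "smooth_atlas N" and P: "projective_structure N P" and n: "CARD('n) \<ge> 2" and s:
      "is_scale N s"
begin

abbreviation (input) "weighted \<equiv> weighted_cotangent (-2) N"

interpretation scale_diffeo: chartwise_diffeo "cotangent N" weighted "scale_iso N s" "\<lambda>i. i"
    "scale_chart s" "scale_chart_inv s"
  by (rule chartwise_diffeo_scale_iso[OF N s])

interpretation ident_diffeo: chartwise_diffeo "cotangent (thomas_cone N)" "ambient_space weighted"
    "identification N s" "\<lambda>i. (s, i)" "ident_chart s" "ident_chart_inv s"
  by (rule chartwise_diffeo_identification[OF N s])

lemma pseudo_metric_induced: "pseudo_metric weighted CARD('n) CARD('n) (induced_metric N P s)"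
  using scale_diffeo.pseudo_metric_transport[OF
      pseudo_metric_patterson_walker[OF N torsion_free_scale_connection[OF N P n s]]]
  by (simp add: induced_metric_def)

lemma pseudo_metric_cotangent_cone:
  "pseudo_metric (cotangent (thomas_cone N)) (CARD('n) + 1) (CARD('n) + 1) (patterson_walker
      (thomas_connection N P))"
  using pseudo_metric_patterson_walker[OF smooth_atlas_thomas_cone[OF N s]
      torsion_free_thomas_connection[OF N P n]]
  by simp

abbreviation (input) "ambient_metric \<equiv> transport (cotangent (thomas_cone N)) (ambient_space weighted)
  (identification N s) (patterson_walker (thomas_connection N P))"

lemma ambient_metric_form:
  assumes i: "i \<in> indices N" and x: "x \<in> img N i" and t: "t > 0"
  shows "ambient_metric i (t, (x, p), \<rho>) (a, U, b) (a', U', b') =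
    t\<^sup>2 * (induced_metric N P s i (x, p) U U' + \<rho> / (real CARD('n) - 1) *
      (ricci (scale_connection N P s i) x (fst U) (fst U') + ricci (scale_connection N P s i) x
          (fst U') (fst U)))
    + 2 * \<rho> * a * a' + t * (a * b' + a' * b)"
proof -
  obtain u \<beta> u' \<beta>' where U: "U = (u, \<beta>)" "U' = (u', \<beta>')" by (metis surj_pair)
  note imgM = img_weighted_cotangent[OF N s i]
  have im: "i \<in> indices weighted" using i by simp
  have xp: "(x, p) \<in> img weighted i" using x by (simp add: imgM)
  have y: "(t, (x, p), \<rho>) \<in> img (ambient_space weighted) i" using xp t by (simp add: img_ambient_space)
  have ia: "i \<in> indices (ambient_space weighted)" using i by simp
  \<comment> \<open>The unweighted covector q = s^2 p. Both the induced metric and the ambient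
    metric are evaluated at it, so the weight drops out of their comparison.\<close>
  obtain q where q: "scale_chart_inv s i (x, p) = (x, q)" by (simp add: scale_chart_inv_def[OF N s])
  have ic: "ident_chart_inv s i (t, (x, p), \<rho>) = ((t, x), (t * \<rho>, t\<^sup>2 *\<^sub>R q))"
    by (simp add: ident_chart_inv_def[OF N s] q)
  note dc = fd_ident_chart_inv[OF N s i x t, of p]
  obtain \<alpha> where \<alpha>: "fd (scale_chart_inv s i) (x, p) (u, \<beta>) = (u, \<alpha>)"
    using dc(2)[of u \<beta>] by (metis prod.collapse)
  obtain \<alpha>' where \<alpha>': "fd (scale_chart_inv s i) (x, p) (u', \<beta>') = (u', \<alpha>')"
    using dc(2)[of u' \<beta>'] by (metis prod.collapse)
  have ind: "induced_metric N P s i (x, p) U U' = patterson_walker (scale_connection N P s) i (x,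
      q) (u, \<alpha>) (u', \<alpha>')"
    using scale_diffeo.transport_eq[OF pseudo_metric_patterson_walker[OF N
        torsion_free_scale_connection[OF N P n s]] im xp]
    by (simp add: induced_metric_def U q \<alpha> \<alpha>')
  have "ambient_metric i (t, (x, p), \<rho>) (a, U, b) (a', U', b') =
    patterson_walker (thomas_connection N P) (s, i) ((t, x), (t * \<rho>, t\<^sup>2 *\<^sub>R q))
      ((a, u), (a * \<rho> + t * b, (2 * t * a) *\<^sub>R q + t\<^sup>2 *\<^sub>R \<alpha>))
      ((a', u'), (a' * \<rho> + t * b', (2 * t * a') *\<^sub>R q + t\<^sup>2 *\<^sub>R \<alpha>'))"
    unfolding ident_diffeo.transport_eq[OF pseudo_metric_cotangent_cone ia y] ic U dc(1) q \<alpha> \<alpha>'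
        snd_conv ..
  also have "\<dots> = t\<^sup>2 * (induced_metric N P s i (x, p) U U' + \<rho> / (real CARD('n) - 1) *
      (ricci (scale_connection N P s i) x u u' + ricci (scale_connection N P s i) x u' u))
    + 2 * \<rho> * a * a' + t * (a * b' + a' * b)"
    unfolding ind
    using patterson_walker_thomas_christoffel[of t "thomas_connection N P" "(s, i)"
        "scale_connection N P s" i] t
    by (simp add: thomas_connection_eq)
  finally show ?thesis by (simp add: U)
qed

text \<open>In the canonical coordinates over the cone chart \<open>(s, i)\<close> the Levi-Civita
  symbols are explicit. Naturality turns the Ricci tensor of the transported metric into a pullback
  of Ric(v, w) + Ric(w, v) of the cone connection, and both summands vanish.\<close>

lemma ricci_flat_ambient_metric: "ricci_flat (ambient_space weighted) ambient_metric"
  unfolding ricci_flat_def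
proof (intro ballI allI)
  fix i y u v
  assume ia: "i \<in> indices (ambient_space weighted)" and y: "y \<in> img (ambient_space weighted) i"
  then have i: "i \<in> indices N" by simp
  have img: "img (cotangent (thomas_cone N)) (s, i) = img (thomas_cone N) (s, i) \<times> UNIV"
    by (rule img_cotangent_cone[OF N s]) (use s i in simp)
  note sc = torsion_free_connection_smooth_christoffel[OF smooth_atlas_thomas_cone[OF N s]
      torsion_free_thomas_connection[OF N P n], of "(s, i)"]
  have sc: "smooth_christoffel (img (thomas_cone N) (s, i)) (thomas_connection N P (s, i))"
    by (rule sc) (use s i in simp)
  have sym: "thomas_connection N P (s, i) z u v = thomas_connection N P (s, i) z v u"
    if "z \<in> img (thomas_cone N) (s, i)" for z u v
  proof -
    have "(s, i) \<in> indices (thomas_cone N)" using s i by simp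
    then show ?thesis
      using torsion_free_thomas_connection[OF N P n] that unfolding torsion_free_connection_def by blast
  qed
  let ?y = "ident_chart_inv s i y" and ?J = "fd (ident_chart_inv s i) y"
  have "ricci (levi_civita (ambient_metric i)) y u v =
    ricci (pw_christoffel (thomas_connection N P (s, i))) ?y (?J u) (?J v)"
  proof (rule ident_diffeo.ricci_levi_civita_transport[OF pseudo_metric_cotangent_cone _ _ _ ia y])
    show "smooth_christoffel (img (cotangent (thomas_cone N)) (s, i)) (pw_christoffel
        (thomas_connection N P (s, i)))"
      unfolding img by (rule smooth_christoffel_pw) (use sc sym in auto)
    show "2 * patterson_walker (thomas_connection N P) (s, i) z
        (pw_christoffel (thomas_connection N P (s, i)) z u v) w =
      koszul (patterson_walker (thomas_connection N P) (s, i)) z u v w"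
      if "z \<in> img (cotangent (thomas_cone N)) (s, i)" for z u v w
      using patterson_walker_koszul[of "img (thomas_cone N) (s, i)" "thomas_connection N P" "(s,
          i)" "fst z" "snd z" u v w]
        sc sym that unfolding img by (auto simp: mem_Times_iff)
    show "nondegenerate (patterson_walker (thomas_connection N P) (s, i) z)"
      if "z \<in> img (cotangent (thomas_cone N)) (s, i)" for z
      using nondegenerate_patterson_walker[of "thomas_connection N P" "(s, i)" "fst z" "snd z"]
        smooth_christoffel_bilinear[OF sc] that unfolding img by (auto simp: mem_Times_iff)
  qed
  also have "\<dots> = 0"
  proof -
    have "?y \<in> img (cotangent (thomas_cone N)) (s, i)" by (rule ident_diffeo.\<theta>'_in[OF ia y])
    then obtain t x q where y': "?y = ((t, x), q)" "t > 0" "x \<in> img N i" "(t, x) \<in> img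
        (thomas_cone N) (s, i)"
      unfolding img img_thomas_cone[OF N s i] by auto
    have "ricci (thomas_connection N P (s, i)) (t, x) X Y = 0" for X Y
      using ricci_thomas_christoffel[OF smooth_christoffel_scale_connection[OF N P n s i]
          scale_connection_symmetric[OF N P n s i] y'(3,2), of "fst X" "snd X" "fst Y" "snd Y"] n
      by (simp add: thomas_connection_eq)
    then show ?thesis
      using ricci_patterson_walker[of "img (thomas_cone N) (s, i)" "thomas_connection N P" "(s,
          i)" "(t, x)" q
          "fst (?J u)" "snd (?J u)" "fst (?J v)" "snd (?J v)"] sc sym y'(4)
      by (simp add: y'(1))
  qed
  finally show "ricci (levi_civita (ambient_metric i)) y u v = 0" .
qed

lemma ambient_metric_works:
  "ricci_flat_ambient_metric weighted CARD('n) CARD('n) (induced_metric N P s) ambient_metric"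
  unfolding ricci_flat_ambient_metric_def
proof (intro conjI pseudo_metric_induced ricci_flat_ambient_metric)
  show "pseudo_metric (ambient_space weighted) (CARD('n) + 1) (CARD('n) + 1) ambient_metric"
    by (rule ident_diffeo.pseudo_metric_transport[OF pseudo_metric_cotangent_cone])
  \<comment> \<open>Affine in \<rho>. The Ricci term is a sum over both orders of its arguments, the
    form in which the Patterson--Walker metric produces it; it involves base components only, being
    pulled back from N.\<close>
  define h where "h = (\<lambda>i y \<rho> U U'. induced_metric N P s i y U U' + \<rho> / (real CARD('n) - 1) *
      (ricci (scale_connection N P s i) (fst y) (fst U) (fst U') + ricci (scale_connection N P s
          i) (fst y) (fst U') (fst U)))"
  show "\<exists>h. \<forall>i\<in>indices weighted. \<forall>x\<in>img weighted i. (\<forall>u v. h i x 0 u v = induced_metric N P s i x u v) \<and>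
        (\<forall>t>0. \<forall>\<rho> a u b a' u' b'. ambient_metric i (t, x, \<rho>) (a, u, b) (a', u', b') =
             t\<^sup>2 * h i x \<rho> u u' + 2 * \<rho> * a * a' + t * (a * b' + a' * b))"
  proof (intro exI[of _ h] ballI conjI allI impI)
    show "h i x 0 u v = induced_metric N P s i x u v" for i x u v by (simp add: h_def)
    fix i y t \<rho> a u b a' u' b'
    assume "i \<in> indices weighted" and y: "y \<in> img weighted i" and t: "(t::real) > 0"
    then have i: "i \<in> indices N" by simp
    obtain x p where "y = (x, p)" "x \<in> img N i" using y unfolding img_weighted_cotangent[OF N s i]
        by auto
    then show "ambient_metric i (t, y, \<rho>) (a, u, b) (a', u', b') =
             t\<^sup>2 * h i y \<rho> u u' + 2 * \<rho> * a * a' + t * (a * b' + a' * b)"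
      using ambient_metric_form[OF i _ t] by (simp add: h_def)
  qed
qed

lemma diffeomorphism_identification:
  "diffeomorphism (cotangent (thomas_cone N)) (ambient_space weighted) (identification N s)"
  by (rule ident_diffeo.diffeomorphism_F)

lemma induced_metric_in_conformal_structure: "induced_metric N P s \<in> induced_conformal_structure N P"
proof -
  have "conformal_metrics weighted (induced_metric N P s) (induced_metric N P s)"
    unfolding conformal_metrics_def
    by (intro exI[of _ "\<lambda>i x. 1"])
      (auto simp: smooth_function_def intro!: smooth_on_const open_img[OF
          smooth_atlas_weighted_cotangent[OF N s]])
  then show ?thesis
    unfolding induced_conformal_structure_def using pseudo_metric_induced s by auto
qed

end

theorem theorem2:
  fixes N :: "('i, 'a, real^'n) atlas"
    and P :: "('i, real^'n) connection set"
    and s :: "'i \<Rightarrow> real^'n \<Rightarrow> real"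
  assumes "smooth_manifold N" and "CARD('n) \<ge> 2"
    and "projective_structure N P" and "is_scale N s"
  shows
    "let n = CARD('n);
         C = thomas_cone N;
         nabla = thomas_connection N P;
         M = weighted_cotangent (-2) N;
         \<Psi> = identification N s
     in special_connection C nabla \<and>
        diffeomorphism (cotangent C) (ambient_space M) \<Psi> \<and>
        ricci_flat_ambient_metric M n n (induced_metric N P s)
          (transport (cotangent C) (ambient_space M) \<Psi> (patterson_walker nabla)) \<and>
        (\<exists>g \<in> induced_conformal_structure N P. \<exists>G.
           ricci_flat_ambient_metric M n n g G \<and> is_patterson_walker_of C (ambient_space M) G)"
proof -
  note N = smooth_manifold_imp_smooth_atlas[OF assms(1)] and P = assms(3) and n = assms(2) and s =
      assms(4)
  note special = special_thomas_connection[OF N P n]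
    and diffeo = diffeomorphism_identification[OF N P n s]
    and ambient = ambient_metric_works[OF N P n s]
  have "is_patterson_walker_of (thomas_cone N) (ambient_space (weighted_cotangent (-2) N))
    (transport (cotangent (thomas_cone N)) (ambient_space (weighted_cotangent (-2) N))
        (identification N s)
      (patterson_walker (thomas_connection N P)))"
    unfolding is_patterson_walker_of_def using special diffeo by blast
  then show ?thesis
    unfolding Let_def
    using special diffeo ambient induced_metric_in_conformal_structure[OF N P n s] by blast
qed

end
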